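(* Let $d$ be prime and $N\ge1$, and let $(U_s,\kappa_s,\eta_s,\varrho_s)_{s\in S}$ be a fixed admissible stabilizer blow-up chart system. Let $\widehat\pi_{\theta_M}$, $\widehat P$ and $\widehat\pi$ be the corresponding blown-up stationary laws, affine tangent kernel, and the unique invariant probability measure of $\widehat P$. Let $0<\theta_n\le1$ with $\theta_n\downarrow0$, and suppose $\widehat\pi_{\theta_n}\Rightarrow\zeta$ weakly on $\widehat{\mathsf X}^\dagger$. Then $\zeta(\{\dagger\})=0$ and, viewing $\zeta$ as a probability measure on $\widehat{\mathsf X}$, $$\int_{\widehat{\mathsf X}}\varphi\,d\zeta=\int_{\widehat{\mathsf X}}\widehat P\varphi\,d\zeta\qquad\text{for all }\varphi\in C_c(\widehat{\mathsf X}).$$ Consequently $\zeta=\widehat\pi$. In particular, $\widehat\pi_{\theta_M}\Rightarrow\widehat\pi$ as $\theta_M\downarrow0$.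
   Context: Model. Let $d$ be prime, $N\ge1$, $D=d^N$, $\mathcal H=(\mathbb C^d)^{\otimes N}$, $\omega=e^{2\pi i/d}$, computational basis $|m\rangle$, $m\in\mathbb F_d$ (field elements in exponents are replaced by representatives in $\{0,\dots,d-1\}$). $\mathsf X=\mathbb{CP}^{D-1}$ is the space of rays, $d_{\mathrm{tr}}(\psi,\varphi)=\sqrt{1-|\langle\psi,\varphi\rangle|^2}$. On one qudit, $X|m\rangle=|m+1\rangle$, $Z|m\rangle=\omega^m|m\rangle$. The projective Pauli group is the group of classes in $PU(D)$ of $\bigotimes_jZ^{p_j}X^{q_j}$; $\mathcal C_{d,N}$ (projective Clifford group) is its normalizer in $PU(D)$, a finite group whose elements are identified with unitary representatives. $F_d=d^{-1/2}\sum_{j,k}\omega^{jk}|j\rangle\langle k|$; $D_a^{(2)}(\theta)=\mathrm{diag}(1,e^{i\theta\pi/4})$, $D_a^{(3)}(\theta)=\mathrm{diag}(1,e^{2\pi i\theta/9},e^{-2\pi i\theta/9})$, and for $d>3$, with fixed $a\in\mathbb F_d^*$, $D_a^{(d)}(\theta)=\sum_ke^{-2\pi i\theta\tau_{a,d}(k)/d}|k\rangle\langle k|$ with $\tau_{a,d}(k)\in\{0,\dots,d-1\}$ representing $ak^3$. $R(\theta)=F_d^\dagger D_a^{(d)}(\theta)F_d$ for real $\theta$, $R(\theta)^{(1)}=R(\theta)\otimes I^{\otimes(N-1)}$, $\Pi_m=|m\rangle\langle m|\otimes I^{\otimes(N-1)}$. For a branch $J=(U,m)\in\mathcal C_{d,N}\times\mathbb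 F_d$: $p_{J,\theta}(\psi)=\|\Pi_mR(\theta)^{(1)}U|\psi\rangle\|^2$ and, if positive, $\Psi_{J,\theta}(\psi)=[U^\dagger\Pi_mR(\theta)^{(1)}U|\psi\rangle]$. For $\theta_M\in[0,1]$, $P_{\theta_M}(\psi,\cdot)=|\mathcal C_{d,N}|^{-1}\sum_{J:p_{J,\theta_M}(\psi)>0}p_{J,\theta_M}(\psi)\delta_{\Psi_{J,\theta_M}(\psi)}$; it has a unique invariant probability measure $\pi_{\theta_M}$. Charts. $S$ is the finite set of stabilizer pure states (the $\mathcal C_{d,N}$-orbit of $|0\rangle^{\otimes N}$), with fixed unit representatives $|s\rangle$. $T_s\mathsf X$ carries the Fubini–Study metric normalized so that it is isometric to $|s\rangle^\perp$ with $\mathrm{Re}\langle\cdot|\cdot\rangle$. An admissible stabilizer blow-up chart system consists, for each $s\in S$, of $\varrho_s>0$, an open $U_s\subset\mathsf X$, a chart $\kappa_s:U_s\to B(0,\varrho_s)\subset T_s\mathsf X$ and a smooth map $\eta_s:B(0,\varrho_s)\to\mathcal H$ such that: (C1) the $U_s$ are pairwise disjoint, $\kappa_s(s)=0$, $\kappa_s^{-1}$ is a $C^\infty$ diffeomorphism onto $U_s$ with $D\kappa_s^{-1}(0)=\mathrm{Id}$; (C2) $\|\eta_s(v)\|=1$, $[\eta_s(v)]=\kappa_s^{-1}(v)$, $\eta_s(0)=|s\rangle$; (C3) there are $0<c\le C<\infty$ with $c\|u-w\|\le d_{\mathrm{tr}}(\kappa_s^{-1}(u),\kappa_s^{-1}(w))\le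 C\|u-w\|$ for all $s$, $u,w\in B(0,\varrho_s)$; (C4) every point of $U_s$ has $s$ as its unique nearest point of $S$ in $d_{\mathrm{tr}}$ and consequently, for $\psi\in U_s$, $\alpha_sd_{\mathrm{tr}}(\psi,S)\le\|\kappa_s(\psi)\|\le\beta_sd_{\mathrm{tr}}(\psi,S)$ for some $0<\alpha_s\le\beta_s<\infty$. Blow-up. $\widehat{\mathsf X}=\bigsqcup_{s\in S}T_s\mathsf X$ (disjoint-union topology), $\widehat{\mathsf X}^\dagger=\widehat{\mathsf X}\sqcup\{\dagger\}$ with $\dagger$ an isolated point. For $\theta_M>0$, $\mathcal B_{\theta_M}(\psi)=(s,\kappa_s(\psi)/\theta_M)$ if $\psi\in U_s$, and $\mathcal B_{\theta_M}(\psi)=\dagger$ if $\psi\notin\bigcup_sU_s$; $\widehat\pi_{\theta_M}=(\mathcal B_{\theta_M})_\#\pi_{\theta_M}$. Tangent kernel. For $J$ with $p_{J,0}(s)>0$: $s_J=\Psi_{J,0}(s)\in S$, $F_{J,s}(u,\vartheta)=\kappa_{s_J}(\Psi_{J,\vartheta}(\kappa_s^{-1}(u)))$ ($C^2$ near $(0,0)$), $A_{J,s}=D_uF_{J,s}(0,0)$, $b_{J,s}=\partial_\vartheta F_{J,s}(0,0)$, and $\widehat P((s,v),\cdot)=|\mathcal C_{d,N}|^{-1}\sum_{J:p_{J,0}(s)>0}p_{J,0}(s)\delta_{(s_J,A_{J,s}v+b_{J,s})}$. $\widehat P$ has a unique invariant probability measure $\widehat\pi$ on $\widehat{\mathsf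 X}$, regarded as a measure on $\widehat{\mathsf X}^\dagger$ giving no mass to $\dagger$. *)

theory Defs
  imports
    "HOL-Probability.Probability"
    "HOL-Algebra.Group_Action"
    "Berlekamp_Zassenhaus.Finite_Field"
begin

section \<open>Linear algebra over finite index types\<close>

definition cinner :: "complex ^ 'i \<Rightarrow> complex ^ 'i \<Rightarrow> complex" where
  "cinner x y = (\<Sum>i\<in>UNIV. cnj (x $ i) * y $ i)"

definition dagger :: "complex ^ 'i ^ 'j \<Rightarrow> complex ^ 'j ^ 'i" where
  "dagger A = (\<chi> i j. cnj (A $ j $ i))"

definition diag :: "('i \<Rightarrow> complex) \<Rightarrow> complex ^ 'i ^ 'i" where
  "diag f = (\<chi> i j. if i = j then f i else 0)"

text \<open>The power class operation on \<^typ>\<open>complex ^ 'i ^ 'i\<close> is entrywise, so matrix powers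
  are iterated by hand.\<close>

definition mpow :: "complex ^ 'i ^ 'i \<Rightarrow> nat \<Rightarrow> complex ^ 'i ^ 'i" where
  "mpow A k = (((**) A) ^^ k) (mat 1)"

text \<open>The tensor power of \<open>complex ^ 'm\<close> over the finite index type \<open>'n\<close> is
  \<open>complex ^ ('n \<Rightarrow> 'm)\<close>, whose standard basis consists of the product basis vectors.\<close>

definition tensor_op :: "('n::finite \<Rightarrow> complex ^ 'm ^ 'm) \<Rightarrow> complex ^ ('n \<Rightarrow> 'm) ^ ('n \<Rightarrow> 'm)" where
  "tensor_op A = (\<chi> k l. \<Prod>j\<in>UNIV. A j $ k j $ l j)"

definition projector :: "complex ^ 'i \<Rightarrow> complex ^ 'i ^ 'i" where
  "projector x = (\<chi> i j. x $ i * cnj (x $ j))"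

lemma norm_sq_cinner: "cinner x x = of_real ((norm x)\<^sup>2)"
  by (simp add: cinner_def norm_vec_def L2_set_def sum_nonneg complex_norm_square
      mult.commute del: of_real_power)

lemma cinner_commute: "cinner y x = cnj (cinner x y)"
  by (simp add: cinner_def mult.commute)

lemma inner_projector: "projector x \<bullet> projector y = (cmod (cinner x y))\<^sup>2"
proof -
  have "complex_of_real (projector x \<bullet> projector y)
      = (\<Sum>i\<in>UNIV. \<Sum>j\<in>UNIV. of_real ((x $ i * cnj (x $ j)) \<bullet> (y $ i * cnj (y $ j))))"
    by (simp add: inner_vec_def projector_def)
  have re: "u \<bullet> v = Re (cnj u * v)" for u v :: complex
    by (simp add: inner_complex_def)
  have "projector x \<bullet> projector y
      = Re (\<Sum>i\<in>UNIV. \<Sum>j\<in>UNIV. (cnj (x $ i) * y $ i) * cnj (cnj (x $ j) * y $ j))"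
    by (simp add: inner_vec_def projector_def re mult_ac)
  also have "(\<Sum>i\<in>UNIV. \<Sum>j\<in>UNIV. (cnj (x $ i) * y $ i) * cnj (cnj (x $ j) * y $ j))
      = cinner x y * cnj (cinner x y)"
    by (simp only: cinner_def sum_product cnj_sum)
  also have "Re \<dots> = (cmod (cinner x y))\<^sup>2"
    by (metis Re_complex_of_real complex_norm_square)
  finally show ?thesis .
qed

lemma dist_projector:
  assumes "norm x = 1" "norm y = 1"
  shows "sqrt (1 - (cmod (cinner x y))\<^sup>2) = dist (projector x) (projector y) / sqrt 2"
proof -
  have "(dist (projector x) (projector y))\<^sup>2 = 2 * (1 - (cmod (cinner x y))\<^sup>2)"
    using assms
    by (simp add: dist_norm power2_norm_eq_inner inner_diff inner_projector norm_sq_cinner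
        cinner_commute[of x y])
  then have "dist (projector x) (projector y) = sqrt 2 * sqrt (1 - (cmod (cinner x y))\<^sup>2)"
    by (metis real_sqrt_mult real_sqrt_unique zero_le_dist)
  then show ?thesis by simp
qed

lemma projector_mult: "projector x *v z = cinner x z *s x"
  by (simp add: vec_eq_iff projector_def cinner_def matrix_vector_mult_def sum_distrib_left
      sum_distrib_right mult_ac)


section \<open>Complex projective space\<close>

definition cline :: "complex ^ 'i \<Rightarrow> (complex ^ 'i) set" where
  "cline x = range (\<lambda>c. c *s x)"

typedef (overloaded) 'i ray = "{cline x |x. x \<noteq> (0 :: complex ^ 'i::finite)}"
  morphisms ray_line Abs_ray
proof -
  have "axis undefined 1 \<noteq> (0 :: complex ^ 'i)" by simp
  then show ?thesis by blast
qed

definition ray_of :: "complex ^ 'i \<Rightarrow> 'i::finite ray" where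
  "ray_of x = Abs_ray (cline x)"

definition unit_rep :: "'i::finite ray \<Rightarrow> complex ^ 'i" where
  "unit_rep r = (SOME x. x \<in> ray_line r \<and> norm x = 1)"

lemma cline_scale: "c \<noteq> 0 \<Longrightarrow> cline (c *s x) = cline x"
proof -
  assume c: "c \<noteq> 0"
  have "d *s x = (d / c) *s (c *s x)" "d *s (c *s x) = (d * c) *s x" for d
    using c by (simp_all add: vec_eq_iff)
  then show ?thesis unfolding cline_def by blast
qed

lemma unit_rep: "unit_rep r \<in> ray_line r" "norm (unit_rep r) = 1"
proof -
  obtain x where x: "x \<noteq> 0" "ray_line r = cline x" using ray_line[of r] by auto
  have "inverse (norm x) *\<^sub>R x = of_real (inverse (norm x)) *s x"
    unfolding vec_eq_iff vector_scaleR_component vector_smult_component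
    by (simp only: scaleR_conv_of_real simp_thms)
  then have "inverse (norm x) *\<^sub>R x \<in> ray_line r" using x by (auto simp: cline_def)
  moreover have "norm (inverse (norm x) *\<^sub>R x) = 1" using x by simp
  ultimately have "\<exists>y. y \<in> ray_line r \<and> norm y = 1" by blast
  then have "unit_rep r \<in> ray_line r \<and> norm (unit_rep r) = 1"
    unfolding unit_rep_def by (rule someI_ex)
  then show "unit_rep r \<in> ray_line r" "norm (unit_rep r) = 1" by auto
qed

lemma ray_line_unit_rep: "ray_line r = cline (unit_rep r)"
proof -
  obtain x where x: "x \<noteq> 0" "ray_line r = cline x" using ray_line[of r] by auto
  then obtain c where c: "unit_rep r = c *s x" using unit_rep(1)[of r] by (auto simp: cline_def)
  then have "c \<noteq> 0" using unit_rep(2)[of r] by auto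
  then show ?thesis using c x cline_scale by metis
qed

lemma projector_unit_rep_inject:
  assumes "projector (unit_rep r) = projector (unit_rep t)" shows "r = t"
proof -
  let ?x = "unit_rep r" and ?y = "unit_rep t"
  have "?x = projector ?x *v ?x"
    by (simp add: projector_mult norm_sq_cinner unit_rep)
  also have "\<dots> = cinner ?y ?x *s ?y" by (simp add: assms projector_mult)
  finally have *: "?x = cinner ?y ?x *s ?y" .
  then have "cinner ?y ?x \<noteq> 0" using unit_rep(2)[of r] by force
  then have "cline ?x = cline ?y" using * cline_scale by metis
  then show ?thesis by (simp add: ray_line_unit_rep[symmetric] ray_line_inject)
qed

text \<open>The metric is the trace distance.\<close>

instantiation ray :: (finite) metric_space
begin

definition dist_ray :: "'a ray \<Rightarrow> 'a ray \<Rightarrow> real" where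
  "dist_ray r t = sqrt (1 - (cmod (cinner (unit_rep r) (unit_rep t)))\<^sup>2)"

definition uniformity_ray :: "('a ray \<times> 'a ray) filter" where
  "uniformity_ray = (INF e\<in>{0<..}. principal {(x, y). dist x y < e})"

definition open_ray :: "'a ray set \<Rightarrow> bool" where
  "open_ray U \<longleftrightarrow> (\<forall>x\<in>U. \<forall>\<^sub>F (x', y) in uniformity. x' = x \<longrightarrow> y \<in> U)"

instance
proof
  have d: "dist r t = dist (projector (unit_rep r)) (projector (unit_rep t)) / sqrt 2"
    for r t :: "'a ray"
    unfolding dist_ray_def by (rule dist_projector) (auto simp: unit_rep)
  fix r t u :: "'a ray"
  show "dist r t = 0 \<longleftrightarrow> r = t" by (auto simp: d intro: projector_unit_rep_inject)
  show "dist r t \<le> dist r u + dist t u"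
    unfolding d add_divide_distrib[symmetric]
    by (intro divide_right_mono dist_triangle2) simp
qed (auto simp: uniformity_ray_def open_ray_def)

end

text \<open>The rank-one projector of a ray. The map is an isometric (up to a factor) smooth embedding of
  projective space into the real vector space of matrices.\<close>

definition ray_projector :: "'i::finite ray \<Rightarrow> complex ^ 'i ^ 'i" where
  "ray_projector r = projector (unit_rep r)"


section \<open>Projective Pauli and Clifford groups\<close>

definition digit :: "'p::prime_card mod_ring \<Rightarrow> nat" where
  "digit m = nat (to_int_mod_ring m)"

definition omega :: "'p::prime_card itself \<Rightarrow> complex" where
  "omega _ = cis (2 * pi / CARD('p))"

definition X_gate :: "complex ^ ('p::prime_card mod_ring) ^ ('p mod_ring)" where
  "X_gate = (\<chi> k m. if k = m + 1 then 1 else 0)"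

definition Z_gate :: "complex ^ ('p::prime_card mod_ring) ^ ('p mod_ring)" where
  "Z_gate = diag (\<lambda>m. omega TYPE('p) ^ digit m)"

definition unitary_group :: "(complex ^ 'i ^ 'i) monoid" where
  "unitary_group =
     \<lparr>carrier = {U. U ** dagger U = mat 1 \<and> dagger U ** U = mat 1}, monoid.mult = (**), one = mat 1\<rparr>"

definition phases :: "(complex ^ 'i ^ 'i) set" where
  "phases = {mat c |c. cmod c = 1}"

text \<open>Elements of the projective unitary group are cosets, i.e. sets of unitary matrices that
  differ by a phase.\<close>

definition proj_unitary_group :: "(complex ^ 'i ^ 'i) set monoid" where
  "proj_unitary_group = unitary_group Mod phases"

type_synonym ('n, 'p) qray = "('n \<Rightarrow> 'p mod_ring) ray"
type_synonym ('n, 'p) qvec = "complex ^ ('n \<Rightarrow> 'p mod_ring)"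
type_synonym ('n, 'p) qop = "complex ^ ('n \<Rightarrow> 'p mod_ring) ^ ('n \<Rightarrow> 'p mod_ring)"

definition proj_pauli ::
    "('n::finite, 'p::prime_card) qop set set" where
  "proj_pauli =
     {phases #>\<^bsub>unitary_group\<^esub> tensor_op (\<lambda>j. mpow Z_gate (digit (p j)) ** mpow X_gate (digit (q j)))
       |(p :: 'n \<Rightarrow> 'p mod_ring) (q :: 'n \<Rightarrow> 'p mod_ring). True}"

definition proj_clifford ::
    "('n::finite, 'p::prime_card) qop set set" where
  "proj_clifford = normalizer proj_unitary_group proj_pauli"

definition unitary_rep :: "(complex ^ 'i ^ 'i) set \<Rightarrow> complex ^ 'i ^ 'i" where
  "unitary_rep g = (SOME U. U \<in> g)"

definition stabilizer_states :: "('n::finite, 'p::prime_card) qray set" where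
  "stabilizer_states = (\<lambda>g. ray_of (unitary_rep g *v axis (\<lambda>_. 0) 1)) ` proj_clifford"


section \<open>The measurement chain\<close>

definition fourier :: "complex ^ ('p::prime_card mod_ring) ^ ('p mod_ring)" where
  "fourier = (\<chi> j k. omega TYPE('p) ^ digit (j * k) / sqrt (CARD('p)))"

definition D_gate :: "'p::prime_card mod_ring \<Rightarrow> real \<Rightarrow> complex ^ ('p mod_ring) ^ ('p mod_ring)" where
  "D_gate a \<theta> = diag (\<lambda>k.
     if CARD('p) = 2 then (if digit k = 0 then 1 else cis (\<theta> * pi / 4))
     else if CARD('p) = 3 then
       (if digit k = 0 then 1 else if digit k = 1 then cis (2 * pi * \<theta> / 9) else cis (- 2 * pi * \<theta> / 9))
     else cis (- 2 * pi * \<theta> * digit (a * k ^ 3) / CARD('p)))"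

definition R_gate :: "'p::prime_card mod_ring \<Rightarrow> real \<Rightarrow> complex ^ ('p mod_ring) ^ ('p mod_ring)" where
  "R_gate a \<theta> = dagger fourier ** D_gate a \<theta> ** fourier"

text \<open>An operator acting on the tensor factor \<open>j0\<close> only; \<open>j0\<close> is the name of the measured
  (``first'') qudit in the otherwise unordered index type \<open>'n\<close>.\<close>

definition on_qudit :: "'n::finite \<Rightarrow> complex ^ 'm ^ 'm \<Rightarrow> complex ^ ('n \<Rightarrow> 'm) ^ ('n \<Rightarrow> 'm)" where
  "on_qudit j0 A = tensor_op (\<lambda>j. if j = j0 then A else mat 1)"

type_synonym ('n, 'p) branch =
  "('n, 'p) qop set \<times> 'p mod_ring"

definition branch_vec :: "'p mod_ring \<Rightarrow> 'n \<Rightarrow> ('n, 'p) branch \<Rightarrow> real \<Rightarrow>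
    ('n::finite, 'p::prime_card) qray \<Rightarrow> ('n, 'p) qvec" where
  "branch_vec a j0 J \<theta> \<psi> =
     (on_qudit j0 (diag (\<lambda>k. if k = snd J then 1 else 0)) ** on_qudit j0 (R_gate a \<theta>)
        ** unitary_rep (fst J)) *v unit_rep \<psi>"

definition branch_prob :: "'p mod_ring \<Rightarrow> 'n \<Rightarrow> ('n, 'p) branch \<Rightarrow> real \<Rightarrow>
    ('n::finite, 'p::prime_card) qray \<Rightarrow> real" where
  "branch_prob a j0 J \<theta> \<psi> = (norm (branch_vec a j0 J \<theta> \<psi>))\<^sup>2"

definition branch_map :: "'p mod_ring \<Rightarrow> 'n \<Rightarrow> ('n, 'p) branch \<Rightarrow> real \<Rightarrow>
    ('n::finite, 'p::prime_card) qray \<Rightarrow> ('n, 'p) qray" where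
  "branch_map a j0 J \<theta> \<psi> = ray_of (dagger (unitary_rep (fst J)) *v branch_vec a j0 J \<theta> \<psi>)"

definition positive_branches :: "'p mod_ring \<Rightarrow> 'n \<Rightarrow> real \<Rightarrow>
    ('n::finite, 'p::prime_card) qray \<Rightarrow> ('n, 'p) branch set" where
  "positive_branches a j0 \<theta> \<psi> = {J \<in> proj_clifford \<times> UNIV. branch_prob a j0 J \<theta> \<psi> > 0}"

text \<open>The law of the random branch drawn at \<open>\<psi>\<close>; the image of
  \<open>point_measure I w\<close> under \<open>x\<close> is the finite sum of the weighted Dirac masses \<open>w i * \<delta>(x i)\<close>.\<close>

definition branch_law :: "'p mod_ring \<Rightarrow> 'n \<Rightarrow> real \<Rightarrow>
    ('n::finite, 'p::prime_card) qray \<Rightarrow> ('n, 'p) branch measure" where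
  "branch_law a j0 \<theta> \<psi> = point_measure (positive_branches a j0 \<theta> \<psi>)
     (\<lambda>J. ennreal (branch_prob a j0 J \<theta> \<psi> /
        card (proj_clifford ::
          ('n, 'p) qop set set)))"

definition chain_kernel :: "'p mod_ring \<Rightarrow> 'n \<Rightarrow> real \<Rightarrow>
    ('n::finite, 'p::prime_card) qray \<Rightarrow> ('n, 'p) qray measure" where
  "chain_kernel a j0 \<theta> \<psi> = distr (branch_law a j0 \<theta> \<psi>) borel (\<lambda>J. branch_map a j0 J \<theta> \<psi>)"

definition invariant_prob :: "'x measure \<Rightarrow> ('x \<Rightarrow> 'x measure) \<Rightarrow> 'x measure \<Rightarrow> bool" where
  "invariant_prob M K \<mu> \<longleftrightarrow> sets \<mu> = sets M \<and> prob_space \<mu> \<and>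
     (\<forall>A\<in>sets M. emeasure \<mu> A = (\<integral>\<^sup>+x. emeasure (K x) A \<partial>\<mu>))"


section \<open>Borel measures on abstract topological spaces\<close>

definition borel_of :: "'x topology \<Rightarrow> 'x measure" where
  "borel_of X = sigma (topspace X) {W. openin X W}"

definition weak_conv_on :: "'x topology \<Rightarrow> ('b \<Rightarrow> 'x measure) \<Rightarrow> 'x measure \<Rightarrow> 'b filter \<Rightarrow> bool" where
  "weak_conv_on X \<mu> \<nu> F \<longleftrightarrow>
     (\<forall>f::'x \<Rightarrow> real. continuous_map X euclidean f \<and> bounded (f ` topspace X) \<longrightarrow>
        ((\<lambda>i. \<integral>x. f x \<partial>\<mu> i) \<longlongrightarrow> (\<integral>x. f x \<partial>\<nu>)) F)"

definition compactly_supported :: "'x topology \<Rightarrow> ('x \<Rightarrow> real) \<Rightarrow> bool" where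
  "compactly_supported X f \<longleftrightarrow> continuous_map X euclidean f \<and>
     (\<exists>K. compactin X K \<and> (\<forall>x \<in> topspace X - K. f x = 0))"

text \<open>Disjoint union with one isolated point \<^const>\<open>None\<close>.\<close>

definition add_isolated :: "'x topology \<Rightarrow> 'x option topology" where
  "add_isolated X = topology (\<lambda>W. openin X (Some -` W))"

lemma openin_add_isolated: "openin (add_isolated X) W \<longleftrightarrow> openin X (Some -` W)"
proof -
  have "istopology (\<lambda>W. openin X (Some -` W))"
    by (auto simp: istopology_def vimage_Union)
  then show ?thesis by (simp add: add_isolated_def)
qed

lemma topspace_add_isolated: "topspace (add_isolated X) = insert None (Some ` topspace X)"
proof -
  have "openin (add_isolated X) (insert None (Some ` topspace X))"
    by (simp add: openin_add_isolated vimage_def image_iff)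
  moreover have "W \<subseteq> insert None (Some ` topspace X)" if "openin (add_isolated X) W" for W
  proof
    fix x assume "x \<in> W"
    with openin_subset[OF that[unfolded openin_add_isolated]]
    show "x \<in> insert None (Some ` topspace X)" by (cases x) auto
  qed
  ultimately show ?thesis unfolding topspace_def by blast
qed

definition extend_isolated :: "'x topology \<Rightarrow> 'x measure \<Rightarrow> 'x option measure" where
  "extend_isolated X \<mu> = distr \<mu> (borel_of (add_isolated X)) Some"

definition restrict_isolated :: "'x topology \<Rightarrow> 'x option measure \<Rightarrow> 'x measure" where
  "restrict_isolated X \<zeta> = distr (restrict_space \<zeta> (Some ` topspace X)) (borel_of X) the"


section \<open>Smooth maps\<close>

text \<open>Differentiability classes, to be used for open sets \<open>W\<close>.\<close>

primrec Ck_on :: "nat \<Rightarrow> 'x::real_normed_vector set \<Rightarrow> ('x \<Rightarrow> 'y::real_normed_vector) \<Rightarrow> bool" where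
  "Ck_on 0 W f \<longleftrightarrow> continuous_on W f"
| "Ck_on (Suc k) W f \<longleftrightarrow> (\<forall>x\<in>W. f differentiable (at x)) \<and>
     (\<forall>v. Ck_on k W (\<lambda>x. frechet_derivative f (at x) v))"

definition smooth_on :: "'x::real_normed_vector set \<Rightarrow> ('x \<Rightarrow> 'y::real_normed_vector) \<Rightarrow> bool" where
  "smooth_on W f \<longleftrightarrow> (\<forall>k. Ck_on k W f)"


section \<open>Stabilizer blow-up charts\<close>

text \<open>With a unit representative \<open>e\<close> of \<open>s\<close>, the tangent space of projective space at \<open>s\<close> is
  the orthogonal complement of \<open>e\<close>, where \<open>v\<close> stands for the velocity at time 0 of the curve
  \<open>[e + t v]\<close>. The norm of \<open>complex ^ 'i\<close> restricts to the Fubini--Study norm.\<close>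

definition tangent :: "complex ^ 'i \<Rightarrow> (complex ^ 'i) set" where
  "tangent e = {v. cinner e v = 0}"

definition tan_ball :: "complex ^ 'i \<Rightarrow> real \<Rightarrow> (complex ^ 'i) set" where
  "tan_ball e \<rho> = {v \<in> tangent e. norm v < \<rho>}"

text \<open>Orthogonal projection onto \<^term>\<open>tangent e\<close> for a unit vector \<open>e\<close>. A map on a ball of the
  tangent space is differentiated after composition with this projection, which extends it to
  an open subset of the ambient space.\<close>

definition tan_proj :: "complex ^ 'i \<Rightarrow> complex ^ 'i \<Rightarrow> complex ^ 'i" where
  "tan_proj e x = x - cinner e x *s e"

definition tube :: "complex ^ 'i \<Rightarrow> real \<Rightarrow> (complex ^ 'i) set" where
  "tube e \<rho> = {x. norm (tan_proj e x) < \<rho>}"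

text \<open>
  \<open>ket\<close>: unit representatives of the stabilizer states. The four parts below are the properties
  of the domains and charts, of the lifts, the bi-Lipschitz bounds, and the nearest-point property.

  Smoothness of a map into projective space is smoothness of its composition with
  \<^const>\<open>ray_projector\<close>, smoothness of a function on an open set of rays is smoothness of its
  pull-back to the punctured vector space.
  The differential of \<^const>\<open>ray_projector\<close> at \<open>[e]\<close> maps the tangent vector \<open>v\<close> to
  \<open>|v><e| + |e><v|\<close>; hence the derivative condition says that the differential of the inverse chart
  at the origin is the identity of the tangent space.\<close>

definition admissible_charts ::
  "(('n::finite, 'p::prime_card) qray \<Rightarrow> ('n, 'p) qvec) \<Rightarrow>
   (('n, 'p) qray \<Rightarrow> ('n, 'p) qray set) \<Rightarrow>
   (('n, 'p) qray \<Rightarrow> ('n, 'p) qray \<Rightarrow> ('n, 'p) qvec) \<Rightarrow>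
   (('n, 'p) qray \<Rightarrow> ('n, 'p) qvec \<Rightarrow> ('n, 'p) qvec) \<Rightarrow>
   (('n, 'p) qray \<Rightarrow> real) \<Rightarrow> bool" where
  "admissible_charts ket U \<kappa> \<eta> \<rho> \<longleftrightarrow>
    disjoint_family_on U stabilizer_states \<and>
    (\<forall>s\<in>stabilizer_states.
       \<rho> s > 0 \<and> open (U s) \<and> s \<in> U s \<and> \<kappa> s s = 0 \<and>
       bij_betw (\<kappa> s) (U s) (tan_ball (ket s) (\<rho> s)) \<and>
       smooth_on {x. x \<noteq> 0 \<and> ray_of x \<in> U s} (\<lambda>x. \<kappa> s (ray_of x)) \<and>
       smooth_on (tube (ket s) (\<rho> s))
         (\<lambda>x. ray_projector (inv_into (U s) (\<kappa> s) (tan_proj (ket s) x))) \<and>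
       (\<forall>v \<in> tangent (ket s).
         ((\<lambda>t. ray_projector (inv_into (U s) (\<kappa> s) (t *\<^sub>R v))) has_vector_derivative
           (\<chi> i j. v $ i * cnj (ket s $ j) + ket s $ i * cnj (v $ j))) (at 0))) \<and>
    (\<forall>s\<in>stabilizer_states.
       smooth_on (tube (ket s) (\<rho> s)) (\<lambda>x. \<eta> s (tan_proj (ket s) x)) \<and>
       \<eta> s 0 = ket s \<and>
       (\<forall>v \<in> tan_ball (ket s) (\<rho> s).
          norm (\<eta> s v) = 1 \<and> ray_of (\<eta> s v) = inv_into (U s) (\<kappa> s) v)) \<and>
    (\<exists>c C. 0 < c \<and> c \<le> C \<and>
       (\<forall>s\<in>stabilizer_states. \<forall>u \<in> tan_ball (ket s) (\<rho> s). \<forall>w \<in> tan_ball (ket s) (\<rho> s).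
          c * norm (u - w) \<le> dist (inv_into (U s) (\<kappa> s) u) (inv_into (U s) (\<kappa> s) w) \<and>
          dist (inv_into (U s) (\<kappa> s) u) (inv_into (U s) (\<kappa> s) w) \<le> C * norm (u - w))) \<and>
    (\<forall>s\<in>stabilizer_states.
       (\<forall>\<psi>\<in>U s. \<forall>t \<in> stabilizer_states - {s}. dist \<psi> s < dist \<psi> t) \<and>
       (\<exists>\<alpha> \<beta>. 0 < \<alpha> \<and> \<alpha> \<le> \<beta> \<and>
          (\<forall>\<psi>\<in>U s. \<alpha> * infdist \<psi> stabilizer_states \<le> norm (\<kappa> s \<psi>) \<and>
                 norm (\<kappa> s \<psi>) \<le> \<beta> * infdist \<psi> stabilizer_states)))"


section \<open>Blow-up and tangent kernel\<close>

definition blowup_space ::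
  "(('n::finite, 'p::prime_card) qray \<Rightarrow> ('n, 'p) qvec) \<Rightarrow>
   (('n, 'p) qray \<times> ('n, 'p) qvec) topology" where
  "blowup_space ket = sum_topology (\<lambda>s. top_of_set (tangent (ket s))) stabilizer_states"

definition blowup_map ::
  "(('n::finite, 'p::prime_card) qray \<Rightarrow> ('n, 'p) qray set) \<Rightarrow>
   (('n, 'p) qray \<Rightarrow> ('n, 'p) qray \<Rightarrow> ('n, 'p) qvec) \<Rightarrow>
   real \<Rightarrow> ('n, 'p) qray \<Rightarrow>
   (('n, 'p) qray \<times> ('n, 'p) qvec) option" where
  "blowup_map U \<kappa> \<theta> \<psi> =
     (if \<exists>s\<in>stabilizer_states. \<psi> \<in> U s
      then let s = (THE s. s \<in> stabilizer_states \<and> \<psi> \<in> U s) in Some (s, \<kappa> s \<psi> /\<^sub>R \<theta>)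
      else None)"

definition blowup_law ::
  "(('n::finite, 'p::prime_card) qray \<Rightarrow> ('n, 'p) qvec) \<Rightarrow>
   (('n, 'p) qray \<Rightarrow> ('n, 'p) qray set) \<Rightarrow>
   (('n, 'p) qray \<Rightarrow> ('n, 'p) qray \<Rightarrow> ('n, 'p) qvec) \<Rightarrow>
   real \<Rightarrow> ('n, 'p) qray measure \<Rightarrow>
   (('n, 'p) qray \<times> ('n, 'p) qvec) option measure" where
  "blowup_law ket U \<kappa> \<theta> \<mu> =
     distr \<mu> (borel_of (add_isolated (blowup_space ket))) (blowup_map U \<kappa> \<theta>)"

text \<open>The branch \<open>J\<close> in the charts around \<open>s\<close> and its image \<open>s\<^sub>J\<close>, with the linear part and the
  translation of its first order expansion at \<open>(0, 0)\<close>.\<close>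

definition chart_branch ::
  "(('n::finite, 'p::prime_card) qray \<Rightarrow> ('n, 'p) qray set) \<Rightarrow>
   (('n, 'p) qray \<Rightarrow> ('n, 'p) qray \<Rightarrow> ('n, 'p) qvec) \<Rightarrow>
   'p mod_ring \<Rightarrow> 'n \<Rightarrow> ('n, 'p) branch \<Rightarrow> ('n, 'p) qray \<Rightarrow>
   ('n, 'p) qvec \<Rightarrow> real \<Rightarrow> ('n, 'p) qvec" where
  "chart_branch U \<kappa> a j0 J s u \<theta> =
     \<kappa> (branch_map a j0 J 0 s) (branch_map a j0 J \<theta> (inv_into (U s) (\<kappa> s) u))"

definition branch_linear ::
  "(('n::finite, 'p::prime_card) qray \<Rightarrow> ('n, 'p) qvec) \<Rightarrow>
   (('n, 'p) qray \<Rightarrow> ('n, 'p) qray set) \<Rightarrow>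
   (('n, 'p) qray \<Rightarrow> ('n, 'p) qray \<Rightarrow> ('n, 'p) qvec) \<Rightarrow>
   'p mod_ring \<Rightarrow> 'n \<Rightarrow> ('n, 'p) branch \<Rightarrow> ('n, 'p) qray \<Rightarrow>
   ('n, 'p) qvec \<Rightarrow> ('n, 'p) qvec" where
  "branch_linear ket U \<kappa> a j0 J s =
     frechet_derivative (\<lambda>x. chart_branch U \<kappa> a j0 J s (tan_proj (ket s) x) 0) (at 0)"

definition branch_shift ::
  "(('n::finite, 'p::prime_card) qray \<Rightarrow> ('n, 'p) qray set) \<Rightarrow>
   (('n, 'p) qray \<Rightarrow> ('n, 'p) qray \<Rightarrow> ('n, 'p) qvec) \<Rightarrow>
   'p mod_ring \<Rightarrow> 'n \<Rightarrow> ('n, 'p) branch \<Rightarrow> ('n, 'p) qray \<Rightarrow>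
   ('n, 'p) qvec" where
  "branch_shift U \<kappa> a j0 J s = vector_derivative (\<lambda>\<theta>. chart_branch U \<kappa> a j0 J s 0 \<theta>) (at 0)"

definition tangent_kernel ::
  "(('n::finite, 'p::prime_card) qray \<Rightarrow> ('n, 'p) qvec) \<Rightarrow>
   (('n, 'p) qray \<Rightarrow> ('n, 'p) qray set) \<Rightarrow>
   (('n, 'p) qray \<Rightarrow> ('n, 'p) qray \<Rightarrow> ('n, 'p) qvec) \<Rightarrow>
   'p mod_ring \<Rightarrow> 'n \<Rightarrow>
   ('n, 'p) qray \<times> ('n, 'p) qvec \<Rightarrow>
   (('n, 'p) qray \<times> ('n, 'p) qvec) measure" where
  "tangent_kernel ket U \<kappa> a j0 = (\<lambda>(s, v).
     distr (branch_law a j0 0 s) (borel_of (blowup_space ket))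
       (\<lambda>J. (branch_map a j0 J 0 s,
             branch_linear ket U \<kappa> a j0 J s v + branch_shift U \<kappa> a j0 J s)))"

end

(*
  Near a stabilizer state, in coordinates of scale \<theta>, a step of the chain converges uniformly on bounded
  sets to a step of the affine tangent chain. By invariance, the integrals of a bounded continuous f and
  of Phat^k f against the blown-up stationary law therefore differ by o(1), provided that these laws are
  tight. Both tightness and the identification of the limit come from measuring all qudits in a stabilizer
  basis, a word of n branches whose operator has rank one. From every state the chain reaches the
  O(\<theta>)-neighbourhood of a stabilizer state in n steps with probability bounded below, and once there it
  stays at scale \<theta>, up to an exceptional probability o(1). In the tangent chain the linear part
  along such a word vanishes, so three of them (computational, Fourier, computational basis) reach one
  fixed point from everywhere with probability at least c. Hence Phat^(3nk) f is within (1 - c)^k osc f of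
  a constant, and the limit of the integrals is the integral against the invariant law of Phat, without
  extracting subsequences.
*)
theory Submission
  imports Defs
begin

section \<open>Complex linear algebra\<close>

text \<open>A single branch measures one qudit, and its affine tangent map need not be a
  contraction, so iterating a norm estimate gives nothing. A word of rank one erases the tangent
  vector instead, which turns the problem into a Doeblin minorization and makes the tails of the
  limit law irrelevant. The same word serves the nonlinear chain, because at parameter \<theta> its
  operator is within O(\<theta>) of the operator at 0.

  The local analysis uses two facts that are not hypotheses of the theorem: the Clifford group is
  finite, and at \<theta> = 0 possible branches map stabilizer states to stabilizer states. Both are
  read off from the given invariant probability measures, since otherwise a kernel would lose mass;
  Clifford symmetry spreads the second fact from one stabilizer state to all.

  The isolated point never has to be excluded in advance: test functions carry an arbitrary value
  there, and this value enters only through the small mass outside radius R in the blow-up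
  coordinate.\<close>

lemma cinner_add_right: "cinner x (y + z) = cinner x y + cinner x z"
  by (simp add: cinner_def algebra_simps sum.distrib)

lemma cinner_scale_right: "cinner x (c *s y) = c * cinner x y"
  by (simp add: cinner_def algebra_simps sum_distrib_left)

lemma cinner_scale_left: "cinner (c *s x) y = cnj c * cinner x y"
  by (simp add: cinner_def algebra_simps sum_distrib_left)

lemma cinner_zero_right [simp]: "cinner x 0 = 0"
  by (simp add: cinner_def)

lemma norm_smult: "norm (c *s x) = cmod c * norm (x :: complex ^ 'i)"
proof -
  have "cinner (c *s x) (c *s x) = of_real ((cmod c)\<^sup>2) * cinner x x"
    unfolding complex_norm_square by (simp add: cinner_scale_left cinner_scale_right)
  then have "(norm (c *s x))\<^sup>2 = (cmod c)\<^sup>2 * (norm x)\<^sup>2"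
    unfolding norm_sq_cinner by (simp only: of_real_eq_iff flip: of_real_mult)
  then have "(norm (c *s x))\<^sup>2 = (cmod c * norm x)\<^sup>2" by (simp only: power_mult_distrib)
  then show ?thesis by (simp add: power2_eq_iff_nonneg)
qed

lemma scaleR_eq_smult: "r *\<^sub>R x = complex_of_real r *s (x :: complex ^ 'i)"
  unfolding vec_eq_iff vector_scaleR_component vector_smult_component
  by (simp only: scaleR_conv_of_real simp_thms)

lemma bounded_linear_smult: "bounded_linear (\<lambda>x :: complex ^ 'i. c *s x)"
  by (rule bounded_linear_intro [where K = "cmod c"])
    (simp_all add: scaleR_eq_smult vector_smult_assoc norm_smult mult.commute)

lemma bounded_linear_cinner: "bounded_linear (cinner (x :: complex ^ 'i))"
proof -
  have "linear (cinner x)"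
    by (rule linearI) (simp_all add: cinner_add_right scaleR_eq_smult cinner_scale_right
        scaleR_conv_of_real)
  then show ?thesis by (rule linear_conv_bounded_linear [THEN iffD1])
qed

lemma matrix_vector_smult: "A *v (c *s x) = c *s (A *v (x :: complex ^ 'i))"
  by (simp add: vec_eq_iff matrix_vector_mult_def sum_distrib_left mult_ac)

lemma cinner_adjoint: "cinner x (A *v y) = cinner (dagger A *v x) y"
proof -
  have "cinner x (A *v y) = (\<Sum>i\<in>UNIV. \<Sum>j\<in>UNIV. cnj (x $ i) * A $ i $ j * y $ j)"
    by (simp add: cinner_def matrix_vector_mult_def sum_distrib_left mult_ac)
  also have "\<dots> = (\<Sum>j\<in>UNIV. \<Sum>i\<in>UNIV. cnj (x $ i) * A $ i $ j * y $ j)"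
    by (rule sum.swap)
  also have "\<dots> = cinner (dagger A *v x) y"
    by (simp add: cinner_def matrix_vector_mult_def dagger_def sum_distrib_left sum_distrib_right mult_ac)
  finally show ?thesis .
qed

lemma dagger_dagger [simp]: "dagger (dagger A) = A"
  by (simp add: dagger_def vec_eq_iff)

lemma dagger_mult: "dagger (A ** B) = dagger B ** dagger A"
  by (simp add: dagger_def vec_eq_iff matrix_matrix_mult_def mult.commute)

lemma dagger_mat: "dagger (mat c) = mat (cnj c)"
  by (auto simp: dagger_def vec_eq_iff mat_def)

lemma dagger_diag: "dagger (diag f) = diag (\<lambda>i. cnj (f i))"
  by (auto simp: dagger_def vec_eq_iff diag_def)

lemma diag_mult: "diag f ** diag g = diag (\<lambda>i. f i * g i)"
  by (auto simp: diag_def vec_eq_iff matrix_matrix_mult_def if_distrib [of "\<lambda>x. x * _"] cong: if_cong)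

lemma diag_mult_vec: "(diag f *v x) $ i = f i * x $ i"
  by (simp add: diag_def matrix_vector_mult_def if_distrib [of "\<lambda>x. x * _"] cong: if_cong)

lemma mat_mult_vec: "mat c *v x = c *s (x :: complex ^ 'i)"
  by (simp add: vec_eq_iff mat_def matrix_vector_mult_def if_distrib [of "\<lambda>x. x * _"] cong: if_cong)

definition unitary :: "complex ^ 'i ^ 'i \<Rightarrow> bool" where
  "unitary V \<longleftrightarrow> V ** dagger V = mat 1 \<and> dagger V ** V = mat 1"

lemma unitary_dagger: "unitary V \<Longrightarrow> unitary (dagger V)"
  by (simp add: unitary_def)

lemma unitary_mult: 
  assumes "unitary V" "unitary W" shows "unitary (V ** W)"
proof -
  have "V ** W ** (dagger W ** dagger V) = V ** (W ** dagger W) ** dagger V"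
    "dagger W ** dagger V ** (V ** W) = dagger W ** (dagger V ** V) ** W"
    by (simp_all only: matrix_mul_assoc)
  then show ?thesis using assms by (simp add: unitary_def dagger_mult)
qed

lemma dagger_unitary_mult_vec: "unitary V \<Longrightarrow> dagger V *v (V *v x) = x"
  "unitary V \<Longrightarrow> V *v (dagger V *v x) = x"
  by (simp_all add: matrix_vector_mul_assoc unitary_def)

lemma norm_unitary: 
  assumes "unitary V" shows "norm (V *v x) = norm x"
proof -
  have "complex_of_real ((norm (V *v x))\<^sup>2) = of_real ((norm x)\<^sup>2)"
    by (simp only: norm_sq_cinner [symmetric] cinner_adjoint dagger_unitary_mult_vec [OF assms])
  then have "(norm (V *v x))\<^sup>2 = (norm x)\<^sup>2" by (simp only: of_real_eq_iff)
  then show ?thesis by (simp add: power2_eq_iff_nonneg)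
qed

lemma bounded_linear_tan_proj: "bounded_linear (tan_proj (e :: complex ^ 'i))"
proof -
  have "linear (tan_proj e)"
    by (rule linearI) (simp_all add: tan_proj_def cinner_add_right scaleR_eq_smult cinner_scale_right
      vec_eq_iff algebra_simps)
  then show ?thesis by (rule linear_conv_bounded_linear [THEN iffD1])
qed

lemma tan_proj_smult: "tan_proj e (c *s x) = c *s tan_proj e x"
  by (simp add: tan_proj_def cinner_scale_right vector_smult_assoc vector_ssub_ldistrib)

lemma tan_proj_add: "tan_proj e (x + y) = tan_proj e x + tan_proj e y"
  and tan_proj_diff: "tan_proj e (x - y) = tan_proj e x - tan_proj e y"
  by (rule bounded_linear.linear [OF bounded_linear_tan_proj, THEN linear_add]
      bounded_linear.linear [OF bounded_linear_tan_proj, THEN linear_diff])+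

lemma tan_proj_self: "norm e = 1 \<Longrightarrow> tan_proj e e = 0"
  by (simp add: tan_proj_def norm_sq_cinner)

lemma tan_proj_zero [simp]: "tan_proj e 0 = 0"
  by (simp add: tan_proj_def)

lemma tan_proj_tangent: "v \<in> tangent e \<Longrightarrow> tan_proj e v = v"
  by (simp add: tan_proj_def tangent_def)

lemma tan_proj_in_tangent: "norm e = 1 \<Longrightarrow> tan_proj e x \<in> tangent e"
  by (simp add: tan_proj_def tangent_def norm_sq_cinner cinner_scale_right
      bounded_linear.linear [OF bounded_linear_cinner, THEN linear_diff])

lemma tangent_add: "v \<in> tangent e \<Longrightarrow> w \<in> tangent e \<Longrightarrow> v + w \<in> tangent e"
  by (simp add: tangent_def cinner_add_right)

lemma tangent_smult: "v \<in> tangent e \<Longrightarrow> c *s v \<in> tangent e"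
  by (simp add: tangent_def cinner_scale_right)

lemma tangent_scaleR: "v \<in> tangent e \<Longrightarrow> r *\<^sub>R v \<in> tangent e"
  by (simp add: scaleR_eq_smult tangent_smult)

lemma tangent_zero [simp]: "0 \<in> tangent e"
  by (simp add: tangent_def)

lemma closed_tangent: "closed (tangent e)"
  unfolding tangent_def
  by (intro closed_Collect_eq continuous_intros bounded_linear.continuous_on [OF bounded_linear_cinner])


section \<open>Rays\<close>

lemma ray_of_smult: "c \<noteq> 0 \<Longrightarrow> ray_of (c *s x) = ray_of x"
  by (simp add: ray_of_def cline_scale)

lemma ray_line_ray_of: "x \<noteq> 0 \<Longrightarrow> ray_line (ray_of x) = cline x"
  unfolding ray_of_def by (rule Abs_ray_inverse) blast

lemma unit_rep_nonzero [simp]: "unit_rep r \<noteq> 0"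
  using unit_rep(2) [of r] by auto

lemma ray_of_unit_rep [simp]: "ray_of (unit_rep r) = r"
  by (metis ray_line_inject ray_line_ray_of ray_line_unit_rep unit_rep_nonzero)

lemma unit_rep_ray_of:
  assumes "x \<noteq> 0"
  obtains c where "c \<noteq> 0" "cmod c * norm x = 1" "unit_rep (ray_of x) = c *s x"
proof -
  have "unit_rep (ray_of x) \<in> cline x"
    using unit_rep(1) [of "ray_of x"] assms by (simp add: ray_line_ray_of)
  then obtain c where c: "unit_rep (ray_of x) = c *s x" by (auto simp: cline_def)
  then have "cmod c * norm x = 1" using unit_rep(2) [of "ray_of x"] by (simp add: norm_smult)
  moreover from this have "c \<noteq> 0" by auto
  ultimately show ?thesis using that c by blast
qed

lemma ray_of_eqD:
  assumes "x \<noteq> 0" "y \<noteq> 0" "ray_of x = ray_of y"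
  obtains c where "c \<noteq> 0" "y = c *s x"
proof -
  have "cline y = cline x" using assms by (metis ray_line_ray_of)
  moreover have "y \<in> cline y" unfolding cline_def by (rule range_eqI [of _ _ 1]) simp
  ultimately obtain c where "y = c *s x" by (auto simp: cline_def)
  then show ?thesis using assms that by (metis vector_smult_lzero)
qed

lemma dist_ray_of:
  assumes "x \<noteq> 0" "y \<noteq> 0"
  shows "dist (ray_of x) (ray_of y) = sqrt (1 - (cmod (cinner x y) / (norm x * norm y))\<^sup>2)"
proof -
  obtain c where c: "cmod c * norm x = 1" "unit_rep (ray_of x) = c *s x"
    using unit_rep_ray_of [OF assms(1)] by metis
  obtain d where d: "cmod d * norm y = 1" "unit_rep (ray_of y) = d *s y"
    using unit_rep_ray_of [OF assms(2)] by metis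
  have "cmod c = 1 / norm x" "cmod d = 1 / norm y"
    using assms c(1) d(1) by (simp_all add: field_simps)
  then show ?thesis
    by (simp add: dist_ray_def c d cinner_scale_left cinner_scale_right norm_mult)
qed

text \<open>By \<open>dist_ray_of\<close> the distance to a fixed ray is an explicit continuous
  function of the vector, and it vanishes at a representative of that ray.\<close>

lemma continuous_on_ray_of: "continuous_on {x. x \<noteq> 0} (ray_of :: complex ^ 'i \<Rightarrow> 'i::finite ray)"
  unfolding continuous_on_eq_continuous_within
proof
  fix x :: "complex ^ 'i" assume "x \<in> {x. x \<noteq> 0}"
  then have x: "x \<noteq> 0" by simp
  let ?F = "at x within {x. x \<noteq> 0}"
  have "((\<lambda>y. cinner x y) \<longlongrightarrow> cinner x x) ?F"
    by (rule bounded_linear.tendsto [OF bounded_linear_cinner]) (rule tendsto_ident_at)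
  moreover have "((\<lambda>y. y) \<longlongrightarrow> x) ?F" by (rule tendsto_ident_at)
  ultimately have "((\<lambda>y. sqrt (1 - (cmod (cinner x y) / (norm x * norm y))\<^sup>2))
      \<longlongrightarrow> sqrt (1 - (cmod (cinner x x) / (norm x * norm x))\<^sup>2)) ?F"
    using x by (intro tendsto_intros) auto
  moreover have "sqrt (1 - (cmod (cinner x x) / (norm x * norm x))\<^sup>2) = 0"
    using x by (simp add: norm_sq_cinner power2_eq_square norm_mult)
  moreover have "\<forall>\<^sub>F y in ?F. dist (ray_of x) (ray_of y)
      = sqrt (1 - (cmod (cinner x y) / (norm x * norm y))\<^sup>2)"
    using x by (auto simp: eventually_at_filter dist_ray_of)
  ultimately have "((\<lambda>y. dist (ray_of x) (ray_of y)) \<longlongrightarrow> 0) ?F"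
    using tendsto_cong by force
  then show "continuous ?F ray_of"
    unfolding continuous_within tendsto_dist_iff [of ray_of] by (simp add: dist_commute)
qed

text \<open>\<open>unit_rep\<close> is a choice and may jump by phases, so representatives of close
  rays are close only after a phase is adjusted. The phase that makes the overlap \<open>z\<close>
  real and nonnegative gives squared distance 2 - 2 |z|, which is at most 2 (1 - |z|^2) because |z|
  \<le> 1.\<close>

lemma unit_rep_close:
  obtains c where "cmod c = 1" "norm (unit_rep r - c *s unit_rep t) \<le> sqrt 2 * dist r t"
proof -
  let ?x = "unit_rep r" and ?y = "unit_rep t"
  define z where "z = cinner ?x ?y"
  define c where "c = (if z = 0 then 1 else cnj z / of_real (cmod z))"
  have c: "cmod c = 1" by (simp add: c_def norm_divide)
  have cz: "c * z = of_real (cmod z)"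
    by (simp add: c_def) (metis complex_norm_square mult.commute nonzero_mult_div_cancel_right
      norm_eq_zero of_real_eq_0_iff of_real_mult power2_eq_square times_divide_eq_left)
  have re: "x \<bullet> y = Re (cinner x y)" for x y :: "complex ^ 'a"
    by (simp add: inner_vec_def cinner_def inner_complex_def)
  have "(norm (?x - c *s ?y))\<^sup>2 = (norm ?x)\<^sup>2 + (norm (c *s ?y))\<^sup>2 - 2 * (?x \<bullet> (c *s ?y))"
    by (simp add: power2_norm_eq_inner inner_diff inner_commute)
  also have "\<dots> = 2 - 2 * cmod z"
    using arg_cong [OF cz, of Re]
    by (simp add: re cinner_scale_right norm_smult c unit_rep del: times_complex.sel flip: z_def)
  finally have n: "(norm (?x - c *s ?y))\<^sup>2 = 2 - 2 * cmod z" .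
  then have z1: "cmod z \<le> 1" using zero_le_power2 [of "norm (?x - c *s ?y)"] by linarith
  then have "2 - 2 * cmod z \<le> 2 * (1 - (cmod z)\<^sup>2)"
    by (simp add: power2_eq_square mult_le_one mult_left_le)
  then have "norm (?x - c *s ?y) \<le> sqrt (2 * (1 - (cmod z)\<^sup>2))"
    using n real_le_rsqrt by metis
  also have "\<dots> = sqrt 2 * dist r t" by (simp only: dist_ray_def real_sqrt_mult z_def)
  finally show ?thesis using that c by blast
qed

text \<open>The projection from nonzero vectors to rays is a quotient map.\<close>

lemma continuous_on_unit_rep:
  fixes h :: "complex ^ 'i::finite \<Rightarrow> 'b::topological_space"
  assumes "continuous_on {x. x \<noteq> 0 \<and> ray_of x \<in> W} h"
    and "\<And>c x. c \<noteq> 0 \<Longrightarrow> x \<noteq> 0 \<Longrightarrow> h (c *s x) = h x"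
  shows "continuous_on W (\<lambda>r. h (unit_rep r))"
  unfolding continuous_on_sequentially
proof (intro allI ballI impI, elim conjE)
  fix r and t assume r: "\<forall>n::nat. r n \<in> W" "t \<in> W" and lim: "r \<longlonglongrightarrow> t"
  \<comment> \<open>Phase-aligned representatives of \<open>r n\<close> converge to
    \<open>unit_rep t\<close>, and the scale invariance of \<open>h\<close> makes the alignment
    invisible.\<close>
  have "\<exists>c. cmod c = 1 \<and> norm (unit_rep t - c *s unit_rep (r n)) \<le> sqrt 2 * dist t (r n)" for n
    using unit_rep_close by metis
  then obtain c where c: "\<And>n. cmod (c n) = 1"
      "\<And>n. norm (unit_rep t - c n *s unit_rep (r n)) \<le> sqrt 2 * dist t (r n)" by metis
  have c0: "c n \<noteq> 0" for n using c(1) [of n] by auto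
  let ?y = "\<lambda>n. c n *s unit_rep (r n)"
  have "(\<lambda>n. dist (r n) t) \<longlonglongrightarrow> 0" using lim by (rule tendsto_dist_iff [THEN iffD1])
  then have "(\<lambda>n. sqrt 2 * dist (r n) t) \<longlonglongrightarrow> 0" by (rule tendsto_mult_right_zero)
  then have "(\<lambda>n. dist (?y n) (unit_rep t)) \<longlonglongrightarrow> 0"
    by (rule Lim_null_comparison [rotated])
      (use c(2) in \<open>simp add: dist_norm norm_minus_commute dist_commute\<close>)
  then have "?y \<longlonglongrightarrow> unit_rep t" by (rule tendsto_dist_iff [THEN iffD2])
  moreover have "?y n \<in> {x. x \<noteq> 0 \<and> ray_of x \<in> W}" for n
    using r c0 by (simp add: ray_of_smult)
  moreover have "unit_rep t \<in> {x. x \<noteq> 0 \<and> ray_of x \<in> W}" using r by simp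
  ultimately have "(\<lambda>n. h (?y n)) \<longlonglongrightarrow> h (unit_rep t)"
    using assms(1) [unfolded continuous_on_sequentially comp_def, rule_format,
      of "unit_rep t" ?y] by blast
  then show "((\<lambda>r. h (unit_rep r)) \<circ> r) \<longlonglongrightarrow> h (unit_rep t)"
    by (simp add: comp_def assms(2) c0)
qed


section \<open>Additive characters and the Fourier matrix\<close>

text \<open>The standard additive character of the prime field. Z gates, X gates and the Fourier
  matrix are computed through its homomorphism law instead of through \<open>digit\<close>.\<close>

definition chi :: "'p::prime_card mod_ring \<Rightarrow> complex" where
  "chi m = omega TYPE('p) ^ digit m"

lemma digit_add: "digit (m + n) = (digit m + digit n) mod CARD('p)"
  for m n :: "'p::prime_card mod_ring"
proof -
  have "to_int_mod_ring (m + n) = (to_int_mod_ring m + to_int_mod_ring n) mod int CARD('p)"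
    by transfer simp
  moreover have "to_int_mod_ring m \<ge> 0" "to_int_mod_ring n \<ge> 0" by (transfer, simp)+
  ultimately show ?thesis by (simp add: digit_def nat_mod_distrib nat_add_distrib)
qed

lemma digit_zero [simp]: "digit 0 = 0"
  by (simp add: digit_def)

lemma digit_one [simp]: "digit 1 = 1"
  by (simp add: digit_def)

lemma of_nat_digit [simp]: "of_nat (digit m) = m"
proof -
  have "to_int_mod_ring m \<ge> 0" by (transfer, simp)
  then show ?thesis by (simp add: of_nat_of_int_mod_ring digit_def)
qed

lemma omega_power_card: "omega TYPE('p::prime_card) ^ CARD('p) = 1"
  unfolding omega_def Complex.DeMoivre by simp

lemma omega_neq_1: "omega TYPE('p::prime_card) \<noteq> 1"
proof
  let ?p = "real CARD('p)"
  have p: "?p > 1" using prime_card [where 'a = 'p] prime_gt_1_nat by simp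
  assume "omega TYPE('p) = 1"
  then have "cos (2 * pi / ?p) = 1" by (metis cis.sel(1) omega_def one_complex.sel(1))
  then obtain n :: int where "2 * pi / ?p = of_int n * 2 * pi" unfolding cos_one_2pi_int by blast
  then have "of_int n * ?p = 1" using p by (simp add: field_simps)
  then have "n * int CARD('p) = 1"
    by (metis of_int_1 of_int_eq_iff of_int_mult of_int_of_nat_eq)
  then have "int CARD('p) = 1 \<or> int CARD('p) = - 1" unfolding zmult_eq_1_iff by blast
  then show False using p by linarith
qed

lemma chi_add: "chi (m + n) = chi m * chi n"
proof -
  let ?w = "omega TYPE('a)"
  have "?w ^ (k mod CARD('a)) = ?w ^ k" for k
  proof -
    have "?w ^ k = ?w ^ (CARD('a) * (k div CARD('a)) + k mod CARD('a))" by simp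
    then show ?thesis unfolding power_add power_mult omega_power_card by simp
  qed
  then show ?thesis by (simp add: chi_def digit_add power_add)
qed

lemma chi_zero [simp]: "chi 0 = 1"
  by (simp add: chi_def)

lemma norm_chi [simp]: "cmod (chi m) = 1"
  by (simp add: chi_def omega_def norm_power)

lemma chi_nonzero [simp]: "chi m \<noteq> 0"
  by (metis norm_chi norm_zero zero_neq_one)

lemma cnj_chi: "cnj (chi m) = chi (- m)"
proof -
  have "chi m * cnj (chi m) = chi m * chi (- m)"
    by (simp add: complex_norm_square [symmetric] flip: chi_add)
  then show ?thesis by simp
qed

lemma chi_of_nat: "chi (of_nat k * m) = chi m ^ k"
  by (induction k) (simp_all add: chi_add algebra_simps)

text \<open>Shifting the summation index by 1 multiplies the sum by \<open>omega\<close>, which is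
  not 1.\<close>

lemma sum_chi: "(\<Sum>k\<in>UNIV. chi (k :: 'p::prime_card mod_ring)) = 0"
proof -
  have "(\<Sum>k\<in>UNIV. chi (k :: 'p mod_ring)) = (\<Sum>k\<in>UNIV. chi (k + 1 :: 'p mod_ring))"
    by (rule sum.reindex_bij_witness [of _ "\<lambda>k. k + 1" "\<lambda>k. k - 1"]) auto
  also have "\<dots> = (\<Sum>k\<in>UNIV. chi (k :: 'p mod_ring)) * omega TYPE('p)"
    by (simp add: chi_add sum_distrib_right) (simp add: chi_def)
  finally show ?thesis using omega_neq_1 [where 'p = 'p] by (metis mult_cancel_left2 mult.right_neutral)
qed

text \<open>Orthogonality of characters: multiplication by a nonzero \<open>m\<close> permutes the
  field and reduces the sum to \<open>sum_chi\<close>.\<close>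

lemma sum_chi_mult:
  "(\<Sum>k\<in>UNIV. chi (k * m)) = (if m = 0 then of_nat CARD('p) else 0)" for m :: "'p::prime_card mod_ring"
proof (cases "m = 0")
  case False
  have "(\<Sum>k\<in>UNIV. chi (k * m)) = (\<Sum>k\<in>UNIV. chi (k :: 'p mod_ring))"
    by (rule sum.reindex_bij_witness [of _ "\<lambda>k. k / m" "\<lambda>k. k * m"]) (use False in auto)
  then show ?thesis using False sum_chi by simp
qed simp

lemma fourier_component: "fourier $ j $ k = chi (j * k) / sqrt CARD('p)"
  for j k :: "'p::prime_card mod_ring"
  by (simp add: fourier_def chi_def)

lemma dagger_fourier_mult: "dagger fourier ** fourier = (mat 1 :: complex ^ 'p::prime_card mod_ring ^ _)"
proof -
  have s: "complex_of_real (sqrt CARD('p)) * complex_of_real (sqrt CARD('p)) = of_nat CARD('p)"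
    by (simp flip: of_real_mult)
  have "(dagger fourier ** fourier) $ i $ l = (mat 1 :: complex ^ 'p mod_ring ^ _) $ i $ l" for i l
  proof -
    have "(dagger fourier ** fourier) $ i $ l
        = (\<Sum>k\<in>UNIV. chi (k * (l - i)) / of_nat CARD('p))"
      by (simp add: matrix_matrix_mult_def dagger_def fourier_component cnj_chi s flip: chi_add)
        (simp add: algebra_simps)
    also have "\<dots> = (if l - i = 0 then of_nat CARD('p) else 0) / of_nat CARD('p)"
      by (simp only: sum_chi_mult flip: sum_divide_distrib)
    also have "\<dots> = (mat 1 :: complex ^ 'p mod_ring ^ _) $ i $ l"
      by (auto simp: mat_def)
    finally show ?thesis .
  qed
  then show ?thesis by (simp add: vec_eq_iff)
qed

lemma unitary_fourier: "unitary fourier"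
  using dagger_fourier_mult matrix_left_right_inverse unitary_def by blast


section \<open>Tensor products\<close>

text \<open>A product over qudits of sums over digits expands into a sum over assignments of digits,
  and these assignments are the basis indices of the tensor power.\<close>

lemma tensor_op_mult: 
  "tensor_op A ** tensor_op B = tensor_op (\<lambda>j :: 'n::finite. A j ** (B j :: complex ^ 'm::finite ^ 'm))"
proof -
  have "(\<Sum>m\<in>UNIV. (\<Prod>j\<in>UNIV. A j $ k j $ m j) * (\<Prod>j\<in>UNIV. B j $ m j $ l j))
      = (\<Prod>j\<in>UNIV. \<Sum>m\<in>UNIV. A j $ k j $ m * B j $ m $ l j)" for k l :: "'n \<Rightarrow> 'm"
    by (subst prod_sum_PiE) (auto simp: prod.distrib)
  then show ?thesis by (simp add: vec_eq_iff tensor_op_def matrix_matrix_mult_def)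
qed

lemma tensor_op_dagger: "dagger (tensor_op A) = tensor_op (\<lambda>j. dagger (A j))"
  by (simp add: vec_eq_iff tensor_op_def dagger_def)

lemma prod_if_eq: "(\<Prod>j\<in>UNIV. if k j = l j then f j else 0) = (if k =
    l then (\<Prod>j\<in>UNIV. f j) else 0 :: 'c::comm_semiring_1)"
  for k l :: "'n::finite \<Rightarrow> 'm"
proof (cases "k = l")
  case False
  then obtain j where "k j \<noteq> l j" by blast
  then show ?thesis using False by (subst prod_zero) auto
qed simp

lemma tensor_op_diag: "tensor_op (\<lambda>j. diag (f j)) = diag (\<lambda>k. \<Prod>j\<in>UNIV. f j (k j))"
  by (simp add: vec_eq_iff tensor_op_def diag_def prod_if_eq)

lemma mat_eq_diag: "mat c = diag (\<lambda>_. c)"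
  by (simp add: mat_def diag_def)

lemma tensor_op_one: "tensor_op (\<lambda>_. mat 1) = mat 1"
  by (simp add: mat_eq_diag tensor_op_diag)

lemma unitary_tensor_op:
  fixes A :: "'n::finite \<Rightarrow> complex ^ 'm::finite ^ 'm"
  assumes "\<And>j. unitary (A j)" shows "unitary (tensor_op A)"
  using assms by (simp add: unitary_def tensor_op_dagger tensor_op_mult tensor_op_one)

lemma on_qudit_diag: "on_qudit j0 (diag f) = diag (\<lambda>k. f (k j0))"
proof -
  have "(\<lambda>j. if j = j0 then diag f else mat 1) = (\<lambda>j. diag (if j = j0 then f else (\<lambda>_. 1)))"
    by (auto simp: mat_eq_diag)
  moreover have "(\<Prod>j\<in>UNIV. (if j = j0 then f else (\<lambda>_. 1)) (k j)) = f (k j0)" for k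
    by (subst prod.remove [of _ j0]) auto
  ultimately show ?thesis by (simp add: on_qudit_def tensor_op_diag)
qed

lemma on_qudit_mult: "on_qudit j0 A ** on_qudit j0 B = on_qudit j0 (A ** (B :: complex ^ 'm::finite ^ 'm))"
  unfolding on_qudit_def tensor_op_mult by (rule arg_cong [of _ _ tensor_op]) auto

lemma on_qudit_dagger: "dagger (on_qudit j0 A) = on_qudit j0 (dagger A)"
  unfolding on_qudit_def tensor_op_dagger
  by (rule arg_cong [of _ _ tensor_op]) (auto simp: dagger_mat)

lemma on_qudit_one: "on_qudit j0 (mat 1) = mat 1"
  by (simp add: on_qudit_def tensor_op_one)

lemma unitary_on_qudit:
  "unitary (A :: complex ^ 'm::finite ^ 'm) \<Longrightarrow> unitary (on_qudit j0 A)"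
  by (simp add: unitary_def on_qudit_dagger on_qudit_mult on_qudit_one)

text \<open>Permutes the tensor factors. It is used for involutions \<sigma>, for which it is its
  own adjoint; conjugation by it moves a measurement from \<open>j0\<close> to another
  qudit.\<close>

definition swap_op :: "('n \<Rightarrow> 'n) \<Rightarrow> complex ^ ('n::finite \<Rightarrow>
    'm::finite) ^ ('n \<Rightarrow> 'm)" where
  "swap_op \<sigma> = (\<chi> k l. if l = k \<circ> \<sigma> then 1 else 0)"

lemma swap_op_mult_left: "(swap_op \<sigma> ** B) $ k $ l = B $ (k \<circ> \<sigma>) $ l"
  by (simp add: matrix_matrix_mult_def swap_op_def if_distrib [of "\<lambda>x. x * _"] cong: if_cong)

lemma swap_op_mult_right:
  assumes "\<sigma> \<circ> \<sigma> = id" shows "(B ** swap_op \<sigma>) $ k $ l = B $ k $ (l \<circ> \<sigma>)"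
proof -
  have "l = m \<circ> \<sigma> \<longleftrightarrow> m = l \<circ> \<sigma>" for m
    using assms by (metis comp_assoc comp_id)
  then show ?thesis
    by (simp add: matrix_matrix_mult_def swap_op_def if_distrib [of "\<lambda>x. _ * x"] cong: if_cong)
qed

lemma swap_op_tensor_op:
  assumes "\<sigma> \<circ> \<sigma> = id"
  shows "swap_op \<sigma> ** tensor_op A = tensor_op (A \<circ> \<sigma>) ** swap_op \<sigma>"
proof -
  have s: "\<sigma> (\<sigma> j) = j" for j using assms by (metis comp_apply id_apply)
  have "(\<Prod>j\<in>UNIV. A j $ (k \<circ> \<sigma>) j $ l j) = (\<Prod>j\<in>UNIV. A (\<sigma> j) $ k j $ (l \<circ> \<sigma>) j)" for k l
    by (rule prod.reindex_bij_witness [of _ \<sigma> \<sigma>]) (auto simp: s)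
  then show ?thesis
    by (simp add: vec_eq_iff swap_op_mult_left swap_op_mult_right [OF assms] tensor_op_def)
qed

lemma swap_op_dagger:
  assumes "\<sigma> \<circ> \<sigma> = id" shows "dagger (swap_op \<sigma>) = swap_op \<sigma>"
proof -
  have "l = m \<circ> \<sigma> \<longleftrightarrow> m = l \<circ> \<sigma>" for l m :: "_ \<Rightarrow> 'b"
    using assms by (metis comp_assoc comp_id)
  then show ?thesis by (simp add: vec_eq_iff dagger_def swap_op_def)
qed

lemma swap_op_square:
  assumes "\<sigma> \<circ> \<sigma> = id" shows "swap_op \<sigma> ** swap_op \<sigma> = mat 1"
  unfolding vec_eq_iff swap_op_mult_left
  using assms by (auto simp: swap_op_def mat_def comp_assoc)

lemma unitary_swap_op: "\<sigma> \<circ> \<sigma> = id \<Longrightarrow> unitary (swap_op \<sigma>)"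
  by (simp add: unitary_def swap_op_dagger swap_op_square)

lemma swap_op_diag: 
  assumes "\<sigma> \<circ> \<sigma> = id"
  shows "swap_op \<sigma> ** diag f ** swap_op \<sigma> = diag (\<lambda>k. f (k \<circ> \<sigma>))"
proof -
  have "k \<circ> \<sigma> = l \<circ> \<sigma> \<longleftrightarrow> k = l" for k l :: "_ \<Rightarrow> 'b"
    using assms by (metis comp_assoc comp_id)
  then show ?thesis
    by (simp add: vec_eq_iff swap_op_mult_left swap_op_mult_right [OF assms] diag_def)
qed


section \<open>Pauli operators\<close>

definition pauli :: "('n::finite \<Rightarrow> 'p mod_ring) \<Rightarrow> ('n \<Rightarrow>
    'p::prime_card mod_ring) \<Rightarrow> ('n, 'p) qop" where
  "pauli p q = tensor_op (\<lambda>j. mpow Z_gate (digit (p j)) ** mpow X_gate (digit (q j)))"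

lemma mpow_Suc: "mpow A (Suc n) = A ** mpow A n"
  by (simp add: mpow_def)

lemma mpow_diag: "mpow (diag f) k = diag (\<lambda>i. f i ^ k)"
  by (induction k) (simp_all add: mpow_def mat_eq_diag diag_mult)

lemma mpow_Z_gate: "mpow Z_gate (digit p) = diag (\<lambda>m. chi (p * m))"
proof -
  have "chi m ^ digit p = chi (p * m)" for m using chi_of_nat [of "digit p" m] by simp
  then show ?thesis by (simp add: Z_gate_def mpow_diag flip: chi_def)
qed

lemma mpow_X_gate: "mpow X_gate (digit q) = (\<chi> k m. if k = m + q then 1 else 0)"
  for q :: "'p::prime_card mod_ring"
proof -
  have "(mpow X_gate n :: complex ^ 'p mod_ring ^ _) = (\<chi> k m. if k = m + of_nat n then 1 else 0)" for n
  proof (induction n)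
    case (Suc n)
    have "mpow X_gate (Suc n) $ k $ m = (if k = m + of_nat (Suc n) then 1 else 0)" for k m :: "'p mod_ring"
    proof -
      have "mpow X_gate (Suc n) $ k $ m
          = (\<Sum>i\<in>UNIV. (if k = i + 1 then 1 else 0) * (if i = m + of_nat n then 1 else 0))"
        unfolding mpow_Suc Suc by (simp add: matrix_matrix_mult_def X_gate_def)
      also have "\<dots> = (if k = m + of_nat n + 1 then 1 else 0)"
        by (simp add: if_distrib [of "\<lambda>x. _ * x"] cong: if_cong)
      finally show ?thesis by (simp add: algebra_simps)
    qed
    then show ?case by (simp add: vec_eq_iff)
  qed (simp add: mpow_def mat_def)
  then show ?thesis by simp
qed

lemma pauli1_component:
  "(mpow Z_gate (digit p) ** mpow X_gate (digit q)) $ k $ l = (if k = l + q then chi (p * k) else 0)"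
  for p q k l :: "'p::prime_card mod_ring"
  by (simp add: mpow_Z_gate mpow_X_gate matrix_matrix_mult_def diag_def
      if_distrib [of "\<lambda>x. x * _"] cong: if_cong)

lemma mat_mult_component: "(mat c ** A) $ i $ j = c * A $ i $ j" for A :: "complex ^ 'k ^ 'l"
  by (simp add: matrix_matrix_mult_def mat_def if_distrib [of "\<lambda>x. x * _"] cong: if_cong)

text \<open>The Fourier transform turns a shift into a modulation and a modulation into an inverse
  shift; restoring the order Z before X costs the phase \<open>chi (p * q)\<close>.\<close>

lemma fourier_pauli1:
  "(fourier :: complex ^ 'a mod_ring ^ _) ** (mpow Z_gate (digit p) ** mpow X_gate (digit q))
    = mat (chi (p * q)) ** (mpow Z_gate (digit q) ** mpow X_gate (digit (- p))) ** fourier"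
  for p q :: "'a::prime_card mod_ring"
proof -
  have "(fourier ** (mpow Z_gate (digit p) ** mpow X_gate (digit q))) $ j $ m
      = (mat (chi (p * q)) ** (mpow Z_gate (digit q) ** mpow X_gate (digit (- p))) ** fourier) $ j $ m"
    for j m :: "'a mod_ring"
  proof -
    let ?W = "mpow Z_gate (digit q) ** mpow X_gate (digit (- p)) :: complex ^ 'a mod_ring ^ _"
    have "(fourier ** (mpow Z_gate (digit p) ** mpow X_gate (digit q))) $ j $ m
        = (\<Sum>k\<in>UNIV. if k = m + q then fourier $ j $ k * chi (p * k) else 0)"
      unfolding matrix_matrix_mult_def [of fourier] by (simp add: pauli1_component if_distrib cong: if_cong)
    also have "\<dots> = chi (j * (m + q) + p * (m + q)) / sqrt CARD('a)"
      by (simp add: fourier_component chi_add)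
    finally have l: "(fourier ** (mpow Z_gate (digit p) ** mpow X_gate (digit q))) $ j $ m
        = chi (j * (m + q) + p * (m + q)) / sqrt CARD('a)" .
    have "(mat (chi (p * q)) ** ?W ** fourier) $ j $ m = chi (p * q) * ((?W ** fourier) $ j $ m)"
      by (simp only: matrix_mul_assoc [symmetric] mat_mult_component)
    also have "(?W ** fourier) $ j $ m = (\<Sum>k\<in>UNIV. ?W $ j $ k * fourier $ k $ m)"
      by (simp add: matrix_matrix_mult_def [of ?W])
    also have "\<dots> = (\<Sum>k\<in>UNIV. if k = j + p then chi (q * j) * fourier $ k $ m else 0)"
      by (rule sum.cong) (auto simp: pauli1_component)
    also have "\<dots> = chi (q * j + (j + p) * m) / sqrt CARD('a)"
      by (simp add: fourier_component chi_add)
    also have "chi (p * q) * (chi (q * j + (j + p) * m) / sqrt CARD('a))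
        = chi (j * (m + q) + p * (m + q)) / sqrt CARD('a)"
      by (simp add: algebra_simps chi_add)
    finally show ?thesis by (simp only: l)
  qed
  then show ?thesis unfolding vec_eq_iff by blast
qed

lemma unitary_pauli: "unitary (pauli p q)"
proof -
  have "unitary (diag (\<lambda>m. chi (p j * m)))" for j
    by (simp add: unitary_def dagger_diag diag_mult mat_eq_diag complex_norm_square [symmetric]
        mult.commute [of "cnj _"])
  moreover have "unitary (mpow X_gate (digit (q j)) :: complex ^ 'b mod_ring ^ _)" for j
  proof -
    let ?X = "mpow X_gate (digit (q j)) :: complex ^ 'b mod_ring ^ _"
    have "dagger ?X ** ?X = mat 1"
      by (auto simp: vec_eq_iff mpow_X_gate dagger_def matrix_matrix_mult_def mat_def
          if_distrib [of "\<lambda>x. x * _"] if_distrib [of cnj] cong: if_cong)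
    then show ?thesis using matrix_left_right_inverse unitary_def by blast
  qed
  ultimately show ?thesis
    unfolding pauli_def by (intro unitary_tensor_op unitary_mult) (simp_all add: mpow_Z_gate)
qed

lemma tensor_op_scale: "tensor_op (\<lambda>j. mat (c j) ** A j) = mat (\<Prod>j\<in>UNIV. c j) ** tensor_op A"
  for A :: "'n::finite \<Rightarrow> complex ^ 'm::finite ^ 'm"
  by (simp add: tensor_op_mult [symmetric] mat_eq_diag tensor_op_diag)

lemma fourier_tensor_pauli:
  "tensor_op (\<lambda>_. fourier) ** pauli p q
    = mat (\<Prod>j\<in>UNIV. chi (p j * q j)) ** pauli q (\<lambda>j. - p j) ** tensor_op (\<lambda>_. fourier)"
  unfolding pauli_def tensor_op_scale [symmetric] tensor_op_mult fourier_pauli1 ..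

lemma swap_op_pauli: "\<sigma> \<circ> \<sigma> = id \<Longrightarrow> swap_op \<sigma> ** pauli p q =
    pauli (p \<circ> \<sigma>) (q \<circ> \<sigma>) ** swap_op \<sigma>"
  unfolding pauli_def by (simp add: swap_op_tensor_op comp_def)


section \<open>The Clifford group\<close>

lemma carrier_unitary_group [simp]: "U \<in> carrier unitary_group \<longleftrightarrow> unitary U"
  by (simp add: unitary_group_def unitary_def)

lemma mult_unitary_group [simp]: "U \<otimes>\<^bsub>unitary_group\<^esub> V = U ** V"
  by (simp add: unitary_group_def)

lemma one_unitary_group [simp]: "\<one>\<^bsub>unitary_group\<^esub> = mat 1"
  by (simp add: unitary_group_def)

lemma unitary_mat: "unitary (mat c) \<longleftrightarrow> cmod c = 1"
proof -
  have "c * cnj c = 1 \<longleftrightarrow> cmod c = 1"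
    unfolding complex_norm_square [symmetric] of_real_eq_1_iff by (simp add: power2_eq_1_iff)
      (use norm_ge_zero [of c] in linarith)
  moreover have "diag (\<lambda>_ :: 'a. d) = diag (\<lambda>_. 1) \<longleftrightarrow> d = 1" for d
    by (auto simp: vec_eq_iff diag_def)
  ultimately show ?thesis
    by (simp add: unitary_def mat_eq_diag dagger_diag diag_mult mult.commute)
qed

lemma group_unitary_group: "group (unitary_group :: (complex ^ 'i ^ 'i) monoid)"
proof (rule groupI)
  fix U :: "complex ^ 'i ^ 'i" assume "U \<in> carrier unitary_group"
  then show "\<exists>V\<in>carrier unitary_group. V \<otimes>\<^bsub>unitary_group\<^esub> U = \<one>\<^bsub>unitary_group\<^esub>"
    by (intro bexI [of _ "dagger U"]) (simp_all add: unitary_dagger, simp add: unitary_def)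
qed (auto simp: unitary_mult unitary_mat matrix_mul_assoc)

lemma inv_unitary_group: "unitary U \<Longrightarrow> inv\<^bsub>unitary_group\<^esub> U = dagger U"
  by (rule group.inv_equality [OF group_unitary_group]) (simp_all add: unitary_dagger,
      simp add: unitary_def)

lemma mat_commute: "mat c ** A = A ** mat c" for A :: "complex ^ 'i ^ 'i"
  by (simp add: vec_eq_iff matrix_matrix_mult_def mat_def if_distrib [of "\<lambda>x. _ * x"]
      if_distrib [of "\<lambda>x. x * _"] mult.commute cong: if_cong)

lemma mat_mult_mat: "mat c ** mat d = (mat (c * d) :: complex ^ 'i ^ 'i)"
  by (simp add: mat_eq_diag diag_mult)

text \<open>Phases are scalar matrices and hence central.\<close>

lemma phases_normal: "(phases :: (complex ^ 'i ^ 'i) set) \<lhd> unitary_group"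
  unfolding group.normal_inv_iff [OF group_unitary_group]
proof (intro conjI ballI)
  show "subgroup (phases :: (complex ^ 'i ^ 'i) set) unitary_group"
  proof
    show "phases \<subseteq> carrier unitary_group" by (auto simp: phases_def unitary_mat)
    show "\<one>\<^bsub>unitary_group\<^esub> \<in> phases" by (auto simp: phases_def)
  next
    fix x y :: "complex ^ 'i ^ 'i" assume "x \<in> phases" "y \<in> phases"
    then show "x \<otimes>\<^bsub>unitary_group\<^esub> y \<in> phases"
      by (auto simp: phases_def mat_mult_mat norm_mult)
  next
    fix x :: "complex ^ 'i ^ 'i" assume "x \<in> phases"
    then obtain c where c: "x = mat c" "cmod c = 1" by (auto simp: phases_def)
    then have "inv\<^bsub>unitary_group\<^esub> x = mat (cnj c)"
      by (simp add: inv_unitary_group unitary_mat dagger_mat)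
    then show "inv\<^bsub>unitary_group\<^esub> x \<in> phases"
      using c unfolding phases_def by (intro CollectI exI [of _ "cnj c"]) simp
  qed
next
  fix x h :: "complex ^ 'i ^ 'i" assume x: "x \<in> carrier unitary_group" and h: "h \<in> phases"
  then obtain c where c: "h = mat c" "cmod c = 1" by (auto simp: phases_def)
  have "x ** h ** dagger x = h ** (x ** dagger x)"
    by (simp only: c mat_commute [of c x, symmetric] matrix_mul_assoc)
  then show "x \<otimes>\<^bsub>unitary_group\<^esub> h \<otimes>\<^bsub>unitary_group\<^esub> inv\<^bsub>unitary_group\<^esub> x \<in> phases"
    using x h by (simp add: inv_unitary_group) (simp add: unitary_def)
qed

abbreviation pclass :: "complex ^ 'i ^ 'i \<Rightarrow> (complex ^ 'i ^ 'i) set" where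
  "pclass V \<equiv> phases #>\<^bsub>unitary_group\<^esub> V"

lemma pclass_eq: "pclass V = {mat c ** V |c. cmod c = 1}"
  by (auto simp: r_coset_def phases_def)

lemma pclass_phase:
  assumes "cmod c = 1" shows "pclass (mat c ** V) = pclass V"
proof (intro equalityI subsetI)
  fix x assume "x \<in> pclass (mat c ** V)"
  then obtain d where "x = mat (d * c) ** V" "cmod (d * c) = 1"
    using assms by (auto simp: pclass_eq matrix_mul_assoc mat_mult_mat norm_mult)
  then show "x \<in> pclass V" by (auto simp: pclass_eq)
next
  fix x assume "x \<in> pclass V"
  then obtain d where d: "x = mat d ** V" "cmod d = 1" by (auto simp: pclass_eq)
  have "d * cnj c * c = d * of_real ((cmod c)\<^sup>2)"
    unfolding complex_norm_square by (simp add: mult_ac)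
  then have "d * cnj c * c = d" using assms by simp
  then have "x = mat (d * cnj c) ** (mat c ** V)"
    unfolding d(1) matrix_mul_assoc mat_mult_mat by (simp only:)
  moreover have "cmod (d * cnj c) = 1" using assms d(2) by (simp add: norm_mult)
  ultimately show "x \<in> pclass (mat c ** V)" unfolding pclass_eq by blast
qed

lemma pclass_self: "V \<in> pclass V"
  unfolding pclass_eq by (intro CollectI exI [of _ 1]) simp

lemma group_proj_unitary: "group proj_unitary_group"
  unfolding proj_unitary_group_def by (rule normal.factorgroup_is_group [OF phases_normal])

lemma carrier_proj_unitary: "carrier proj_unitary_group = {pclass V |V. unitary V}"
  by (auto simp: proj_unitary_group_def carrier_FactGroup)

lemma mult_pclass:
  "unitary V \<Longrightarrow> unitary W \<Longrightarrow> pclass V \<otimes>\<^bsub>proj_unitary_group\<^esub> pclass W =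
      pclass (V ** W)"
  by (simp add: proj_unitary_group_def normal.rcos_sum [OF phases_normal])

lemma one_pclass: "\<one>\<^bsub>proj_unitary_group\<^esub> = pclass (mat 1)"
  unfolding proj_unitary_group_def one_FactGroup pclass_eq by (simp add: phases_def)

lemma inv_pclass: "unitary V \<Longrightarrow> inv\<^bsub>proj_unitary_group\<^esub> (pclass V) = pclass (dagger V)"
  by (rule group.inv_equality [OF group_proj_unitary])
    (auto simp: carrier_proj_unitary mult_pclass one_pclass unitary_dagger, 
      auto simp: unitary_def)

lemma proj_pauli_eq: "proj_pauli = {pclass (pauli p q) |p q. True}"
  by (simp add: proj_pauli_def pauli_def)

lemma proj_pauli_subset: "proj_pauli \<subseteq> carrier proj_unitary_group"
  by (auto simp: proj_pauli_eq carrier_proj_unitary unitary_pauli)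

lemma finite_proj_pauli: "finite (proj_pauli :: ('n::finite, 'p::prime_card) qop set set)"
proof -
  have eq: "(proj_pauli :: ('n, 'p) qop set set) = (\<lambda>(p, q). pclass (pauli p q)) ` UNIV"
    by (auto simp: proj_pauli_eq)
  show ?thesis unfolding eq by (rule finite_imageI) (rule finite)
qed

lemma proj_clifford_subgroup: "subgroup proj_clifford proj_unitary_group"
  unfolding proj_clifford_def
  by (rule group.normalizer_imp_subgroup [OF group_proj_unitary proj_pauli_subset])

text \<open>The unitary matrices above \<open>proj_clifford\<close>. Working with them avoids the
  chosen representatives \<open>unitary_rep\<close>, which are known only up to a phase.\<close>

definition clifford :: "('n::finite, 'p::prime_card) qop set" where
  "clifford = {V. unitary V \<and> pclass V \<in> proj_clifford}"

lemma clifford_unitary: "V \<in> clifford \<Longrightarrow> unitary V"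
  by (simp add: clifford_def)

lemma clifford_mult: "V \<in> clifford \<Longrightarrow> W \<in> clifford \<Longrightarrow> V ** W \<in> clifford"
  using subgroup.m_closed [OF proj_clifford_subgroup, of "pclass V" "pclass W"]
  by (simp add: clifford_def mult_pclass unitary_mult)

lemma clifford_dagger: "V \<in> clifford \<Longrightarrow> dagger V \<in> clifford"
  using subgroup.m_inv_closed [OF proj_clifford_subgroup, of "pclass V"]
  by (simp add: clifford_def inv_pclass unitary_dagger)

lemma clifford_phase: 
  assumes "V \<in> clifford" "cmod c = 1" shows "mat c ** V \<in> clifford"
  using assms by (simp add: clifford_def pclass_phase unitary_mult unitary_mat)

lemma clifford_one: "mat 1 \<in> clifford"
  using subgroup.one_closed [OF proj_clifford_subgroup]
  by (simp add: clifford_def one_pclass unitary_mat)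

lemma unitary_rep_pclass:
  obtains c where "cmod c = 1" "unitary_rep (pclass V) = mat c ** V"
proof -
  have "unitary_rep (pclass V) \<in> pclass V"
    unfolding unitary_rep_def using pclass_self by (rule someI)
  then show ?thesis using that by (auto simp: pclass_eq)
qed

lemma unitary_rep_clifford:
  assumes "g \<in> proj_clifford" shows "unitary_rep g \<in> clifford" "pclass (unitary_rep g) = g"
proof -
  have "g \<in> carrier proj_unitary_group"
    using assms subgroup.subset [OF proj_clifford_subgroup] by blast
  then obtain V where V: "g = pclass V" "unitary V" by (auto simp: carrier_proj_unitary)
  then have "V \<in> clifford" using assms by (simp add: clifford_def)
  moreover obtain c where c: "cmod c = 1" "unitary_rep (pclass V) = mat c ** V" 
    by (rule unitary_rep_pclass)
  ultimately show "unitary_rep g \<in> clifford" "pclass (unitary_rep g) = g"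
    using V by (simp_all add: clifford_phase pclass_phase)
qed

text \<open>The normalizer condition is an equality of sets, but one inclusion is enough:
  conjugation is injective and \<open>proj_pauli\<close> is finite.\<close>

lemma mem_cliffordI:
  fixes V :: "('n::finite, 'p::prime_card) qop"
  assumes V: "unitary V"
    and conj: "\<And>p q. \<exists>c p' q'. cmod c = 1 \<and> V ** pauli p q = mat c ** pauli p' q' ** V"
  shows "V \<in> clifford"
proof -
  interpret G: group "proj_unitary_group :: ('n, 'p) qop set monoid"
    by (rule group_proj_unitary)
  let ?G = "proj_unitary_group :: ('n, 'p) qop set monoid"
  let ?P = "proj_pauli :: ('n, 'p) qop set set"
  let ?g = "pclass V"
  define f where "f h = ?g \<otimes>\<^bsub>?G\<^esub> h \<otimes>\<^bsub>?G\<^esub> inv\<^bsub>?G\<^esub> ?g" for h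
  have g: "?g \<in> carrier ?G" using V by (auto simp: carrier_proj_unitary)
  have "f h \<in> ?P" if h: "h \<in> ?P" for h
  proof -
    obtain p q where hp: "h = pclass (pauli p q)" using h by (auto simp: proj_pauli_eq)
    obtain c p' q' where c: "cmod c = 1" "V ** pauli p q = mat c ** pauli p' q' ** V"
      using conj by blast
    have "f h = pclass (V ** pauli p q ** dagger V)"
      using V by (simp add: f_def hp inv_pclass mult_pclass unitary_pauli unitary_mult unitary_dagger)
    also have "V ** pauli p q ** dagger V = mat c ** pauli p' q'"
      using V by (simp add: c(2) unitary_def flip: matrix_mul_assoc)
    finally show ?thesis using c(1) by (auto simp: pclass_phase proj_pauli_eq)
  qed
  then have sub: "f ` ?P \<subseteq> ?P" by blast
  have "inj_on f ?P"
  proof (rule inj_onI)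
    fix x y assume "x \<in> ?P" "y \<in> ?P" and eq: "f x = f y"
    then have "x \<in> carrier ?G" "y \<in> carrier ?G" using proj_pauli_subset by auto
    then show "x = y" using eq g by (simp add: f_def)
  qed
  then have "f ` ?P = ?P"
    by (intro card_subset_eq sub finite_proj_pauli) (simp add: card_image)
  moreover have "?g <#\<^bsub>?G\<^esub> ?P #>\<^bsub>?G\<^esub> inv\<^bsub>?G\<^esub> ?g = f ` ?P"
    by (auto simp: l_coset_def r_coset_def f_def)
  moreover have "?P \<subseteq> carrier ?G" by (rule proj_pauli_subset)
  ultimately have "?g \<in> proj_clifford"
    using g by (simp add: proj_clifford_def normalizer_def stabilizer_def)
  then show ?thesis using V by (simp add: clifford_def)
qed

lemma swap_op_clifford:
  assumes "\<sigma> \<circ> \<sigma> = id" shows "swap_op \<sigma> \<in> clifford"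
proof (rule mem_cliffordI)
  fix p q :: "'a \<Rightarrow> 'b mod_ring"
  show "\<exists>c p' q'. cmod c = 1 \<and> swap_op \<sigma> ** pauli p q = mat c ** pauli p' q' ** swap_op \<sigma>"
    using swap_op_pauli [OF assms, of p q] by (intro exI [of _ 1]) (auto intro: exI)
qed (use assms in \<open>rule unitary_swap_op\<close>)

definition fourier_all :: "('n::finite, 'p::prime_card) qop" where
  "fourier_all = tensor_op (\<lambda>_. fourier)"

lemma fourier_all_clifford: "fourier_all \<in> clifford"
  unfolding fourier_all_def
proof (rule mem_cliffordI)
  fix p q :: "'a \<Rightarrow> 'b mod_ring"
  show "\<exists>c p' q'. cmod c = 1 \<and>
      tensor_op (\<lambda>_. fourier) ** pauli p q = mat c ** pauli p' q' ** tensor_op (\<lambda>_. fourier)"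
    using fourier_tensor_pauli [of p q]
    by (intro exI [of _ "\<Prod>j\<in>UNIV. chi (p j * q j)"] exI [of _ q] exI [of _ "\<lambda>j. - p j"])
      (simp flip: prod_norm)
qed (simp add: unitary_tensor_op unitary_fourier)

text \<open>A phase does not change a ray, so every Clifford matrix may replace the chosen
  representative of its class.\<close>

lemma stabilizer_states_eq: "stabilizer_states = {ray_of (V *v axis (\<lambda>_. 0) 1) |V. V \<in> clifford}"
proof (intro equalityI subsetI)
  fix s :: "('a, 'b) qray" assume "s \<in> {ray_of (V *v axis (\<lambda>_. 0) 1) |V. V \<in> clifford}"
  then obtain V :: "('a, 'b) qop" where V: "V \<in> clifford" "s = ray_of (V *v axis (\<lambda>_. 0) 1)" by auto
  obtain c where c: "cmod c = 1" "unitary_rep (pclass V) = mat c ** V" by (rule unitary_rep_pclass)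
  have "s = ray_of (unitary_rep (pclass V) *v axis (\<lambda>_. 0) 1)"
    using c(1) unfolding c(2) V(2) matrix_vector_mul_assoc [symmetric] mat_mult_vec
    by (subst ray_of_smult) auto
  then show "s \<in> stabilizer_states"
    using V(1) by (auto simp: stabilizer_states_def clifford_def)
qed (auto simp: stabilizer_states_def dest: unitary_rep_clifford(1))

lemma ray_of_clifford_mult:
  fixes V :: "('n::finite, 'p::prime_card) qop"
  assumes "V \<in> clifford" "x \<noteq> 0" "ray_of x \<in> stabilizer_states"
  shows "ray_of (V *v x) \<in> stabilizer_states"
proof -
  let ?e = "axis (\<lambda>_. 0) 1 :: ('n, 'p) qvec"
  obtain W :: "('n, 'p) qop" where W: "W \<in> clifford" "ray_of x = ray_of (W *v ?e)"
    using assms(3) by (auto simp: stabilizer_states_eq)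
  have "W *v ?e \<noteq> 0" using norm_unitary [OF clifford_unitary [OF W(1)], of ?e] by auto
  then obtain c where c: "c \<noteq> 0" "W *v ?e = c *s x" using ray_of_eqD assms(2) W(2) by metis
  have "ray_of (V *v x) = ray_of ((V ** W) *v ?e)"
    using c(1) by (simp only: matrix_vector_mul_assoc [symmetric] c(2) matrix_vector_smult)
      (simp add: ray_of_smult)
  then show ?thesis using clifford_mult [OF assms(1) W(1)] by (auto simp: stabilizer_states_eq)
qed


section \<open>Branch operators\<close>

definition meas_op :: "'n::finite \<Rightarrow> 'p mod_ring \<Rightarrow> ('n, 'p::prime_card) qop" where
  "meas_op j m = diag (\<lambda>k. if k j = m then 1 else 0)"

lemma meas_op_eq: "on_qudit j (diag (\<lambda>k. if k = m then 1 else 0)) = meas_op j m"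
  by (simp add: on_qudit_diag meas_op_def)

lemma meas_op_contraction: "norm (meas_op j m *v x) \<le> norm x"
proof (rule norm_le_componentwise_cart)
qed (simp add: meas_op_def diag_mult_vec norm_mult)

lemma sum_norm_meas_op: "(\<Sum>m\<in>UNIV. (norm (meas_op j m *v x))\<^sup>2) = (norm x)\<^sup>2"
  for x :: "('n::finite, 'p::prime_card) qvec"
proof -
  have n: "(norm y)\<^sup>2 = (\<Sum>k\<in>UNIV. (cmod (y $ k))\<^sup>2)" for y :: "('n, 'p) qvec"
    by (simp add: norm_vec_def L2_set_def sum_nonneg)
  have "(\<Sum>m\<in>UNIV. (norm (meas_op j m *v x))\<^sup>2)
      = (\<Sum>m\<in>UNIV. \<Sum>k\<in>UNIV. if k j = m then (cmod (x $ k))\<^sup>2 else 0)"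
    unfolding n by (intro sum.cong refl) (simp add: meas_op_def diag_mult_vec)
  also have "\<dots> = (\<Sum>k\<in>UNIV. \<Sum>m\<in>UNIV. if k j = m then (cmod (x $ k))\<^sup>2 else 0)"
    by (rule sum.swap)
  also have "\<dots> = (norm x)\<^sup>2" by (simp add: n)
  finally show ?thesis .
qed

text \<open>In each of the cases p = 2, p = 3 and p > 3 the gate is a diagonal one-parameter group
  in \<theta>. Naming its frequencies merges the three cases for the rest of the proof.\<close>

definition D_freq :: "'p::prime_card mod_ring \<Rightarrow> 'p mod_ring \<Rightarrow> real" where
  "D_freq a k =
     (if CARD('p) = 2 then (if digit k = 0 then 0 else pi / 4)
      else if CARD('p) = 3 then
        (if digit k = 0 then 0 else if digit k = 1 then 2 * pi / 9 else - 2 * pi / 9)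
      else - 2 * pi * digit (a * k ^ 3) / CARD('p))"

lemma D_gate_eq: "D_gate a \<theta> = diag (\<lambda>k. cis (\<theta> * D_freq a k))"
  unfolding D_gate_def D_freq_def
  by (rule arg_cong [of _ _ diag]) (auto simp: fun_eq_iff mult_ac)

lemma unitary_diag_cis: "unitary (diag (\<lambda>k. cis (f k)))"
  by (simp add: unitary_def dagger_diag diag_mult mat_eq_diag cis_cnj cis_mult)

lemma unitary_R_gate: "unitary (R_gate a \<theta>)"
  unfolding R_gate_def D_gate_eq
  by (intro unitary_mult unitary_dagger unitary_fourier unitary_diag_cis)

lemma R_gate_zero: "R_gate a 0 = mat 1"
  by (simp add: R_gate_def D_gate_eq dagger_fourier_mult flip: mat_eq_diag)

text \<open>Contains the final inverse Clifford unitary, which \<open>branch_vec\<close> leaves out,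
  so that successive branches compose by multiplying these operators. The extra unitary does not
  affect norms and hence not the probabilities.\<close>

definition branch_op :: "'p mod_ring \<Rightarrow> 'n \<Rightarrow> ('n,
    'p) branch \<Rightarrow> real \<Rightarrow> ('n::finite, 'p::prime_card) qop" where
  "branch_op a j0 J \<theta> =
     dagger (unitary_rep (fst J)) ** meas_op j0 (snd J) ** on_qudit j0 (R_gate a \<theta>) ** unitary_rep (fst J)"

abbreviation branches :: "('n::finite, 'p::prime_card) branch set" where
  "branches \<equiv> proj_clifford \<times> UNIV"

lemma unitary_rep_branch: "J \<in> branches \<Longrightarrow> unitary (unitary_rep (fst J))"
  by (auto intro!: clifford_unitary unitary_rep_clifford(1))

lemma branch_map_eq: "branch_map a j0 J \<theta> \<psi> = ray_of (branch_op a j0 J \<theta> *v unit_rep \<psi>)"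
  by (simp add: branch_map_def branch_vec_def branch_op_def meas_op_eq matrix_vector_mul_assoc
      matrix_mul_assoc)

lemma branch_vec_eq: 
  assumes "J \<in> branches"
  shows "norm (branch_op a j0 J \<theta> *v x)
    = norm (meas_op j0 (snd J) *v (on_qudit j0 (R_gate a \<theta>) *v (unitary_rep (fst J) *v x)))"
  unfolding branch_op_def matrix_vector_mul_assoc [symmetric]
  by (rule norm_unitary) (rule unitary_dagger [OF unitary_rep_branch [OF assms]])

lemma branch_prob_eq:
  assumes "J \<in> branches"
  shows "branch_prob a j0 J \<theta> \<psi> = (norm (branch_op a j0 J \<theta> *v unit_rep \<psi>))\<^sup>2"
  by (simp add: branch_vec_eq [OF assms] branch_prob_def branch_vec_def meas_op_eq
      matrix_vector_mul_assoc matrix_mul_assoc)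

lemma branch_op_contraction:
  assumes "J \<in> branches" shows "norm (branch_op a j0 J \<theta> *v x) \<le> norm x"
proof -
  have "norm (branch_op a j0 J \<theta> *v x) \<le> norm (on_qudit j0 (R_gate a \<theta>) *v (unitary_rep (fst J) *v x))"
    unfolding branch_vec_eq [OF assms] by (rule meas_op_contraction)
  also have "\<dots> = norm x"
    by (simp add: norm_unitary unitary_on_qudit unitary_R_gate unitary_rep_branch [OF assms])
  finally show ?thesis .
qed

text \<open>For a fixed Clifford element the outcome projections resolve the identity, so each
  element contributes exactly 1.\<close>

lemma branch_prob_sum:
  assumes "finite (proj_clifford :: ('n::finite, 'p::prime_card) qop set set)"
  shows "(\<Sum>J\<in>branches. branch_prob a j0 J \<theta> (\<psi> :: ('n, 'p) qray))
    = card (proj_clifford :: ('n, 'p) qop set set)"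
proof -
  have "(\<Sum>J\<in>branches. branch_prob a j0 J \<theta> \<psi>)
      = (\<Sum>g\<in>proj_clifford. \<Sum>m\<in>UNIV. branch_prob a j0 (g, m) \<theta> \<psi>)"
    by (simp add: sum.cartesian_product)
  also have "\<dots> = (\<Sum>g\<in>(proj_clifford :: ('n, 'p) qop set set). 1)"
  proof (rule sum.cong)
    fix g :: "('n, 'p) qop set" assume g: "g \<in> proj_clifford"
    have "(\<Sum>m\<in>UNIV. branch_prob a j0 (g, m) \<theta> \<psi>)
        = (norm (on_qudit j0 (R_gate a \<theta>) *v (unitary_rep g *v unit_rep \<psi>)))\<^sup>2"
      using g by (simp add: branch_prob_eq branch_vec_eq sum_norm_meas_op)
    also have "\<dots> = 1"
      using g unitary_rep_branch [of "(g, 0)"] by (simp add: norm_unitary unitary_on_qudit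
          unitary_R_gate unit_rep)
    finally show "(\<Sum>m\<in>UNIV. branch_prob a j0 (g, m) \<theta> \<psi>) = 1" .
  qed simp
  finally show ?thesis by simp
qed

lemma branch_map_ray_of:
  assumes "x \<noteq> 0" shows "branch_map a j0 J \<theta> (ray_of x) = ray_of (branch_op a j0 J \<theta> *v x)"
proof -
  obtain c where "c \<noteq> 0" "unit_rep (ray_of x) = c *s x" using unit_rep_ray_of [OF assms] by metis
  then show ?thesis by (simp add: branch_map_eq matrix_vector_smult ray_of_smult)
qed

lemma branch_prob_ray_of:
  assumes "x \<noteq> 0" "J \<in> branches"
  shows "branch_prob a j0 J \<theta> (ray_of x) = (norm (branch_op a j0 J \<theta> *v x) / norm x)\<^sup>2"
proof -
  obtain c where c: "cmod c * norm x = 1" "unit_rep (ray_of x) = c *s x"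
    using unit_rep_ray_of [OF assms(1)] by metis
  then have "cmod c = 1 / norm x" using assms(1) by (simp add: field_simps)
  then show ?thesis by (simp add: branch_prob_eq [OF assms(2)] c(2) matrix_vector_smult norm_smult)
qed

text \<open>Only the diagonal gate depends on \<theta>. Splitting it by the coordinate projections
  \<open>E k\<close> writes the branch as a trigonometric polynomial with operator coefficients,
  from which the derivative and the Lipschitz bound follow term by term.\<close>

lemma branch_op_expansion:
  fixes J :: "('n::finite, 'p::prime_card) branch"
  shows "\<exists>f (Q :: ('n \<Rightarrow> 'p mod_ring) \<Rightarrow> ('n, 'p) qop).
    \<forall>\<theta> x. branch_op a j0 J \<theta> *v x = (\<Sum>k\<in>UNIV. cis (\<theta> * f k) *s (Q k *v x))"
proof -
  let ?W = "unitary_rep (fst J)"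
  define L where "L = dagger ?W ** meas_op j0 (snd J) ** on_qudit j0 (dagger fourier)"
  define M where "M = on_qudit j0 fourier ** ?W"
  define E :: "('n \<Rightarrow> 'p mod_ring) \<Rightarrow> ('n, 'p) qop" where "E k = diag (\<lambda>l. if l =
      k then 1 else 0)" for k
  define f where "f k = D_freq a (k j0)" for k :: "'n \<Rightarrow> 'p mod_ring"
  have "branch_op a j0 J \<theta> *v x = (\<Sum>k\<in>UNIV. cis (\<theta> * f k) *s ((L ** E k ** M) *v x))" for \<theta> x
  proof -
    have D: "diag (\<lambda>k. cis (\<theta> * f k)) *v y = (\<Sum>k\<in>UNIV. cis (\<theta> * f k) *s (E k *v y))" for y
      by (simp add: vec_eq_iff diag_mult_vec E_def if_distrib [of "\<lambda>x. x * _"] if_distrib [of "\<lambda>x. _ *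
          x"] cong: if_cong)
    have "branch_op a j0 J \<theta> = L ** diag (\<lambda>k. cis (\<theta> * f k)) ** M"
      unfolding branch_op_def L_def M_def R_gate_def D_gate_eq on_qudit_mult [symmetric] on_qudit_diag f_def
      by (simp only: matrix_mul_assoc)
    then have "branch_op a j0 J \<theta> *v x = L *v (\<Sum>k\<in>UNIV. cis (\<theta> * f k) *s (E k *v (M *v x)))"
      by (simp only: D flip: matrix_vector_mul_assoc)
    also have "\<dots> = (\<Sum>k\<in>UNIV. L *v (cis (\<theta> * f k) *s (E k *v (M *v x))))"
      by (rule bounded_linear.linear [OF matrix_vector_mul_bounded_linear, THEN linear_sum])
    also have "\<dots> = (\<Sum>k\<in>UNIV. cis (\<theta> * f k) *s ((L ** E k ** M) *v x))"
      by (simp only: matrix_vector_smult flip: matrix_vector_mul_assoc)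
    finally show ?thesis .
  qed
  then show ?thesis by (intro exI [of _ f] exI [of _ "\<lambda>k. L ** E k ** M"]) simp
qed

lemma bounded_bilinear_smult: "bounded_bilinear (\<lambda>(c :: complex) (x :: complex ^ 'i). c *s x)"
  by (rule bounded_bilinear.intro)
    (auto simp: vec_eq_iff algebra_simps norm_smult intro!: exI [of _ 1])

text \<open>\<open>K'\<close> is the derivative of the operator in \<theta> at 0. The functions
  \<open>t\<close> and \<open>h\<close> are built in so that the product rule can be applied
  directly with the pair (u, \<theta>) as variable.\<close>

lemma branch_op_has_derivative:
  fixes J :: "('n::finite, 'p::prime_card) branch"
  obtains K' :: "('n, 'p) qvec \<Rightarrow> ('n, 'p) qvec"
  where "\<And>t t' h h' (z :: 'z::real_normed_vector).
    (t has_derivative t') (at z) \<Longrightarrow> (h has_derivative h') (at z) \<Longrightarrow> t z =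
        0 \<Longrightarrow>
    ((\<lambda>z. branch_op a j0 J (t z) *v h z) has_derivative
      (\<lambda>y. branch_op a j0 J 0 *v h' y + t' y *\<^sub>R K' (h z))) (at z)"
proof -
  obtain f and Q :: "('n \<Rightarrow> 'p mod_ring) \<Rightarrow> ('n, 'p) qop"
    where "\<forall>\<theta> x. branch_op a j0 J \<theta> *v x = (\<Sum>k\<in>UNIV. cis (\<theta> * f k) *s (Q k *v x))"
    using branch_op_expansion [of a j0 J] by blast
  then have Q: "\<And>\<theta> x. branch_op a j0 J \<theta> *v x = (\<Sum>k\<in>UNIV. cis (\<theta> * f k) *s (Q k *v x))" by simp
  define K' where "K' x = (\<Sum>k\<in>UNIV. (\<i> * of_real (f k)) *s (Q k *v x))" for x
  have "((\<lambda>z. branch_op a j0 J (t z) *v h z) has_derivative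
      (\<lambda>y. branch_op a j0 J 0 *v h' y + t' y *\<^sub>R K' (h z))) (at z)"
    if t: "(t has_derivative t') (at z)" "t z = 0" and h: "(h has_derivative h') (at z)" 
    for t t' h h' and z :: 'z
  proof -
    have c: "((\<lambda>z. cis (t z * f k)) has_derivative (\<lambda>y. t' y *\<^sub>R (\<i> * of_real (f k)))) (at z)" for k
    proof -
      have "((\<lambda>z. exp (\<i> * of_real (t z * f k))) has_derivative
          (\<lambda>y. exp (\<i> * of_real (t z * f k)) * (\<i> * of_real (t' y * f k)))) (at z)"
        by (rule has_derivative_compose [OF has_derivative_mult_right [OF has_derivative_of_real [OF
              has_derivative_mult_left [OF t(1)]]] DERIV_exp [unfolded has_field_derivative_def]])
      then show ?thesis by (simp add: t(2) cis_conv_exp scaleR_conv_of_real mult_ac)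
    qed
    have "((\<lambda>z. cis (t z * f k) *s (Q k *v h z)) has_derivative
        (\<lambda>y. cis (t z * f k) *s (Q k *v h' y) + (t' y *\<^sub>R (\<i> * of_real (f k))) *s (Q k *v h z))) (at z)"
            for k
      by (rule bounded_bilinear.FDERIV [OF bounded_bilinear_smult c
          bounded_linear.has_derivative [OF matrix_vector_mul_bounded_linear h]])
    then have "((\<lambda>z. \<Sum>k\<in>UNIV. cis (t z * f k) *s (Q k *v h z)) has_derivative
        (\<lambda>y. \<Sum>k\<in>UNIV. cis (t z * f k) *s (Q k *v h' y) + (t' y *\<^sub>R (\<i> * of_real (f k))) *s (Q k *v
            h z))) (at z)"
      by (rule has_derivative_sum)
    moreover have "(t' y *\<^sub>R (\<i> * of_real (f k))) *s (Q k *v h z) =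
        t' y *\<^sub>R ((\<i> * of_real (f k)) *s (Q k *v h z))" for y k
      by (simp add: scaleR_eq_smult scaleR_conv_of_real vector_smult_assoc)
    ultimately show ?thesis
      by (simp add: Q K'_def t(2) sum.distrib scaleR_sum_right)
  qed
  then show ?thesis using that by blast
qed

text \<open>Term by term from the expansion, as \<open>cmod (cis t - 1)\<close> is at most the
  modulus of \<open>t\<close>. Linearity of the bound in \<theta> is what later places the chain at
  distance O(\<theta>) from a stabilizer state.\<close>

lemma branch_op_lipschitz:
  fixes J :: "('n::finite, 'p::prime_card) branch"
  obtains C where "C \<ge> 0" "\<And>\<theta> x. norm (branch_op a j0 J \<theta> *v x - branch_op a j0 J 0 *v x) \<le> C * \<bar>\<theta>\<bar>
      * norm x"
proof -
  obtain f and Q :: "('n \<Rightarrow> 'p mod_ring) \<Rightarrow> ('n, 'p) qop"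
      where "\<forall>\<theta> x. branch_op a j0 J \<theta> *v x = (\<Sum>k\<in>UNIV. cis (\<theta> * f k) *s (Q k *v x))"
    using branch_op_expansion [of a j0 J] by blast
  then have Q: "\<And>\<theta> x. branch_op a j0 J \<theta> *v x = (\<Sum>k\<in>UNIV. cis (\<theta> * f k) *s (Q k *v x))" by simp
  have "\<exists>q\<ge>0. \<forall>x. norm (Q k *v x) \<le> norm x * q" for k
    by (rule bounded_linear.nonneg_bounded) (rule matrix_vector_mul_bounded_linear)
  then obtain q where q: "\<And>k. q k \<ge> 0" "\<And>k x. norm (Q k *v x) \<le> norm x * q k" by metis
  have cis: "cmod (cis t - 1) \<le> \<bar>t\<bar>" for t
    using dist_exp_i_1 [of t] abs_sin_x_le_abs_x [of "t / 2"] by (simp add: cis_conv_exp)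
  show ?thesis
  proof (rule that)
    show "0 \<le> (\<Sum>k\<in>UNIV. \<bar>f k\<bar> * q k)" by (intro sum_nonneg mult_nonneg_nonneg q) simp
  next
    fix \<theta> x
    have "branch_op a j0 J \<theta> *v x - branch_op a j0 J 0 *v x
        = (\<Sum>k\<in>UNIV. (cis (\<theta> * f k) - 1) *s (Q k *v x))"
      by (simp add: Q flip: sum_subtractf)
    also have "norm \<dots> \<le> (\<Sum>k\<in>UNIV. \<bar>\<theta> * f k\<bar> * (norm x * q k))"
      by (rule sum_norm_le) (unfold norm_smult, intro mult_mono cis q, simp_all)
    also have "\<dots> = (\<Sum>k\<in>UNIV. \<bar>f k\<bar> * q k) * \<bar>\<theta>\<bar> * norm x"
      by (simp add: sum_distrib_left sum_distrib_right abs_mult mult_ac)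
    finally show "norm (branch_op a j0 J \<theta> *v x - branch_op a j0 J 0 *v x)
        \<le> (\<Sum>k\<in>UNIV. \<bar>f k\<bar> * q k) * \<bar>\<theta>\<bar> * norm x" .
  qed
qed


section \<open>Markov kernels with finitely many branches\<close>

text \<open>The kernel acting on functions, written without integrals. A branch of weight 0
  contributes nothing whatever its image is, so meaningless images of impossible branches do no
  harm.\<close>

definition branch_mean :: "'i set \<Rightarrow> ('i \<Rightarrow> 'x \<Rightarrow> real) \<Rightarrow>
    ('i \<Rightarrow> 'x \<Rightarrow> 'x) \<Rightarrow> ('x \<Rightarrow> real) \<Rightarrow> 'x
        \<Rightarrow> real" where
  "branch_mean I w f \<phi> x = (\<Sum>i\<in>I. w i x * \<phi> (f i x))"

text \<open>Common frame for the measurement chain on rays and for the tangent chain. Images are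
  constrained only where the weight is positive, because an impossible branch has no meaningful
  image.\<close>

locale finite_kernel =
  fixes M :: "'x measure" and I :: "'i set" and w :: "'i \<Rightarrow> 'x \<Rightarrow> real"
      and f :: "'i \<Rightarrow> 'x \<Rightarrow> 'x"
    and K :: "'x \<Rightarrow> 'x measure"
  assumes finite_branches: "finite I"
    and weight_nonneg: "\<And>i x. i \<in> I \<Longrightarrow> x \<in> space M \<Longrightarrow> 0 \<le> w i x"
    and weight_sum: "\<And>x. x \<in> space M \<Longrightarrow> (\<Sum>i\<in>I. w i x) = 1"
    and image_in_space: "\<And>i x. i \<in> I \<Longrightarrow> x \<in> space M \<Longrightarrow>
        w i x > 0 \<Longrightarrow> f i x \<in> space M"
    and weight_measurable: "\<And>i. i \<in> I \<Longrightarrow> w i \<in> borel_measurable M"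
    and image_measurable: "\<And>i A. i \<in> I \<Longrightarrow> A \<in> sets M \<Longrightarrow>
        {x \<in> space M. w i x > 0 \<and> f i x \<in> A} \<in> sets M"
    and kernel_eq: "\<And>x. x \<in> space M \<Longrightarrow>
      K x = distr (point_measure {i \<in> I. w i x > 0} (\<lambda>i. ennreal (w i x))) M (\<lambda>i. f i x)"
begin

lemma integral_kernel:
  assumes x: "x \<in> space M" and \<phi>: "\<phi> \<in> borel_measurable M"
  shows "(\<integral>y. \<phi> y \<partial>K x) = branch_mean I w f \<phi> x"
proof -
  let ?I = "{i \<in> I. w i x > 0}"
  have "(\<integral>y. \<phi> y \<partial>K x) = (\<integral>i. \<phi> (f i x) \<partial>point_measure ?I (\<lambda>i. ennreal (w i x)))"
    unfolding kernel_eq [OF x] using \<phi> image_in_space x by (subst integral_distr) auto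
  also have "\<dots> = (\<Sum>i\<in>?I. w i x *\<^sub>R \<phi> (f i x))"
    using finite_branches by (subst lebesgue_integral_point_measure_finite) auto
  also have "\<dots> = (\<Sum>i\<in>I. w i x * \<phi> (f i x))"
    using finite_branches weight_nonneg [OF _ x] by (intro sum.mono_neutral_cong_left) force+
  finally show ?thesis by (simp add: branch_mean_def)
qed

lemma emeasure_kernel:
  assumes x: "x \<in> space M" and A: "A \<in> sets M"
  shows "emeasure (K x) A = ennreal (\<Sum>i\<in>I. w i x * indicator {x. w i x > 0 \<and> f i x \<in> A} x)"
proof -
  let ?I = "{i \<in> I. w i x > 0}"
  let ?f = "\<lambda>i. f i x"
  have "emeasure (K x) A = emeasure (point_measure ?I (\<lambda>i. ennreal (w i x))) (?f -` A \<inter> ?I)"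
    unfolding kernel_eq [OF x] using A image_in_space x
    by (subst emeasure_distr) (auto simp: space_point_measure)
  also have "\<dots> = (\<Sum>i\<in>?f -` A \<inter> ?I. ennreal (w i x))"
    using finite_branches by (subst emeasure_point_measure_finite) auto
  also have "\<dots> = ennreal (\<Sum>i\<in>?f -` A \<inter> ?I. w i x)"
    by (rule sum_ennreal) auto
  also have "(\<Sum>i\<in>?f -` A \<inter> ?I. w i x) = (\<Sum>i\<in>I. w i x * indicator {x. w i x > 0 \<and> f i x \<in> A} x)"
    using finite_branches by (intro sum.mono_neutral_cong_left) (auto simp: indicator_def)
  finally show ?thesis .
qed

lemma kernel_measurable: "K \<in> M \<rightarrow>\<^sub>M subprob_algebra M"
proof (rule measurable_subprob_algebra)
  fix x assume x: "x \<in> space M"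
  show "sets (K x) = sets M" by (simp add: kernel_eq x)
  have "(\<Sum>i\<in>I. w i x * indicator {x. w i x > 0 \<and> f i x \<in> space M} x) = (\<Sum>i\<in>I. w i x)"
    by (intro sum.cong refl) (use image_in_space x weight_nonneg in \<open>force simp: indicator_def\<close>)
  then have "emeasure (K x) (space M) = 1"
    by (subst emeasure_kernel [OF x]) (simp_all add: weight_sum [OF x])
  moreover have "space (K x) = space M" by (simp add: kernel_eq x)
  ultimately show "subprob_space (K x)" by (intro subprob_spaceI) (use x in auto)
next
  fix A assume A: "A \<in> sets M"
  have "(\<lambda>x. ennreal (\<Sum>i\<in>I. w i x * indicator {x \<in> space M. w i x > 0 \<and>
      f i x \<in> A} x)) \<in> borel_measurable M"
    by (rule measurable_compose [OF _ measurable_ennreal])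
      (intro borel_measurable_sum borel_measurable_times borel_measurable_indicator
        weight_measurable image_measurable A)
  then show "(\<lambda>x. emeasure (K x) A) \<in> borel_measurable M"
    by (rule measurable_cong [THEN iffD1, rotated])
      (auto simp: emeasure_kernel A indicator_def intro!: sum.cong arg_cong [of _ _ ennreal])
qed

lemma borel_measurable_branch_mean:
  assumes "\<phi> \<in> borel_measurable M" shows "branch_mean I w f \<phi> \<in> borel_measurable M"
proof -
  have "(\<lambda>x. \<integral>y. \<phi> y \<partial>K x) \<in> borel_measurable M"
    by (rule measurable_compose [OF kernel_measurable integral_measurable_subprob_algebra [OF assms]])
  then show ?thesis
    by (rule measurable_cong [THEN iffD1, rotated]) (simp add: integral_kernel assms)
qed

text \<open>Invariance is given on sets. As an identity \<open>\<mu> \<bind> K = \<mu>\<close> of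
  measures it passes to integrals of bounded functions.\<close>

lemma integral_branch_mean:
  assumes inv: "invariant_prob M K \<mu>" and \<phi>: "\<phi> \<in> borel_measurable M"
    and B: "\<And>x. x \<in> space M \<Longrightarrow> \<bar>\<phi> x\<bar> \<le> B"
  shows "(\<integral>x. branch_mean I w f \<phi> x \<partial>\<mu>) = (\<integral>x. \<phi> x \<partial>\<mu>)"
proof -
  have s: "sets \<mu> = sets M" and p: "prob_space \<mu>" using inv by (auto simp: invariant_prob_def)
  have sp: "space \<mu> = space M" using s by (rule sets_eq_imp_space_eq)
  have ne: "space \<mu> \<noteq> {}" using p by (rule prob_space.not_empty)
  have K: "K \<in> \<mu> \<rightarrow>\<^sub>M subprob_algebra M"
    using kernel_measurable measurable_cong_sets [OF s refl] by blast
  have "\<mu> \<bind> K = \<mu>"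
  proof (rule measure_eqI)
    show "sets (\<mu> \<bind> K) = sets \<mu>"
      using sets_bind [OF _ ne, of K M] by (simp add: s sp kernel_eq)
    fix A assume "A \<in> sets (\<mu> \<bind> K)"
    then have "A \<in> sets M" using \<open>sets (\<mu> \<bind> K) = sets \<mu>\<close> s by simp
    then show "emeasure (\<mu> \<bind> K) A = emeasure \<mu> A"
      using inv by (simp add: emeasure_bind [OF ne K] invariant_prob_def)
  qed
  then have "(\<integral>x. \<phi> x \<partial>\<mu>) = (\<integral>x. \<phi> x \<partial>(\<mu> \<bind> K))" by simp
  also have "\<dots> = (\<integral>x. \<integral>y. \<phi> y \<partial>K x \<partial>\<mu>)"
  proof (rule integral_bind [OF \<phi> B K])
    show "finite_measure \<mu>" by (rule prob_space.finite_measure [OF p])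
    have "emeasure (K x) (space (K x)) \<le> ennreal 1" if "x \<in> space \<mu>" for x
      using subprob_space_kernel [OF K that] subprob_space.subprob_emeasure_le_1 by fastforce
    then show "AE x in \<mu>. emeasure (K x) (space (K x)) \<le> ennreal 1" by simp
  qed
  also have "\<dots> = (\<integral>x. branch_mean I w f \<phi> x \<partial>\<mu>)"
    by (rule Bochner_Integration.integral_cong) (simp_all add: integral_kernel \<phi> sp)
  finally show ?thesis by simp
qed

lemma branch_mean_bound:
  assumes "x \<in> space M" "\<And>y. y \<in> space M \<Longrightarrow> \<phi> y \<le> B"
  shows "branch_mean I w f \<phi> x \<le> B"
proof -
  have "branch_mean I w f \<phi> x \<le> (\<Sum>i\<in>I. w i x * B)"
    unfolding branch_mean_def
  proof (rule sum_mono)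
    fix i assume i: "i \<in> I"
    show "w i x * \<phi> (f i x) \<le> w i x * B"
    proof (cases "w i x > 0")
      case True
      then show ?thesis using image_in_space i assms by (intro mult_left_mono) auto
    qed (use weight_nonneg [OF i assms(1)] in simp)
  qed
  also have "\<dots> = B" by (simp add: weight_sum assms(1) flip: sum_distrib_right)
  finally show ?thesis .
qed

lemma branch_mean_mono:
  assumes "x \<in> space M" "\<And>y. y \<in> space M \<Longrightarrow> \<phi> y \<le> \<psi> y"
  shows "branch_mean I w f \<phi> x \<le> branch_mean I w f \<psi> x"
  unfolding branch_mean_def
proof (rule sum_mono)
  fix i assume i: "i \<in> I"
  show "w i x * \<phi> (f i x) \<le> w i x * \<psi> (f i x)"
  proof (cases "w i x > 0")
    case True
    then show ?thesis using image_in_space i assms by (intro mult_left_mono) auto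
  qed (use weight_nonneg [OF i assms(1)] in simp)
qed

lemma branch_mean_affine:
  assumes "x \<in> space M"
  shows "branch_mean I w f (\<lambda>y. c * \<phi> y + d) x = c * branch_mean I w f \<phi> x + d"
  by (simp add: branch_mean_def algebra_simps sum.distrib weight_sum [OF assms]
      flip: sum_distrib_left)

text \<open>All other branches are dropped. This is the single step from which the lower bounds
  along words are built, for the chain and for its tangent chain.\<close>

lemma branch_mean_ge_branch:
  assumes "x \<in> space M" "i \<in> I" "\<And>y. y \<in> space M \<Longrightarrow> 0 \<le> \<phi> y"
  shows "branch_mean I w f \<phi> x \<ge> w i x * \<phi> (f i x)"
  unfolding branch_mean_def
proof (rule member_le_sum [OF assms(2)])
  fix k assume k: "k \<in> I - {i}"
  show "0 \<le> w k x * \<phi> (f k x)"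
  proof (cases "w k x > 0")
    case True
    then show ?thesis using image_in_space k assms by (intro mult_nonneg_nonneg) auto
  qed (use weight_nonneg [of k x] k assms(1) in simp)
qed (rule finite_branches)

lemma funpow_branch_mean:
  assumes inv: "invariant_prob M K \<mu>" and \<phi>: "\<phi> \<in> borel_measurable M"
    and B: "\<And>x. x \<in> space M \<Longrightarrow> \<bar>\<phi> x\<bar> \<le> B"
  shows "(branch_mean I w f ^^ n) \<phi> \<in> borel_measurable M"
    and "\<And>x. x \<in> space M \<Longrightarrow> \<bar>(branch_mean I w f ^^ n) \<phi> x\<bar> \<le> B"
    and "(\<integral>x. (branch_mean I w f ^^ n) \<phi> x \<partial>\<mu>) = (\<integral>x. \<phi> x \<partial>\<mu>)"
proof (induction n)
  case (Suc n)
  let ?g = "(branch_mean I w f ^^ n) \<phi>"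
  { case 1 show ?case using borel_measurable_branch_mean [OF Suc(1)] by simp }
  { case (2 x)
    \<comment> \<open>The lower bound is the upper bound for the negated function, put into the form
      of \<open>branch_mean_affine\<close>.\<close>
    have "branch_mean I w f (\<lambda>y. (-1) * ?g y + 0) x \<le> B" "branch_mean I w f ?g x \<le> B"
      using Suc(2) 2 by (intro branch_mean_bound; force)+
    then show ?case unfolding branch_mean_affine [OF 2] by simp }
  { case 3 show ?case using integral_branch_mean [OF inv Suc(1) Suc(2)] Suc(3) by simp }
qed (use \<phi> B in auto)

lemma branch_mean_cong:
  assumes "x \<in> space M" "\<And>y. y \<in> space M \<Longrightarrow> \<phi> y = \<psi> y"
  shows "branch_mean I w f \<phi> x = branch_mean I w f \<psi> x"
  using assms by (intro antisym branch_mean_mono) auto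

lemma funpow_branch_mean_mono:
  assumes "x \<in> space M" "\<And>y. y \<in> space M \<Longrightarrow> \<phi> y \<le> \<psi> y"
  shows "(branch_mean I w f ^^ n) \<phi> x \<le> (branch_mean I w f ^^ n) \<psi> x"
  using assms(1) by (induction n arbitrary: x) (simp_all add: assms(2) branch_mean_mono)

lemma funpow_branch_mean_affine:
  assumes "x \<in> space M"
  shows "(branch_mean I w f ^^ n) (\<lambda>y. c * \<phi> y + d) x = c * (branch_mean I w f ^^ n) \<phi> x + d"
  using assms
proof (induction n arbitrary: x)
  case (Suc n)
  have "branch_mean I w f ((branch_mean I w f ^^ n) (\<lambda>y. c * \<phi> y + d)) x
      = branch_mean I w f (\<lambda>y. c * (branch_mean I w f ^^ n) \<phi> y + d) x"
    by (rule branch_mean_cong [OF Suc.prems Suc.IH])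
  then show ?case using branch_mean_affine [OF Suc.prems] by simp
qed simp

lemma funpow_branch_mean_const: "x \<in> space M \<Longrightarrow> (branch_mean I w f ^^ n) (\<lambda>y. d) x = d"
  using funpow_branch_mean_affine [of x n 0 "\<lambda>_. 0" d] by simp

lemma funpow_branch_mean_bounds:
  assumes "x \<in> space M"
  shows "(\<And>y. y \<in> space M \<Longrightarrow> \<phi> y \<le> B) \<Longrightarrow>
      (branch_mean I w f ^^ n) \<phi> x \<le> B"
    and "(\<And>y. y \<in> space M \<Longrightarrow> B \<le> \<phi> y) \<Longrightarrow>
        B \<le> (branch_mean I w f ^^ n) \<phi> x"
  using funpow_branch_mean_mono [OF assms, of \<phi> "\<lambda>_. B"] funpow_branch_mean_mono [OF assms, of "\<lambda>_. B" \<phi>]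
    funpow_branch_mean_const [OF assms] by auto

end


section \<open>Charts\<close>

lemma smooth_on_differentiable: "smooth_on W f \<Longrightarrow> x \<in> W \<Longrightarrow>
    f differentiable (at x)"
  unfolding smooth_on_def using Ck_on.simps(2) by blast

lemma smooth_on_continuous: "smooth_on W f \<Longrightarrow> continuous_on W f"
  unfolding smooth_on_def using Ck_on.simps(1) by blast

lemma has_derivative_eventually:
  assumes "(f has_derivative f') (at x)" "\<forall>\<^sub>F y in nhds x. f y = g y"
  shows "(g has_derivative f') (at x)"
  using assms eventually_nhds_x_imp_x [OF assms(2)]
  by (intro has_derivative_transform_eventually [OF assms(1)])
    (auto simp: eventually_at_filter elim: eventually_mono)

lemma isCont_nhds: "isCont f x \<Longrightarrow> (f \<longlongrightarrow> f x) (nhds x)"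
  unfolding isCont_def using tendsto_at_iff_tendsto_nhds by blast

lemma ray_projector_ray_of:
  assumes "norm x = 1" shows "ray_projector (ray_of x) = projector x"
proof -
  obtain c where c: "cmod c * norm x = 1" "unit_rep (ray_of x) = c *s x"
    using unit_rep_ray_of [of x] assms by (metis norm_zero zero_neq_one)
  then have "c * cnj c = 1" using assms by (simp flip: complex_norm_square)
  moreover have "c * x $ i * cnj (c * x $ j) = (c * cnj c) * (x $ i * cnj (x $ j))" for i j
    by (simp add: mult_ac)
  ultimately have "c * x $ i * cnj (c * x $ j) = x $ i * cnj (x $ j)" for i j by simp
  then show ?thesis
    unfolding ray_projector_def c(2) projector_def vector_smult_component by (simp only:)
qed

lemma open_ray_preimage:
  assumes "open W" shows "open {x. x \<noteq> 0 \<and> ray_of x \<in> W}"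
proof -
  have "open ({x. x \<noteq> 0} :: (complex ^ 'a) set)" by (rule open_Collect_neq) (auto intro: continuous_intros)
  then have "open ({x. x \<noteq> 0} \<inter> ray_of -` W)"
    using continuous_on_ray_of assms continuous_on_open_vimage [of "{x. x \<noteq> 0}"]
    by (metis inf_commute)
  then show ?thesis by (simp add: Collect_conj_eq vimage_def)
qed

text \<open>The last two assumptions are not extra hypotheses of the theorem:
  \<open>finite_proj_clifford\<close> and \<open>branch_map_stabilizer_states\<close> derive them
  from the invariant measures before the locale is interpreted.\<close>

locale blowup_charts =
  fixes ket :: "('n::finite, 'p::prime_card) qray \<Rightarrow> ('n, 'p) qvec"
    and U :: "('n, 'p) qray \<Rightarrow> ('n, 'p) qray set"
    and \<kappa> :: "('n, 'p) qray \<Rightarrow> ('n, 'p) qray \<Rightarrow> ('n, 'p) qvec"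
    and \<eta> :: "('n, 'p) qray \<Rightarrow> ('n, 'p) qvec \<Rightarrow> ('n, 'p) qvec"
    and \<rho> :: "('n, 'p) qray \<Rightarrow> real"
    and a :: "'p mod_ring" and j0 :: 'n
  assumes ket: "\<And>s. s \<in> stabilizer_states \<Longrightarrow> norm (ket s) = 1 \<and> ray_of (ket s) = s"
    and charts: "admissible_charts ket U \<kappa> \<eta> \<rho>"
    and finite_clifford: "finite (proj_clifford :: ('n, 'p) qop set set)"
    and branch_map_stabilizer: "\<And>s J. s \<in> stabilizer_states \<Longrightarrow>
        J \<in> branches \<Longrightarrow>
      branch_prob a j0 J 0 s > 0 \<Longrightarrow> branch_map a j0 J 0 s \<in> stabilizer_states"
begin

abbreviation S :: "('n, 'p) qray set" where "S \<equiv> stabilizer_states"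

lemma finite_S: "finite S"
  unfolding stabilizer_states_def using finite_clifford by simp

lemma norm_ket: "s \<in> S \<Longrightarrow> norm (ket s) = 1" and ray_of_ket: "s \<in> S \<Longrightarrow>
    ray_of (ket s) = s"
  using ket by auto

lemma ket_nonzero: "s \<in> S \<Longrightarrow> ket s \<noteq> 0"
  using norm_ket [of s] by auto

lemma charts_disjoint: "s \<in> S \<Longrightarrow> t \<in> S \<Longrightarrow> \<psi> \<in> U s \<Longrightarrow>
    \<psi> \<in> U t \<Longrightarrow> s = t"
  using charts unfolding admissible_charts_def disjoint_family_on_def by blast

context
  fixes s assumes s: "s \<in> S"
begin

lemma radius_pos: "\<rho> s > 0" and open_chart: "open (U s)" and center_in_chart: "s \<in> U s"
  and chart_center: "\<kappa> s s = 0" and chart_bij: "bij_betw (\<kappa> s) (U s) (tan_ball (ket s) (\<rho> s))"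
  and chart_smooth: "smooth_on {x. x \<noteq> 0 \<and> ray_of x \<in> U s} (\<lambda>x. \<kappa> s (ray_of x))"
  and chart_inv_derivative: "v \<in> tangent (ket s) \<Longrightarrow>
    ((\<lambda>t. ray_projector (inv_into (U s) (\<kappa> s) (t *\<^sub>R v))) has_vector_derivative
      (\<chi> i j. v $ i * cnj (ket s $ j) + ket s $ i * cnj (v $ j))) (at 0)"
  and lift_smooth: "smooth_on (tube (ket s) (\<rho> s)) (\<lambda>x. \<eta> s (tan_proj (ket s) x))"
  and lift_zero: "\<eta> s 0 = ket s"
  and lift: "v \<in> tan_ball (ket s) (\<rho> s) \<Longrightarrow> norm (\<eta> s v) = 1"
    "v \<in> tan_ball (ket s) (\<rho> s) \<Longrightarrow> ray_of (\<eta> s v) = inv_into (U s) (\<kappa> s) v"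
  using charts s unfolding admissible_charts_def by blast+

lemma chart_tangent: "\<psi> \<in> U s \<Longrightarrow> \<kappa> s \<psi> \<in> tangent (ket s)"
  using chart_bij by (auto simp: bij_betw_def tan_ball_def)

lemma chart_inv_chart: "v \<in> tan_ball (ket s) (\<rho> s) \<Longrightarrow> \<kappa> s (inv_into (U s) (\<kappa> s) v) = v"
  and inv_chart_chart: "\<psi> \<in> U s \<Longrightarrow> inv_into (U s) (\<kappa> s) (\<kappa> s \<psi>) = \<psi>"
  using chart_bij unfolding bij_betw_def by (metis f_inv_into_f, metis inv_into_f_f)

lemma chart_continuous: "continuous_on (U s) (\<kappa> s)"
proof -
  have "continuous_on (U s) (\<lambda>r. \<kappa> s (ray_of (unit_rep r)))"
    by (rule continuous_on_unit_rep [where h = "\<lambda>x. \<kappa> s (ray_of x)"])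
      (auto simp: ray_of_smult intro: smooth_on_continuous chart_smooth)
  then show ?thesis by simp
qed

lemma eventually_in_chart:
  assumes "c \<noteq> 0" shows "\<forall>\<^sub>F x in nhds (c *s ket s). x \<noteq> 0 \<and> ray_of x \<in> U s"
proof -
  have "c *s ket s \<in> {x. x \<noteq> 0 \<and> ray_of x \<in> U s}"
    using assms s ket_nonzero ray_of_ket center_in_chart by (simp add: ray_of_smult)
  then show ?thesis
    using eventually_nhds_in_open [OF open_ray_preimage [OF open_chart]] by fastforce
qed

lemma eventually_small_in_ball:
  "\<forall>\<^sub>F x in nhds 0. tan_proj (ket s) x \<in> tan_ball (ket s) (\<rho> s)"
proof -
  have "((\<lambda>x. norm (tan_proj (ket s) x)) \<longlongrightarrow> norm (tan_proj (ket s) 0)) (nhds 0)"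
    by (intro tendsto_intros bounded_linear.tendsto [OF bounded_linear_tan_proj]) (rule filterlim_ident)
  then have "\<forall>\<^sub>F x in nhds 0. norm (tan_proj (ket s) x) < \<rho> s"
    by (rule order_tendstoD) (simp add: radius_pos)
  then show ?thesis
    by eventually_elim (simp add: tan_ball_def tan_proj_in_tangent norm_ket s)
qed

text \<open>The chart condition prescribes the derivative of the rank-one projector of the lift.
  This determines the derivative of the lift up to multiples of \<open>ket s\<close>, the direction
  in which phases move.\<close>

lemma lift_has_derivative:
  obtains E where "((\<lambda>x. \<eta> s (tan_proj (ket s) x)) has_derivative E) (at 0)"
    "\<And>x. \<exists>c. E x = tan_proj (ket s) x + c *s ket s"
proof -
  let ?e = "ket s" and ?T = "tan_proj (ket s)"
  have "0 \<in> tube ?e (\<rho> s)" by (simp add: tube_def radius_pos)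
  then obtain E where E: "((\<lambda>x. \<eta> s (?T x)) has_derivative E) (at 0)"
    using smooth_on_differentiable [OF lift_smooth] unfolding differentiable_def by blast
  have tan: "\<exists>c. E v = v + c *s ?e" if v: "v \<in> tangent ?e" for v
  proof -
    let ?x = "\<lambda>t. \<eta> s (?T (t *\<^sub>R v))"
    have "((\<lambda>t. t *\<^sub>R v) has_derivative (\<lambda>t. t *\<^sub>R v)) (at 0)"
      by (rule bounded_linear_imp_has_derivative) (rule bounded_linear_scaleR_left)
    then have "(?x has_derivative (\<lambda>t. E (t *\<^sub>R v))) (at 0)"
      using has_derivative_compose [of "\<lambda>t. t *\<^sub>R v" _ 0 UNIV "\<lambda>x. \<eta> s (?T x)" E] E by simp
    moreover have "(\<lambda>t. E (t *\<^sub>R v)) = (\<lambda>t. t *\<^sub>R E v)"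
      using has_derivative_linear [OF E] by (simp add: linear_cmul)
    ultimately have x: "(?x has_vector_derivative E v) (at 0)"
      by (simp add: has_vector_derivative_def)
    have xi: "((\<lambda>t. ?x t $ i) has_vector_derivative E v $ i) (at 0)" for i
      by (rule bounded_linear.has_vector_derivative [OF bounded_linear_vec_nth x])
    \<comment> \<open>Both sides are the derivative at 0 of an entry of the projector along the
      curve: once by the product rule for the lift, once by the chart condition.\<close>
    have "E v $ i * cnj (?e $ j) + ?e $ i * cnj (E v $ j) = v $ i * cnj (?e $ j) + ?e $ i * cnj (v $ j)"
      for i j
    proof (rule vector_derivative_unique_at)
      have "((\<lambda>t. ?x t $ i * cnj (?x t $ j)) has_vector_derivative
          ?x 0 $ i * cnj (E v $ j) + E v $ i * cnj (?x 0 $ j)) (at 0)"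
        by (rule has_vector_derivative_mult [OF xi bounded_linear.has_vector_derivative [OF
            bounded_linear_cnj xi]])
      then show "((\<lambda>t. ?x t $ i * cnj (?x t $ j)) has_vector_derivative
          E v $ i * cnj (?e $ j) + ?e $ i * cnj (E v $ j)) (at 0)"
        by (simp add: lift_zero add.commute)
      have "((\<lambda>t. ray_projector (inv_into (U s) (\<kappa> s) (t *\<^sub>R v)) $ i $ j) has_vector_derivative
          (\<chi> i j. v $ i * cnj (?e $ j) + ?e $ i * cnj (v $ j)) $ i $ j) (at 0)"
        by (intro bounded_linear.has_vector_derivative [OF bounded_linear_vec_nth] chart_inv_derivative v)
      moreover have "\<forall>\<^sub>F t in nhds 0. ray_projector (inv_into (U s) (\<kappa> s) (t *\<^sub>R v)) $ i $ j =
          ?x t $ i * cnj (?x t $ j)"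
      proof -
        have "((\<lambda>t. t *\<^sub>R v) \<longlongrightarrow> 0 *\<^sub>R v) (nhds (0::real))"
          by (intro tendsto_intros) (rule filterlim_ident)
        then have "\<forall>\<^sub>F t in nhds 0. ?T (t *\<^sub>R v) \<in> tan_ball ?e (\<rho> s)"
          using eventually_compose_filterlim [OF eventually_small_in_ball] by simp
        then show ?thesis
        proof eventually_elim
          case (elim t)
          have "?T (t *\<^sub>R v) = t *\<^sub>R v" using v by (simp add: tan_proj_tangent tangent_scaleR)
          then show ?case using elim
            by (simp add: lift(1) ray_projector_ray_of projector_def flip: lift(2))
        qed
      qed
      ultimately have "((\<lambda>t. ?x t $ i * cnj (?x t $ j)) has_vector_derivative
          (\<chi> i j. v $ i * cnj (?e $ j) + ?e $ i * cnj (v $ j)) $ i $ j) (at 0)"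
        unfolding has_vector_derivative_def by (rule has_derivative_eventually)
      then show "((\<lambda>t. ?x t $ i * cnj (?x t $ j)) has_vector_derivative
          v $ i * cnj (?e $ j) + ?e $ i * cnj (v $ j)) (at 0)" by simp
    qed
    note eq = this
    \<comment> \<open>Applying both matrices to \<open>ket s\<close> isolates \<open>E v\<close>,
      because \<open>v\<close> is orthogonal to \<open>ket s\<close>.\<close>
    have expand: "(\<Sum>j\<in>UNIV. (x $ i * cnj (?e $ j) + ?e $ i * cnj (x $ j)) * ?e $ j)
        = x $ i * cinner ?e ?e + ?e $ i * cinner x ?e" for x i
      by (simp add: cinner_def sum.distrib sum_distrib_left distrib_right mult.assoc)
    have "E v $ i * cinner ?e ?e + ?e $ i * cinner (E v) ?e
        = v $ i * cinner ?e ?e + ?e $ i * cinner v ?e" for i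
      unfolding expand [symmetric] by (simp only: eq)
    moreover have "cinner v ?e = 0" using v by (simp add: tangent_def cinner_commute [of v])
    ultimately have "E v $ i + ?e $ i * cinner (E v) ?e = v $ i" for i
      using s by (simp add: norm_sq_cinner norm_ket)
    then have "E v = v + (- cinner (E v) ?e) *s ?e"
      by (simp add: vec_eq_iff algebra_simps)
    then show ?thesis by blast
  qed
  have "\<exists>c. E x = ?T x + c *s ?e" for x
  proof -
    \<comment> \<open>The lift is seen only through \<open>tan_proj\<close>, so its derivative
      factors through it and the tangent case suffices.\<close>
    have "((\<lambda>x. \<eta> s (?T (?T x))) has_derivative (\<lambda>x. E (?T x))) (at 0)"
      using has_derivative_compose [OF bounded_linear_imp_has_derivative [OF bounded_linear_tan_proj],
          of "\<lambda>x. \<eta> s (?T x)" E ?e 0 UNIV] E by simp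
    moreover have "?T (?T x) = ?T x" for x
      by (simp add: tan_proj_tangent tan_proj_in_tangent norm_ket s)
    ultimately have "((\<lambda>x. \<eta> s (?T x)) has_derivative (\<lambda>x. E (?T x))) (at 0)" by simp
    then have "E = (\<lambda>x. E (?T x))" by (rule has_derivative_unique [OF E])
    then have "E x = E (?T x)" by (rule fun_cong)
    then show ?thesis using tan [OF tan_proj_in_tangent [OF norm_ket [OF s]], of x] by simp
  qed
  then show ?thesis using that E by blast
qed

text \<open>The pulled-back chart depends on the ray only, so its derivative \<open>G\<close> kills
  complex multiples of \<open>ket s\<close>. Composed with the lift it is the identity in chart
  coordinates, which gives \<open>G (E x) = tan_proj (ket s) x\<close>; and \<open>E x\<close>
  differs from \<open>x\<close> only by a multiple of \<open>ket s\<close>.\<close>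

lemma chart_has_derivative_ket: "((\<lambda>x. \<kappa> s (ray_of x)) has_derivative tan_proj (ket s)) (at (ket s))"
proof -
  let ?e = "ket s" and ?T = "tan_proj (ket s)" and ?g = "\<lambda>x. \<kappa> s (ray_of x)"
  have "ket s \<in> {x. x \<noteq> 0 \<and> ray_of x \<in> U s}"
    by (simp add: ket_nonzero ray_of_ket center_in_chart s)
  then obtain G where G: "(?g has_derivative G) (at ?e)"
    using smooth_on_differentiable [OF chart_smooth] unfolding differentiable_def by blast
  interpret G: bounded_linear G by (rule has_derivative_bounded_linear [OF G])
  obtain E where E: "((\<lambda>x. \<eta> s (?T x)) has_derivative E) (at 0)"
    "\<And>x. \<exists>c. E x = ?T x + c *s ?e" by (rule lift_has_derivative) blast
  have radial: "G (c *s ?e) = 0" for c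
  proof -
    let ?h = "\<lambda>t :: real. ?g (?e + t *\<^sub>R (c *s ?e))"
    have "((\<lambda>t. ?e + t *\<^sub>R (c *s ?e)) has_derivative (\<lambda>t. t *\<^sub>R (c *s ?e))) (at 0)"
      by (auto intro!: derivative_eq_intros)
    then have "(?h has_derivative (\<lambda>t. G (t *\<^sub>R (c *s ?e)))) (at 0)"
      using has_derivative_compose [of "\<lambda>t. ?e + t *\<^sub>R (c *s ?e)" _ 0 UNIV ?g G] G by simp
    moreover have "\<forall>\<^sub>F t in nhds (0 :: real). ?h t = ?g ?e"
    proof -
      have "((\<lambda>t. 1 + of_real t * c) \<longlongrightarrow> 1 + of_real 0 * c) (nhds 0)"
        by (intro tendsto_intros) (rule filterlim_ident)
      then have "\<forall>\<^sub>F t in nhds 0. 1 + of_real t * c \<noteq> 0"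
        by (rule tendsto_imp_eventually_ne) simp
      then show ?thesis
      proof eventually_elim
        case (elim t)
        have "?e + t *\<^sub>R (c *s ?e) = (1 + of_real t * c) *s ?e"
          by (simp add: scaleR_eq_smult vec_eq_iff algebra_simps)
        then show ?case using elim by (simp only: ray_of_smult not_False_eq_True)
      qed
    qed
    ultimately have "((\<lambda>t::real. ?g ?e) has_derivative (\<lambda>t. G (t *\<^sub>R (c *s ?e)))) (at 0)"
      by (rule has_derivative_eventually)
    then have "(\<lambda>t. G (t *\<^sub>R (c *s ?e))) = (\<lambda>t. 0)"
      using has_derivative_unique has_derivative_const by blast
    then show ?thesis by (metis scaleR_one)
  qed
  have "((\<lambda>x. ?g (\<eta> s (?T x))) has_derivative (\<lambda>x. G (E x))) (at 0)"
    using has_derivative_compose [OF E(1), of ?g G] G by (simp add: lift_zero)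
  moreover have "\<forall>\<^sub>F x in nhds 0. ?g (\<eta> s (?T x)) = ?T x"
    using eventually_small_in_ball by eventually_elim (simp add: lift(2) chart_inv_chart)
  ultimately have "(?T has_derivative (\<lambda>x. G (E x))) (at 0)"
    by (rule has_derivative_eventually)
  then have "(\<lambda>x. G (E x)) = ?T"
    using has_derivative_unique bounded_linear_imp_has_derivative bounded_linear_tan_proj by blast
  then have "G (E x) = ?T x" for x by metis
  moreover have "G (E x) = G x" for x
  proof -
    obtain c where "E x = ?T x + c *s ?e" using E(2) by blast
    then have "E x = x + (c - cinner ?e x) *s ?e" by (simp add: tan_proj_def vec_eq_iff algebra_simps)
    then show ?thesis by (simp only: G.add radial add_0_right)
  qed
  ultimately have "G = ?T" by auto
  then show ?thesis using G by simp
qed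

text \<open>Scale invariance of the pulled-back chart carries the derivative from
  \<open>ket s\<close> to its multiples.\<close>

lemma chart_has_derivative:
  assumes "c \<noteq> 0"
  shows "((\<lambda>x. \<kappa> s (ray_of x)) has_derivative (\<lambda>x. tan_proj (ket s) ((1 / c) *s x))) (at (c *s ket s))"
proof -
  have "((\<lambda>x. (1 / c) *s x) has_derivative (\<lambda>x. (1 / c) *s x)) (at (c *s ket s))"
    by (rule bounded_linear_imp_has_derivative) (rule bounded_linear_smult)
  moreover have "(1 / c) *s (c *s ket s) = ket s"
    using assms by (simp add: vector_smult_assoc)
  ultimately have "((\<lambda>x. \<kappa> s (ray_of ((1 / c) *s x))) has_derivative (\<lambda>x. tan_proj (ket s) ((1 / c) *s
      x))) (at (c *s ket s))"
    using has_derivative_compose [of "\<lambda>x. (1 / c) *s x" _ "c *s ket s" UNIV "\<lambda>x. \<kappa> s (ray_of x)"]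
      chart_has_derivative_ket by simp
  then show ?thesis using assms by (simp add: ray_of_smult)
qed

end

text \<open>For v of norm at most R the point (\<theta> v, \<theta>) has norm at most \<theta> (|R|
  + 1). Hence a property valid near the origin of pairs holds uniformly on bounded sets of the
  blow-up coordinate.\<close>

lemma eventually_at_right_scaled:
  fixes P :: "'b::real_normed_vector \<times> real \<Rightarrow> bool"
  assumes "\<forall>\<^sub>F z in nhds 0. P z"
  shows "\<forall>\<^sub>F \<theta> in at_right 0. \<forall>v. norm v \<le> R \<longrightarrow> P (\<theta> *\<^sub>R v, \<theta>)"
proof -
  obtain d where d: "d > 0" "\<And>z. dist z 0 < d \<Longrightarrow> P z"
    using assms unfolding eventually_nhds_metric by blast
  have "0 < d / (\<bar>R\<bar> + 1)" using d(1) by (intro divide_pos_pos) auto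
  from eventually_at_right_real [OF this]
  have "\<forall>\<^sub>F \<theta> in at_right 0. \<theta> < d / (\<bar>R\<bar> + 1)" by eventually_elim simp
  moreover have "\<forall>\<^sub>F \<theta> in at_right (0::real). \<theta> > 0" by (simp add: eventually_at_right_less)
  ultimately show ?thesis
  proof eventually_elim
    case (elim \<theta>)
    have "P (\<theta> *\<^sub>R v, \<theta>)" if v: "norm v \<le> R" for v
    proof (rule d(2))
      have "norm (\<theta> *\<^sub>R v, \<theta>) \<le> \<theta> * norm v + \<theta>"
        using norm_Pair_le [of "\<theta> *\<^sub>R v" \<theta>] elim by simp
      also have "\<dots> \<le> \<theta> * (\<bar>R\<bar> + 1)"
        using v elim by (simp add: distrib_left)
      also have "\<dots> < d" using elim by (simp add: field_simps)
      finally show "dist (\<theta> *\<^sub>R v, \<theta>) 0 < d" by simp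
    qed
    then show ?case by blast
  qed
qed

section \<open>First-order expansion of the branches at a stabilizer state\<close>

lemma branch_op_ket:
  assumes s: "s \<in> S" and J: "J \<in> branches"
  shows "branch_prob a j0 J \<theta> s = (norm (branch_op a j0 J \<theta> *v ket s))\<^sup>2"
    and "branch_map a j0 J \<theta> s = ray_of (branch_op a j0 J \<theta> *v ket s)"
  using branch_prob_ray_of [OF ket_nonzero [OF s] J] branch_map_ray_of [OF ket_nonzero [OF s]]
  by (simp_all add: ray_of_ket norm_ket s)

lemma branch_op_ket_eq:
  assumes s: "s \<in> S" and J: "J \<in> branches" and p: "branch_prob a j0 J 0 s > 0"
  obtains c where "c \<noteq> 0" "branch_op a j0 J 0 *v ket s = c *s ket (branch_map a j0 J 0 s)"
proof -
  let ?t = "branch_map a j0 J 0 s"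
  have t: "?t \<in> S" by (rule branch_map_stabilizer [OF assms])
  have "branch_op a j0 J 0 *v ket s \<noteq> 0" using p by (auto simp: branch_op_ket s J)
  moreover have "ray_of (ket ?t) = ray_of (branch_op a j0 J 0 *v ket s)"
    using t by (simp add: ray_of_ket branch_op_ket s J flip: branch_op_ket(2))
  ultimately show ?thesis using ray_of_eqD ket_nonzero [OF t] that by metis
qed

text \<open>The multiple \<open>c\<close> of \<open>ket s\<close> stays undetermined. This is
  harmless, since a possible branch sends \<open>ket s\<close> to a multiple of the next
  representative, which the tangent projection there removes.\<close>

lemma lift_branch_has_derivative:
  assumes s: "s \<in> S" 
  obtains K where "((\<lambda>z :: ('n, 'p) qvec \<times> real. branch_op a j0 J (snd z) *v \<eta> s (tan_proj (ket s) (fst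
      z))) has_derivative K) (at 0)"
    and "\<exists>k. \<forall>u \<theta>. \<exists>c. K (u, \<theta>) = branch_op a j0 J 0 *v (tan_proj (ket s) u + c *s ket s) + \<theta> *\<^sub>R k"
proof -
  obtain E where E: "((\<lambda>x. \<eta> s (tan_proj (ket s) x)) has_derivative E) (at 0)"
    "\<And>x. \<exists>c. E x = tan_proj (ket s) x + c *s ket s" by (rule lift_has_derivative [OF s]) blast
  obtain K' :: "('n, 'p) qvec \<Rightarrow> ('n, 'p) qvec"
    where K': "\<And>t t' h h' (z :: ('n, 'p) qvec \<times> real).
    (t has_derivative t') (at z) \<Longrightarrow> (h has_derivative h') (at z) \<Longrightarrow> t z =
        0 \<Longrightarrow>
    ((\<lambda>z. branch_op a j0 J (t z) *v h z) has_derivative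
      (\<lambda>y. branch_op a j0 J 0 *v h' y + t' y *\<^sub>R K' (h z))) (at z)"
    by (rule branch_op_has_derivative [where 'z = "('n, 'p) qvec \<times> real"]) blast
  have fst: "((\<lambda>z. fst z) has_derivative fst) (at (0 :: ('n, 'p) qvec \<times> real))"
    by (rule bounded_linear_imp_has_derivative) (rule bounded_linear_fst)
  have snd: "((\<lambda>z. snd z) has_derivative snd) (at (0 :: ('n, 'p) qvec \<times> real))"
    by (rule bounded_linear_imp_has_derivative) (rule bounded_linear_snd)
  have "((\<lambda>z. \<eta> s (tan_proj (ket s) (fst z))) has_derivative (\<lambda>z. E (fst z))) (at (0 :: ('n,
      'p) qvec \<times> real))"
    using has_derivative_compose [OF fst, of "\<lambda>x. \<eta> s (tan_proj (ket s) x)" E] E(1) by simp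
  from K' [OF snd this]
  have *: "((\<lambda>z. branch_op a j0 J (snd z) *v \<eta> s (tan_proj (ket s) (fst z))) has_derivative
      (\<lambda>y. branch_op a j0 J 0 *v E (fst y) + snd y *\<^sub>R K' (ket s))) (at 0)"
    by (simp add: lift_zero s)
  show ?thesis
  proof (rule that [OF *], intro exI [of _ "K' (ket s)"] allI)
    fix u \<theta>
    obtain d where "E u = tan_proj (ket s) u + d *s ket s" using E(2) by blast
    then show "\<exists>c. branch_op a j0 J 0 *v E (fst (u, \<theta>)) + snd (u, \<theta>) *\<^sub>R K' (ket s)
        = branch_op a j0 J 0 *v (tan_proj (ket s) u + c *s ket s) + \<theta> *\<^sub>R K' (ket s)"
      by (intro exI [of _ d]) simp
  qed
qed

text \<open>Continuity in the pair (u, \<theta>) at the origin, read along the scaled points: at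
  scale \<theta> the transition probabilities are those of the stabilizer state itself up to
  \<open>e\<close>.\<close>

lemma branch_prob_uniform:
  assumes s: "s \<in> S" and J: "J \<in> branches" and e: "e > 0"
  shows "\<forall>\<^sub>F \<theta> in at_right 0. \<forall>v\<in>tangent (ket s). norm v \<le> R \<longrightarrow>
    \<theta> *\<^sub>R v \<in> tan_ball (ket s) (\<rho> s) \<and>
    \<bar>branch_prob a j0 J \<theta> (inv_into (U s) (\<kappa> s) (\<theta> *\<^sub>R v)) - branch_prob a j0 J 0 s\<bar> \<le> e"
proof -
  let ?x = "\<lambda>z :: ('n, 'p) qvec \<times> real. branch_op a j0 J (snd z) *v \<eta> s (tan_proj (ket s) (fst z))"
  obtain K where "(?x has_derivative K) (at 0)" by (rule lift_branch_has_derivative [OF s]) blast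
  then have "isCont ?x 0" by (rule has_derivative_continuous)
  then have "(?x \<longlongrightarrow> ?x 0) (nhds 0)" by (rule isCont_nhds)
  then have "((\<lambda>z. (norm (?x z))\<^sup>2) \<longlongrightarrow> (norm (?x 0))\<^sup>2) (nhds 0)" by (intro tendsto_intros)
  then have "\<forall>\<^sub>F z in nhds 0. dist ((norm (?x z))\<^sup>2) ((norm (?x 0))\<^sup>2) < e" using e by (rule tendstoD)
  moreover have "(norm (?x 0))\<^sup>2 = branch_prob a j0 J 0 s" by (simp add: lift_zero s branch_op_ket J)
  ultimately have 1: "\<forall>\<^sub>F z in nhds 0. \<bar>(norm (?x z))\<^sup>2 - branch_prob a j0 J 0 s\<bar> < e"
    by (simp add: dist_real_def)
  have "((\<lambda>z. fst z) \<longlongrightarrow> 0) (nhds (0 :: ('n, 'p) qvec \<times> real))"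
    using tendsto_fst [OF filterlim_ident, of "0 :: ('n, 'p) qvec \<times> real"] by simp
  then have 2: "\<forall>\<^sub>F z in nhds (0 :: ('n, 'p) qvec \<times> real). tan_proj (ket s) (fst z) \<in> tan_ball (ket s)
      (\<rho> s)"
    by (rule eventually_compose_filterlim [OF eventually_small_in_ball [OF s]])
  show ?thesis
    using eventually_at_right_scaled [OF eventually_conj [OF 1 2], of R]
  proof eventually_elim
    case (elim \<theta>)
    show ?case
    proof (intro ballI impI)
      fix v assume v: "v \<in> tangent (ket s)" "norm v \<le> R"
      then have T: "tan_proj (ket s) (\<theta> *\<^sub>R v) = \<theta> *\<^sub>R v" by (simp add: tan_proj_tangent tangent_scaleR)
      then have b: "\<theta> *\<^sub>R v \<in> tan_ball (ket s) (\<rho> s)" using elim v by auto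
      have n: "norm (\<eta> s (\<theta> *\<^sub>R v)) = 1" by (rule lift(1) [OF s b])
      then have "\<eta> s (\<theta> *\<^sub>R v) \<noteq> 0" by auto
      from branch_prob_ray_of [OF this J]
      have "branch_prob a j0 J \<theta> (inv_into (U s) (\<kappa> s) (\<theta> *\<^sub>R v)) = (norm (?x (\<theta> *\<^sub>R v, \<theta>)))\<^sup>2"
        by (simp add: T n flip: lift(2) [OF s b])
      moreover have "\<bar>(norm (?x (\<theta> *\<^sub>R v, \<theta>)))\<^sup>2 - branch_prob a j0 J 0 s\<bar> < e"
        using elim v(2) by blast
      ultimately show "\<theta> *\<^sub>R v \<in> tan_ball (ket s) (\<rho> s) \<and>
        \<bar>branch_prob a j0 J \<theta> (inv_into (U s) (\<kappa> s) (\<theta> *\<^sub>R v)) - branch_prob a j0 J 0 s\<bar> \<le> e"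
        using b by simp
    qed
  qed
qed

text \<open>All conclusions come from one derivative. In charts the branch is
  \<open>\<kappa> t\<close> applied to the ray of an explicit vector function of (u, \<theta>), with
  derivative \<open>A u + \<theta> *\<^sub>R b\<close> at the origin. The two axes give the linear
  part and the shift; the remainder at (\<theta> v, \<theta>), divided by \<theta>, gives the
  uniform convergence.\<close>

lemma
  assumes s: "s \<in> S" and J: "J \<in> branches" and p: "branch_prob a j0 J 0 s > 0"
    and c: "c \<noteq> 0" "branch_op a j0 J 0 *v ket s = c *s ket (branch_map a j0 J 0 s)"
  shows branch_linear_eq: "branch_linear ket U \<kappa> a j0 J s v =
      tan_proj (ket (branch_map a j0 J 0 s)) ((1 / c) *s (branch_op a j0 J 0 *v tan_proj (ket s) v))"
    and branch_shift_tangent: "branch_shift U \<kappa> a j0 J s \<in> tangent (ket (branch_map a j0 J 0 s))"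
    and branch_uniform: "e > 0 \<Longrightarrow> \<forall>\<^sub>F \<theta> in at_right 0. \<forall>v\<in>tangent (ket s). norm v \<le> R \<longrightarrow>
      branch_map a j0 J \<theta> (inv_into (U s) (\<kappa> s) (\<theta> *\<^sub>R v)) \<in> U (branch_map a j0 J 0 s) \<and>
      norm (\<kappa> (branch_map a j0 J 0 s) (branch_map a j0 J \<theta> (inv_into (U s) (\<kappa> s) (\<theta> *\<^sub>R v))) /\<^sub>R \<theta>
        - (branch_linear ket U \<kappa> a j0 J s v + branch_shift U \<kappa> a j0 J s)) \<le> e"
proof -
  define t where "t = branch_map a j0 J 0 s"
  let ?x = "\<lambda>z :: ('n, 'p) qvec \<times> real. branch_op a j0 J (snd z) *v \<eta> s (tan_proj (ket s) (fst z))"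
  let ?H = "\<lambda>z. \<kappa> t (ray_of (?x z))"
  have t: "t \<in> S" unfolding t_def by (rule branch_map_stabilizer [OF s J p])
  have x0: "?x 0 = c *s ket t" by (simp add: lift_zero s c(2) t_def)
  obtain K k where K: "(?x has_derivative K) (at 0)"
    and k: "\<forall>u \<theta>. \<exists>d. K (u, \<theta>) = branch_op a j0 J 0 *v (tan_proj (ket s) u + d *s ket s) + \<theta> *\<^sub>R k"
    by (rule lift_branch_has_derivative [OF s, of J]) blast
  define A where "A v = tan_proj (ket t) ((1 / c) *s (branch_op a j0 J 0 *v tan_proj (ket s) v))" for v
  define b where "b = tan_proj (ket t) ((1 / c) *s k)"
  \<comment> \<open>The undetermined multiple of \<open>ket s\<close> becomes a multiple of
    \<open>ket t\<close> and vanishes under \<open>tan_proj (ket t)\<close>.\<close>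
  have D: "tan_proj (ket t) ((1 / c) *s K (u, \<theta>)) = A u + \<theta> *\<^sub>R b" for u \<theta>
  proof -
    obtain d where "K (u, \<theta>) = branch_op a j0 J 0 *v (tan_proj (ket s) u + d *s ket s) + \<theta> *\<^sub>R k"
      using k by blast
    then have "K (u, \<theta>) = branch_op a j0 J 0 *v tan_proj (ket s) u + (d * c) *s ket t + of_real \<theta> *s k"
      by (simp add: matrix_vector_right_distrib matrix_vector_smult c(2) t_def vector_smult_assoc
          scaleR_eq_smult)
    then show ?thesis
      using t by (simp add: A_def b_def vector_add_ldistrib tan_proj_add tan_proj_smult tan_proj_self
          norm_ket
          scaleR_eq_smult vector_smult_assoc mult_ac)
  qed
  have H: "(?H has_derivative (\<lambda>z. A (fst z) + snd z *\<^sub>R b)) (at 0)"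
  proof -
    have "(?H has_derivative (\<lambda>z. tan_proj (ket t) ((1 / c) *s K z))) (at 0)"
      by (rule has_derivative_compose [OF K]) (simp only: x0 chart_has_derivative [OF t c(1)])
    moreover have "tan_proj (ket t) ((1 / c) *s K z) = A (fst z) + snd z *\<^sub>R b" for z
      using D [of "fst z" "snd z"] by simp
    ultimately show ?thesis by simp
  qed
  have H0: "?H 0 = 0" unfolding x0 using c(1) t by (simp add: ray_of_smult ray_of_ket chart_center)
  have ball: "\<forall>\<^sub>F z in nhds (0 :: ('n, 'p) qvec \<times> real). tan_proj (ket s) (fst z) \<in> tan_ball (ket s) (\<rho> s)"
  proof -
    have "((\<lambda>z. fst z) \<longlongrightarrow> 0) (nhds (0 :: ('n, 'p) qvec \<times> real))"
      using tendsto_fst [OF filterlim_ident, of "0 :: ('n, 'p) qvec \<times> real"] by simp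
    then show ?thesis by (rule eventually_compose_filterlim [OF eventually_small_in_ball [OF s]])
  qed
  have cb: "branch_map a j0 J (snd z) (inv_into (U s) (\<kappa> s) (tan_proj (ket s) (fst z))) = ray_of (?x z)"
    if z: "tan_proj (ket s) (fst z) \<in> tan_ball (ket s) (\<rho> s)" for z
  proof -
    have "\<eta> s (tan_proj (ket s) (fst z)) \<noteq> 0" using lift(1) [OF s z] by auto
    then show ?thesis by (simp add: branch_map_ray_of flip: lift(2) [OF s z])
  qed
  have eq: "\<forall>\<^sub>F z in nhds (0 :: ('n, 'p) qvec \<times> real). ?H z =
      chart_branch U \<kappa> a j0 J s (tan_proj (ket s) (fst z)) (snd z)"
    using ball by eventually_elim (simp add: chart_branch_def cb flip: t_def)
  have Hc: "((\<lambda>z. chart_branch U \<kappa> a j0 J s (tan_proj (ket s) (fst z)) (snd z))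
      has_derivative (\<lambda>z. A (fst z) + snd z *\<^sub>R b)) (at (0 :: ('n, 'p) qvec \<times> real))"
    by (rule has_derivative_eventually [OF H eq])
  have lin: "branch_linear ket U \<kappa> a j0 J s = A"
  proof -
    have "((\<lambda>x. (x, 0)) has_derivative (\<lambda>x. (x, 0))) (at (0 :: ('n, 'p) qvec))"
      by (auto intro!: derivative_eq_intros)
    from has_derivative_compose [OF this, of "\<lambda>z. chart_branch U \<kappa> a j0 J s (tan_proj (ket s) (fst z))
        (snd z)" "\<lambda>z. A (fst z) + snd z *\<^sub>R b"] Hc
    have "((\<lambda>x. chart_branch U \<kappa> a j0 J s (tan_proj (ket s) x) 0) has_derivative A) (at 0)"
      by (simp add: zero_prod_def)
    then show ?thesis unfolding branch_linear_def by (metis frechet_derivative_at)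
  qed
  have shift: "branch_shift U \<kappa> a j0 J s = b"
  proof -
    have "((\<lambda>\<theta>. (0, \<theta>)) has_derivative (\<lambda>\<theta>. (0 :: ('n, 'p) qvec, \<theta>))) (at (0 :: real))"
      by (auto intro!: derivative_eq_intros)
    from has_derivative_compose [OF this, of "\<lambda>z. chart_branch U \<kappa> a j0 J s (tan_proj (ket s) (fst z))
        (snd z)" "\<lambda>z. A (fst z) + snd z *\<^sub>R b"] Hc
    have "((\<lambda>\<theta>. chart_branch U \<kappa> a j0 J s 0 \<theta>) has_derivative (\<lambda>\<theta>. A 0 + \<theta> *\<^sub>R b)) (at 0)"
      by (simp add: zero_prod_def)
    moreover have "A 0 = 0" by (simp add: A_def)
    ultimately have "((\<lambda>\<theta>. chart_branch U \<kappa> a j0 J s 0 \<theta>) has_vector_derivative b) (at 0)"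
      by (simp add: has_vector_derivative_def)
    then show ?thesis unfolding branch_shift_def by (rule vector_derivative_at)
  qed
  show "branch_linear ket U \<kappa> a j0 J s v =
      tan_proj (ket (branch_map a j0 J 0 s)) ((1 / c) *s (branch_op a j0 J 0 *v tan_proj (ket s) v))"
    by (simp add: lin A_def t_def)
  show "branch_shift U \<kappa> a j0 J s \<in> tangent (ket (branch_map a j0 J 0 s))"
    using t by (simp add: shift b_def tan_proj_in_tangent norm_ket flip: t_def)
  assume e: "e > 0"
  \<comment> \<open>The point (\<theta> v, \<theta>) has norm at most \<theta> (|R| + 1), so this
    rate leaves the error \<open>e\<close> after division by \<theta>.\<close>
  let ?e = "e / (\<bar>R\<bar> + 1)"
  have e': "?e > 0" using e by (auto intro!: divide_pos_pos)
  have "\<forall>\<^sub>F z in nhds 0. norm (?H z - (A (fst z) + snd z *\<^sub>R b)) \<le> ?e * norm z"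
  proof -
    obtain d where d: "d > 0"
      "\<And>y. norm (y - 0) < d \<Longrightarrow> norm (?H y - ?H 0 - (A (fst (y - 0)) + snd (y - 0)
          *\<^sub>R b)) \<le> ?e * norm (y - 0)"
      using H e' unfolding has_derivative_at_alt by blast
    show ?thesis
      unfolding eventually_nhds_metric
    proof (intro exI conjI allI impI)
      fix z :: "('n, 'p) qvec \<times> real" assume "dist z 0 < d"
      then show "norm (?H z - (A (fst z) + snd z *\<^sub>R b)) \<le> ?e * norm z"
        using d(2) [of z] by (simp only: H0 diff_zero dist_norm)
    qed (rule d(1))
  qed
  moreover have "\<forall>\<^sub>F z in nhds 0. ?x z \<noteq> 0 \<and> ray_of (?x z) \<in> U t"
  proof (rule eventually_compose_filterlim [OF eventually_in_chart [OF t c(1)]])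
    show "(?x \<longlongrightarrow> c *s ket t) (nhds 0)"
      using isCont_nhds [OF has_derivative_continuous [OF K]] unfolding x0 .
  qed
  ultimately have "\<forall>\<^sub>F z in nhds 0. norm (?H z - (A (fst z) + snd z *\<^sub>R b)) \<le> ?e * norm z \<and>
      (?x z \<noteq> 0 \<and> ray_of (?x z) \<in> U t) \<and> tan_proj (ket s) (fst z) \<in> tan_ball (ket s) (\<rho> s)"
    using ball by eventually_elim blast
  from eventually_at_right_scaled [OF this, of R] 
  have "\<forall>\<^sub>F \<theta> in at_right 0. \<forall>v\<in>tangent (ket s). norm v \<le> R \<longrightarrow>
      branch_map a j0 J \<theta> (inv_into (U s) (\<kappa> s) (\<theta> *\<^sub>R v)) \<in> U t \<and>
      norm (\<kappa> t (branch_map a j0 J \<theta> (inv_into (U s) (\<kappa> s) (\<theta> *\<^sub>R v))) /\<^sub>R \<theta> - (A v + b)) \<le> e"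
    using eventually_at_right_less
  proof eventually_elim
    case (elim \<theta>)
    show ?case
    proof (intro ballI impI)
      fix v assume v: "v \<in> tangent (ket s)" "norm v \<le> R"
      let ?z = "(\<theta> *\<^sub>R v, \<theta>)"
      have el: "norm (?H ?z - (A (fst ?z) + snd ?z *\<^sub>R b)) \<le> ?e * norm ?z"
        "ray_of (?x ?z) \<in> U t" "tan_proj (ket s) (fst ?z) \<in> tan_ball (ket s) (\<rho> s)"
        using elim(1) v(2) by blast+
      have T: "tan_proj (ket s) (\<theta> *\<^sub>R v) = \<theta> *\<^sub>R v" using v by (simp add: tan_proj_tangent tangent_scaleR)
      have m: "branch_map a j0 J \<theta> (inv_into (U s) (\<kappa> s) (\<theta> *\<^sub>R v)) = ray_of (?x ?z)"
        using cb [of ?z] el(3) unfolding fst_conv snd_conv T by blast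
      have "A (\<theta> *\<^sub>R v) = \<theta> *\<^sub>R A v"
        by (simp add: A_def scaleR_eq_smult tan_proj_smult matrix_vector_smult vector_smult_assoc
            mult.commute)
      then have "?H ?z - (A (fst ?z) + snd ?z *\<^sub>R b) = \<theta> *\<^sub>R (?H ?z /\<^sub>R \<theta> - (A v + b))"
        using elim(2) by (simp add: algebra_simps)
      then have "\<theta> * norm (?H ?z /\<^sub>R \<theta> - (A v + b)) = norm (?H ?z - (A (fst ?z) + snd ?z *\<^sub>R b))"
        using elim(2) by simp
      also have "\<dots> \<le> ?e * norm ?z" by (rule el(1))
      also have "\<dots> \<le> ?e * (\<theta> * (\<bar>R\<bar> + 1))"
      proof (rule mult_left_mono)
        have "norm ?z \<le> \<theta> * norm v + \<theta>"
          using norm_Pair_le [of "\<theta> *\<^sub>R v" \<theta>] elim(2) by simp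
        also have "\<dots> \<le> \<theta> * (\<bar>R\<bar> + 1)" using v(2) elim(2) by (simp add: distrib_left)
        finally show "norm ?z \<le> \<theta> * (\<bar>R\<bar> + 1)" .
      qed (use e' in simp)
      also have "\<dots> = \<theta> * e" by simp
      finally have "norm (?H ?z /\<^sub>R \<theta> - (A v + b)) \<le> e" using elim(2) by simp
      then show "branch_map a j0 J \<theta> (inv_into (U s) (\<kappa> s) (\<theta> *\<^sub>R v)) \<in> U t \<and>
        norm (\<kappa> t (branch_map a j0 J \<theta> (inv_into (U s) (\<kappa> s) (\<theta> *\<^sub>R v))) /\<^sub>R \<theta> - (A v + b)) \<le> e"
        unfolding m by (rule conjI [OF el(2)])
    qed
  qed
  then show "\<forall>\<^sub>F \<theta> in at_right 0. \<forall>v\<in>tangent (ket s). norm v \<le> R \<longrightarrow>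
      branch_map a j0 J \<theta> (inv_into (U s) (\<kappa> s) (\<theta> *\<^sub>R v)) \<in> U (branch_map a j0 J 0 s) \<and>
      norm (\<kappa> (branch_map a j0 J 0 s) (branch_map a j0 J \<theta> (inv_into (U s) (\<kappa> s) (\<theta> *\<^sub>R v))) /\<^sub>R \<theta>
        - (branch_linear ket U \<kappa> a j0 J s v + branch_shift U \<kappa> a j0 J s)) \<le> e"
    unfolding lin shift t_def [symmetric] .
qed

end


section \<open>Topology and measurability of the blow-up\<close>

lemma sets_borel_of: "sets (borel_of X) = sigma_sets (topspace X) {W. openin X W}"
  and space_borel_of [simp]: "space (borel_of X) = topspace X"
proof -
  have "{W. openin X W} \<subseteq> Pow (topspace X)" using openin_subset by auto
  then show "sets (borel_of X) = sigma_sets (topspace X) {W. openin X W}" "space (borel_of X) = topspace X"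
    by (simp_all add: borel_of_def sets_measure_of)
qed

lemma openin_sets_borel_of: "openin X W \<Longrightarrow> W \<in> sets (borel_of X)"
  by (auto simp: sets_borel_of)

lemma measurable_borel_ofI:
  assumes "f \<in> space M \<rightarrow> topspace X" "\<And>W. openin X W \<Longrightarrow> {x \<in> space M. f x \<in> W} \<in> sets M"
  shows "f \<in> M \<rightarrow>\<^sub>M borel_of X"
  unfolding borel_of_def
proof (rule measurable_measure_of)
  show "{W. openin X W} \<subseteq> Pow (topspace X)" using openin_subset by auto
  show "f -` W \<inter> space M \<in> sets M" if "W \<in> {W. openin X W}" for W
    using assms(2) [of W] that by (simp add: vimage_def Int_def conj_commute)
qed (rule assms(1))

lemma continuous_map_measurable_borel_of:
  assumes "continuous_map X Y f" shows "f \<in> borel_of X \<rightarrow>\<^sub>M borel_of Y"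
  using assms by (intro measurable_borel_ofI) (auto simp: continuous_map_def openin_sets_borel_of)

lemma continuous_map_borel_measurable:
  assumes "continuous_map X euclidean f" shows "f \<in> borel_measurable (borel_of X)"
proof (rule borel_measurableI)
  fix W :: "'b set" assume "open W"
  then have "openin X {x \<in> topspace X. f x \<in> W}"
    using assms by (simp add: continuous_map_def)
  moreover have "f -` W \<inter> space (borel_of X) = {x \<in> topspace X. f x \<in> W}" by auto
  ultimately show "f -` W \<inter> space (borel_of X) \<in> sets (borel_of X)"
    by (simp add: openin_sets_borel_of)
qed

lemma continuous_map_from_sum_topology:
  assumes "\<And>i. i \<in> I \<Longrightarrow> continuous_map (X i) Z (\<lambda>x. f (i, x))"
  shows "continuous_map (sum_topology X I) Z f"
proof -
  have "openin (sum_topology X I) {x \<in> topspace (sum_topology X I). f x \<in> W}" if W: "openin Z W" for W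
    unfolding openin_sum_topology
  proof (intro conjI ballI)
    fix i assume i: "i \<in> I"
    then have "{x. (i, x) \<in> {x \<in> topspace (sum_topology X I). f x \<in> W}} = {x \<in> topspace (X i). f (i,
        x) \<in> W}"
      by auto
    then show "openin (X i) {x. (i, x) \<in> {x \<in> topspace (sum_topology X I). f x \<in> W}}"
      using assms [OF i] W by (simp add: continuous_map_def)
  qed auto
  moreover have "f (i, x) \<in> topspace Z" if "i \<in> I" "x \<in> topspace (X i)" for i x
    using assms [OF that(1)] that(2) by (auto simp: continuous_map_def)
  ultimately show ?thesis unfolding continuous_map_def by auto
qed

lemma continuous_map_add_isolated:
  fixes f :: "'x option \<Rightarrow> 'y::topological_space"
  shows "continuous_map (add_isolated X) euclidean f \<longleftrightarrow> continuous_map X euclidean (\<lambda>x. f (Some x))"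
proof -
  have "Some -` {x \<in> insert None (Some ` topspace X). f x \<in> W} = {x \<in> topspace X. f (Some x) \<in> W}" for W
    by auto
  then show ?thesis by (simp add: continuous_map_def openin_add_isolated topspace_add_isolated)
qed

context blowup_charts
begin

abbreviation Xhat :: "(('n, 'p) qray \<times> ('n, 'p) qvec) topology" where
  "Xhat \<equiv> blowup_space ket"

lemma topspace_Xhat: "topspace Xhat = Sigma S (\<lambda>s. tangent (ket s))"
  by (simp add: blowup_space_def comp_def)

lemma continuous_map_Xhat:
  fixes f :: "('n, 'p) qray \<times> ('n, 'p) qvec \<Rightarrow> 'y::topological_space"
  shows "continuous_map Xhat euclidean f \<longleftrightarrow> (\<forall>s\<in>S. continuous_on (tangent (ket s)) (\<lambda>v. f (s, v)))"
proof
  assume f: "continuous_map Xhat euclidean f"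
  show "\<forall>s\<in>S. continuous_on (tangent (ket s)) (\<lambda>v. f (s, v))"
  proof
    fix s assume "s \<in> S"
    then have "continuous_map (top_of_set (tangent (ket s))) Xhat (\<lambda>v. (s, v))"
      unfolding blowup_space_def by (rule continuous_map_component_injection)
    from continuous_map_compose [OF this f]
    show "continuous_on (tangent (ket s)) (\<lambda>v. f (s, v))" by (simp add: comp_def)
  qed
next
  assume "\<forall>s\<in>S. continuous_on (tangent (ket s)) (\<lambda>v. f (s, v))"
  then show "continuous_map Xhat euclidean f"
    unfolding blowup_space_def by (intro continuous_map_from_sum_topology) simp
qed

lemma blowup_map_Some:
  assumes "s \<in> S" "\<psi> \<in> U s" shows "blowup_map U \<kappa> \<theta> \<psi> = Some (s, \<kappa> s \<psi> /\<^sub>R \<theta>)"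
proof -
  have "(THE s. s \<in> S \<and> \<psi> \<in> U s) = s"
    using assms charts_disjoint by blast
  then show ?thesis using assms by (auto simp: blowup_map_def)
qed

lemma blowup_map_None: "\<not> (\<exists>s\<in>S. \<psi> \<in> U s) \<Longrightarrow> blowup_map U \<kappa> \<theta> \<psi> = None"
  by (simp only: blowup_map_def if_False)

lemma blowup_map_eq_Some:
  assumes "blowup_map U \<kappa> \<theta> \<psi> = Some (s, v)" "\<theta> > 0"
  shows "s \<in> S" "v \<in> tangent (ket s)" "\<psi> = inv_into (U s) (\<kappa> s) (\<theta> *\<^sub>R v)"
proof -
  obtain t where t: "t \<in> S" "\<psi> \<in> U t"
    using assms(1) blowup_map_None by fastforce
  then have st: "s = t" "v = \<kappa> t \<psi> /\<^sub>R \<theta>" using assms(1) by (auto simp: blowup_map_Some)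
  then show "s \<in> S" "v \<in> tangent (ket s)"
    using t by (auto intro: tangent_scaleR chart_tangent)
  show "\<psi> = inv_into (U s) (\<kappa> s) (\<theta> *\<^sub>R v)"
    using assms(2) by (simp add: st inv_chart_chart t)
qed

lemma blowup_map_measurable: "blowup_map U \<kappa> \<theta> \<in> borel \<rightarrow>\<^sub>M borel_of (add_isolated Xhat)"
proof (rule measurable_borel_ofI)
  show "blowup_map U \<kappa> \<theta> \<in> space borel \<rightarrow> topspace (add_isolated Xhat)"
  proof
    fix \<psi> show "blowup_map U \<kappa> \<theta> \<psi> \<in> topspace (add_isolated Xhat)"
    proof (cases "\<exists>s\<in>S. \<psi> \<in> U s")
      case True
      then obtain s where s: "s \<in> S" "\<psi> \<in> U s" by blast
      then have "\<kappa> s \<psi> /\<^sub>R \<theta> \<in> tangent (ket s)" by (intro tangent_scaleR chart_tangent)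
      then show ?thesis using s by (simp add: blowup_map_Some topspace_add_isolated topspace_Xhat)
    qed (simp add: blowup_map_None topspace_add_isolated)
  qed
next
  fix W assume "openin (add_isolated Xhat) W"
  then have W: "openin Xhat (Some -` W)" by (simp add: openin_add_isolated)
  define V where "V s = {\<psi> \<in> U s. Some (s, \<kappa> s \<psi> /\<^sub>R \<theta>) \<in> W}" for s
  have V: "open (V s)" if s: "s \<in> S" for s
  proof -
    have "openin (top_of_set (tangent (ket s))) {v. (s, v) \<in> Some -` W}"
      using W s unfolding blowup_space_def openin_sum_topology by blast
    then obtain O' where O': "open O'" "{v. (s, v) \<in> Some -` W} = tangent (ket s) \<inter> O'"
      unfolding openin_open by blast
    have "V s = U s \<inter> (\<lambda>\<psi>. \<kappa> s \<psi> /\<^sub>R \<theta>) -` O'"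
    proof -
      have "Some (s, \<kappa> s \<psi> /\<^sub>R \<theta>) \<in> W \<longleftrightarrow> \<kappa> s \<psi> /\<^sub>R \<theta> \<in> O'" if "\<psi> \<in> U s" for \<psi>
      proof -
        have "\<kappa> s \<psi> /\<^sub>R \<theta> \<in> tangent (ket s)" by (intro tangent_scaleR chart_tangent s that)
        then show ?thesis using O'(2) by blast
      qed
      then show ?thesis by (auto simp: V_def)
    qed
    moreover have "continuous_on (U s) (\<lambda>\<psi>. \<kappa> s \<psi> /\<^sub>R \<theta>)"
      by (intro continuous_intros chart_continuous s)
    ultimately show ?thesis
      using O'(1) open_chart [OF s] by (simp add: continuous_open_preimage)
  qed
  \<comment> \<open>Open pieces from the charts, plus possibly the closed complement of all charts,
    which is the preimage of the isolated point.\<close>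
  have "{\<psi> \<in> space borel. blowup_map U \<kappa> \<theta> \<psi> \<in> W}
      = (\<Union>s\<in>S. V s) \<union> (if None \<in> W then - (\<Union>s\<in>S. U s) else {})" (is "?L = ?R")
  proof (rule Set.set_eqI)
    fix \<psi> show "\<psi> \<in> ?L \<longleftrightarrow> \<psi> \<in> ?R"
    proof (cases "\<exists>s\<in>S. \<psi> \<in> U s")
      case True
      then obtain s where s: "s \<in> S" "\<psi> \<in> U s" by blast
      then have "\<psi> \<in> ?R \<longleftrightarrow> \<psi> \<in> V s" using charts_disjoint by (auto simp: V_def)
      then show ?thesis using s by (simp add: blowup_map_Some V_def)
    qed (auto simp: blowup_map_None V_def)
  qed
  moreover have o: "open (\<Union>s\<in>S. V s)" "open (\<Union>s\<in>S. U s)"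
    using V open_chart by auto
  moreover have "(\<Union>s\<in>S. V s) \<in> sets borel" "- (\<Union>s\<in>S. U s) \<in> sets borel"
    by (rule borel_open, rule o(1), rule borel_comp, rule borel_open, rule o(2))
  ultimately show "{\<psi> \<in> space borel. blowup_map U \<kappa> \<theta> \<psi> \<in> W} \<in> sets borel"
    by (simp only: sets.Un sets.empty_sets split: if_split) blast
qed

section \<open>The measurement chain and the tangent chain as kernels with finitely many
  branches\<close>

lemma card_clifford_pos: "0 < card (proj_clifford :: ('n, 'p) qop set set)"
  using finite_clifford subgroup.one_closed [OF proj_clifford_subgroup] card_gt_0_iff by blast

lemma ncliff_pos: "real (card (proj_clifford :: ('n, 'p) qop set set)) > 0"
  using card_clifford_pos by simp

definition chain_weight :: "real \<Rightarrow> ('n, 'p) branch \<Rightarrow> ('n,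
    'p) qray \<Rightarrow> real" where
  "chain_weight \<theta> J \<psi> = branch_prob a j0 J \<theta> \<psi> / real (card (proj_clifford :: ('n, 'p) qop set set))"

lemma chain_weight_nonneg: "0 \<le> chain_weight \<theta> J \<psi>"
  by (simp add: chain_weight_def branch_prob_def)

lemma chain_weight_sum: "(\<Sum>J\<in>branches. chain_weight \<theta> J \<psi>) = 1"
  using branch_prob_sum [OF finite_clifford, of a j0 \<theta> \<psi>] ncliff_pos
  by (simp add: chain_weight_def flip: sum_divide_distrib)

lemma branch_law_eq:
  "branch_law a j0 \<theta> \<psi> = point_measure {J \<in> branches. chain_weight \<theta> J \<psi> > 0} (\<lambda>J. ennreal (chain_weight
      \<theta> J \<psi>))"
  unfolding branch_law_def chain_weight_def positive_branches_def
  using ncliff_pos by (simp add: zero_less_divide_iff)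

lemma branch_prob_continuous:
  assumes J: "J \<in> branches" shows "continuous_on UNIV (\<lambda>\<psi>. branch_prob a j0 J \<theta> \<psi>)"
proof -
  have "continuous_on {x. x \<noteq> 0 \<and> ray_of x \<in> UNIV} (\<lambda>x. (norm (branch_op a j0 J \<theta> *v x) / norm x)\<^sup>2)"
    by (intro continuous_intros bounded_linear.continuous_on [OF matrix_vector_mul_bounded_linear]) auto
  then have "continuous_on UNIV (\<lambda>\<psi>. (norm (branch_op a j0 J \<theta> *v unit_rep \<psi>) / norm (unit_rep \<psi>))\<^sup>2)"
    by (rule continuous_on_unit_rep) (simp add: matrix_vector_smult norm_smult)
  then show ?thesis by (simp add: branch_prob_eq [OF J] unit_rep)
qed

text \<open>Restricted to positive probability because elsewhere the branch vector vanishes and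
  spans no ray.\<close>

lemma branch_map_continuous:
  assumes J: "J \<in> branches"
  shows "continuous_on {\<psi>. branch_prob a j0 J \<theta> \<psi> > 0} (\<lambda>\<psi>. branch_map a j0 J \<theta> \<psi>)"
proof -
  have "continuous_on {x. x \<noteq> 0 \<and> ray_of x \<in> {\<psi>. branch_prob a j0 J \<theta> \<psi> > 0}}
      (\<lambda>x. ray_of (branch_op a j0 J \<theta> *v x))"
    by (rule continuous_on_compose2 [OF continuous_on_ray_of])
      (auto intro!: bounded_linear.continuous_on [OF matrix_vector_mul_bounded_linear] continuous_intros
        simp: branch_prob_ray_of J)
  then have "continuous_on {\<psi>. branch_prob a j0 J \<theta> \<psi> > 0} (\<lambda>\<psi>. ray_of (branch_op a j0 J \<theta> *v unit_rep \<psi>))"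
    by (rule continuous_on_unit_rep) (simp add: matrix_vector_smult ray_of_smult)
  then show ?thesis by (simp add: branch_map_eq)
qed

lemma finite_branches_set: "finite (branches :: ('n, 'p) branch set)"
  using finite_clifford by simp

sublocale chain: finite_kernel borel branches "chain_weight \<theta>" "\<lambda>J. branch_map a j0 J \<theta>"
    "chain_kernel a j0 \<theta>" for \<theta>
proof
  show "finite (branches :: ('n, 'p) branch set)" by (rule finite_branches_set)
  fix J :: "('n, 'p) branch" and \<psi> :: "('n, 'p) qray" and A :: "('n, 'p) qray set"
  show "chain_kernel a j0 \<theta> \<psi> = distr (point_measure {J \<in> branches. 0 < chain_weight \<theta> J \<psi>}
      (\<lambda>J. ennreal (chain_weight \<theta> J \<psi>))) borel (\<lambda>J. branch_map a j0 J \<theta> \<psi>)"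
    by (simp add: chain_kernel_def branch_law_eq)
  assume J: "J \<in> branches"
  have cw: "continuous_on UNIV (chain_weight \<theta> J)"
    unfolding chain_weight_def by (intro continuous_intros branch_prob_continuous J) (use ncliff_pos in
        simp)
  then show "chain_weight \<theta> J \<in> borel_measurable borel" by (rule borel_measurable_continuous_onI)
  assume A: "A \<in> sets borel"
  let ?W = "{\<psi>. branch_prob a j0 J \<theta> \<psi> > 0}"
  have W: "?W \<in> sets borel"
    using open_Collect_less [OF continuous_on_const branch_prob_continuous [OF J]] by simp
  have "(\<lambda>\<psi>. branch_map a j0 J \<theta> \<psi>) \<in> borel_measurable (restrict_space borel ?W)"
    by (rule borel_measurable_continuous_on_restrict) (rule branch_map_continuous [OF J])
  from measurable_sets [OF this A]
  have "(\<lambda>\<psi>. branch_map a j0 J \<theta> \<psi>) -` A \<inter> ?W \<in> sets (restrict_space borel ?W)"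
    by (simp add: space_restrict_space)
  then have "(\<lambda>\<psi>. branch_map a j0 J \<theta> \<psi>) -` A \<inter> ?W \<in> sets borel"
    using W by (simp add: sets_restrict_space_iff)
  moreover have "{\<psi> \<in> space borel. 0 < chain_weight \<theta> J \<psi> \<and> branch_map a j0 J \<theta> \<psi> \<in> A}
      = (\<lambda>\<psi>. branch_map a j0 J \<theta> \<psi>) -` A \<inter> ?W"
    using ncliff_pos by (auto simp: chain_weight_def zero_less_divide_iff)
  ultimately show "{\<psi> \<in> space borel. 0 < chain_weight \<theta> J \<psi> \<and> branch_map a j0 J \<theta> \<psi> \<in> A} \<in> sets borel"
    by simp
qed (auto simp: chain_weight_nonneg chain_weight_sum)

definition hat_weight :: "('n, 'p) branch \<Rightarrow> ('n, 'p) qray \<times> ('n,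
    'p) qvec \<Rightarrow> real" where
  "hat_weight J x = chain_weight 0 J (fst x)"

definition hat_map :: "('n, 'p) branch \<Rightarrow> ('n, 'p) qray \<times> ('n, 'p) qvec \<Rightarrow> ('n,
    'p) qray \<times> ('n, 'p) qvec" where
  "hat_map J x = (branch_map a j0 J 0 (fst x),
     branch_linear ket U \<kappa> a j0 J (fst x) (snd x) + branch_shift U \<kappa> a j0 J (fst x))"

lemma hat_weight_pos: "hat_weight J x > 0 \<longleftrightarrow> branch_prob a j0 J 0 (fst x) > 0"
  using ncliff_pos by (simp add: hat_weight_def chain_weight_def zero_less_divide_iff)

lemma hat_map_component:
  assumes s: "s \<in> S" and J: "J \<in> branches" and p: "branch_prob a j0 J 0 s > 0"
  shows "branch_map a j0 J 0 s \<in> S"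
    and "v \<in> tangent (ket s) \<Longrightarrow> branch_linear ket U \<kappa> a j0 J s v + branch_shift U \<kappa> a j0 J s
        \<in> tangent (ket (branch_map a j0 J 0 s))"
    and "bounded_linear (branch_linear ket U \<kappa> a j0 J s)"
proof -
  show t: "branch_map a j0 J 0 s \<in> S" by (rule branch_map_stabilizer [OF assms])
  obtain c where c: "c \<noteq> 0" "branch_op a j0 J 0 *v ket s = c *s ket (branch_map a j0 J 0 s)"
    by (rule branch_op_ket_eq [OF assms])
  show "branch_linear ket U \<kappa> a j0 J s v + branch_shift U \<kappa> a j0 J s
      \<in> tangent (ket (branch_map a j0 J 0 s))"
    unfolding branch_linear_eq [OF assms c]
    by (intro tangent_add branch_shift_tangent [OF assms c] tan_proj_in_tangent norm_ket t)
  have "branch_linear ket U \<kappa> a j0 J s = (\<lambda>v. tan_proj (ket (branch_map a j0 J 0 s))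
      ((1 / c) *s (branch_op a j0 J 0 *v tan_proj (ket s) v)))"
    using branch_linear_eq [OF assms c] by blast
  then show "bounded_linear (branch_linear ket U \<kappa> a j0 J s)"
    by (simp only:) (intro bounded_linear_compose [OF bounded_linear_tan_proj]
      bounded_linear_compose [OF bounded_linear_smult] bounded_linear_compose [OF
          matrix_vector_mul_bounded_linear]
      bounded_linear_tan_proj)
qed

text \<open>The weight is constant on each tangent space. On a component where the branch is
  impossible the map is therefore replaced by the identity, which is continuous and is never seen by
  the kernel.\<close>

lemma hat_map_continuous:
  assumes J: "J \<in> branches"
  shows "continuous_map Xhat Xhat (\<lambda>x. if hat_weight J x > 0 then hat_map J x else x)"
  unfolding blowup_space_def [of ket]
proof (rule continuous_map_from_sum_topology)
  fix s assume s: "s \<in> S"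
  let ?X = "\<lambda>s. top_of_set (tangent (ket s))"
  show "continuous_map (?X s) (sum_topology ?X S)
      (\<lambda>v. if hat_weight J (s, v) > 0 then hat_map J (s, v) else (s, v))"
  proof (cases "branch_prob a j0 J 0 s > 0")
    case True
    let ?t = "branch_map a j0 J 0 s"
    let ?g = "\<lambda>v. branch_linear ket U \<kappa> a j0 J s v + branch_shift U \<kappa> a j0 J s"
    note h = hat_map_component [OF s J True]
    have "continuous_on (tangent (ket s)) ?g"
      by (intro continuous_intros bounded_linear.continuous_on [OF h(3)])
    then have "continuous_map (?X s) (?X ?t) ?g"
      using h(2) by (auto simp: continuous_map_in_subtopology)
    from continuous_map_compose [of "?X s" "?X ?t" ?g "sum_topology ?X S" "Pair ?t",
        OF this continuous_map_component_injection [OF h(1), of ?X]]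
    show ?thesis using True by (simp add: hat_weight_pos hat_map_def comp_def)
  next
    case False
    then show ?thesis
      using continuous_map_component_injection [OF s, of ?X] by (simp add: hat_weight_pos)
  qed
qed

sublocale hat: finite_kernel "borel_of Xhat" branches hat_weight hat_map "tangent_kernel ket U \<kappa> a j0"
proof
  show "finite (branches :: ('n, 'p) branch set)" by (rule finite_branches_set)
  fix x :: "('n, 'p) qray \<times> ('n, 'p) qvec"
  show "(\<Sum>J\<in>branches. hat_weight J x) = 1"
    by (simp add: hat_weight_def chain_weight_sum)
  show "tangent_kernel ket U \<kappa> a j0 x = distr (point_measure {J \<in> branches. 0 < hat_weight J x}
      (\<lambda>J. ennreal (hat_weight J x))) (borel_of Xhat) (\<lambda>J. hat_map J x)"
    by (cases x) (simp add: tangent_kernel_def branch_law_eq hat_weight_def hat_map_def)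
  fix J :: "('n, 'p) branch"
  show "0 \<le> hat_weight J x" by (simp add: hat_weight_def chain_weight_nonneg)
  assume J: "J \<in> branches"
  have "continuous_map Xhat euclidean (hat_weight J)"
    unfolding continuous_map_Xhat by (simp add: hat_weight_def)
  then show w: "hat_weight J \<in> borel_measurable (borel_of Xhat)" by (rule continuous_map_borel_measurable)
  { assume "x \<in> space (borel_of Xhat)" "0 < hat_weight J x"
    then show "hat_map J x \<in> space (borel_of Xhat)"
      using hat_map_component(1) [of "fst x" J] hat_map_component(2) [of "fst x" J "snd x"] J
      by (auto simp: topspace_Xhat hat_weight_pos hat_map_def) }
  fix A assume A: "A \<in> sets (borel_of Xhat)"
  let ?f = "\<lambda>x. if hat_weight J x > 0 then hat_map J x else x"
  have "?f \<in> borel_of Xhat \<rightarrow>\<^sub>M borel_of Xhat"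
    by (rule continuous_map_measurable_borel_of) (rule hat_map_continuous [OF J])
  then have "?f -` A \<inter> space (borel_of Xhat) \<in> sets (borel_of Xhat)" using A by (rule measurable_sets)
  moreover have "{x \<in> space (borel_of Xhat). 0 < hat_weight J x} \<in> sets (borel_of Xhat)"
    using w by measurable
  moreover have "{x \<in> space (borel_of Xhat). 0 < hat_weight J x \<and> hat_map J x \<in> A}
      = {x \<in> space (borel_of Xhat). 0 < hat_weight J x} \<inter> (?f -` A \<inter> space (borel_of Xhat))" by auto
  ultimately show "{x \<in> space (borel_of Xhat). 0 < hat_weight J x \<and> hat_map J x \<in> A} \<in> sets (borel_of Xhat)"
    by simp
qed

lemma hat_mean_continuous:
  assumes f: "continuous_map Xhat euclidean f"
  shows "continuous_map Xhat euclidean (branch_mean branches hat_weight hat_map f)"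
proof -
  have "branch_mean branches hat_weight hat_map f
      = (\<lambda>x. \<Sum>J\<in>branches. hat_weight J x * f (if hat_weight J x > 0 then hat_map J x else x))"
    unfolding branch_mean_def
    by (intro ext sum.cong refl) (auto simp: hat_weight_def not_less antisym chain_weight_nonneg)
  moreover have "continuous_map Xhat euclidean
      (\<lambda>x. hat_weight J x * f (if hat_weight J x > 0 then hat_map J x else x))" if "J \<in> branches" for J
  proof (rule continuous_map_real_mult)
    show "continuous_map Xhat euclideanreal (hat_weight J)"
      unfolding continuous_map_Xhat by (simp add: hat_weight_def)
    show "continuous_map Xhat euclideanreal (\<lambda>x. f (if hat_weight J x > 0 then hat_map J x else x))"
      using continuous_map_compose [OF hat_map_continuous [OF that] f] by (simp add: comp_def)
  qed
  ultimately show ?thesis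
    using finite_branches_set by (simp only:) (intro continuous_map_sum, auto)
qed

text \<open>Open sets form an intersection-stable generator. Each component is a closed subset of a
  normed space, so the indicator of an open set is a pointwise limit of truncated multiples of the
  distance to its complement, and dominated convergence applies.\<close>

lemma measure_eq_from_continuous:
  assumes \<mu>: "prob_space \<mu>" "sets \<mu> = sets (borel_of (add_isolated Xhat))"
    and \<nu>: "prob_space \<nu>" "sets \<nu> = sets (borel_of (add_isolated Xhat))"
    and eq: "\<And>f :: _ \<Rightarrow> real. continuous_map (add_isolated Xhat) euclidean f
        \<Longrightarrow>
      bounded (f ` topspace (add_isolated Xhat)) \<Longrightarrow> (\<integral>x. f x \<partial>\<mu>) = (\<integral>x. f x \<partial>\<nu>)"
  shows "\<mu> = \<nu>"
proof (rule measure_eqI_generator_eq [where E = "{W. openin (add_isolated Xhat) W}"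
      and \<Omega> = "topspace (add_isolated Xhat)" and A = "\<lambda>_. topspace (add_isolated Xhat)"])
  let ?Y = "add_isolated Xhat"
  interpret \<mu>: prob_space \<mu> by (rule \<mu>(1))
  interpret \<nu>: prob_space \<nu> by (rule \<nu>(1))
  show "Int_stable {W. openin ?Y W}" by (auto simp: Int_stable_def)
  show "{W. openin ?Y W} \<subseteq> Pow (topspace ?Y)" using openin_subset by auto
  show "sets \<mu> = sigma_sets (topspace ?Y) {W. openin ?Y W}" "sets \<nu> =
      sigma_sets (topspace ?Y) {W. openin ?Y W}"
    using \<mu>(2) \<nu>(2) by (simp_all add: sets_borel_of)
  show "range (\<lambda>_ :: nat. topspace ?Y) \<subseteq> {W. openin ?Y W}" "(\<Union>i :: nat. topspace ?Y) =
      topspace ?Y" by auto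
  have sp: "space \<mu> = topspace ?Y" "space \<nu> = topspace ?Y"
    using sets_eq_imp_space_eq [OF \<mu>(2)] sets_eq_imp_space_eq [OF \<nu>(2)] by simp_all
  show "emeasure \<mu> (topspace ?Y) \<noteq> \<infinity>" by (simp flip: sp)
  fix W assume "W \<in> {W. openin ?Y W}"
  then have W: "openin ?Y W" by simp
  define C where "C s = tangent (ket s) - {v. Some (s, v) \<in> W}" for s
  have C: "closed (C s)" if s: "s \<in> S" for s
  proof -
    have "openin (top_of_set (tangent (ket s))) {v. (s, v) \<in> Some -` W}"
      using W s unfolding openin_add_isolated blowup_space_def openin_sum_topology by blast
    then obtain O' where O': "open O'" "{v. (s, v) \<in> Some -` W} = tangent (ket s) \<inter> O'"
      unfolding openin_open by blast
    then have "C s = tangent (ket s) - O'" unfolding C_def by blast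
    then show ?thesis using closed_Diff [OF closed_tangent O'(1)] by metis
  qed
  \<comment> \<open>The empty complement needs its own value 1, since \<open>infdist v {}\<close> is
    0 by convention and would give the zero function.\<close>
  define h where "h n v C = (if C = {} then 1 else min 1 (real n * infdist v C))" for n and v :: "('n,
      'p) qvec" and C
  have h01: "0 \<le> h n v C" "h n v C \<le> 1" for n v C
    by (auto simp: h_def infdist_nonneg)
  have h_cont: "continuous_on UNIV (\<lambda>v. h n v C)" for n C
    unfolding h_def by (cases "C = {}") (auto intro!: continuous_intros)
  have h_lim: "(\<lambda>n. h n v C) \<longlonglongrightarrow> indicator (- C) v" if "closed C" for v C
  proof (cases "C = {} \<or> v \<in> C")
    case True
    then show ?thesis
    proof
      assume "v \<in> C"
      then have "h n v C = 0" for n by (auto simp: h_def)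
      then show ?thesis using \<open>v \<in> C\<close> by simp
    qed (simp add: h_def)
  next
    case False
    then have "infdist v C > 0" using that infdist_pos_not_in_closed by blast
    then obtain N where N: "1 \<le> real N * infdist v C"
      using ex_less_of_nat_mult less_imp_le by metis
    have "h n v C = 1" if "n \<ge> N" for n
    proof -
      have "real N * infdist v C \<le> real n * infdist v C"
        using that by (intro mult_right_mono) (auto simp: infdist_nonneg)
      then show ?thesis using N by (simp add: h_def)
    qed
    then have "\<forall>\<^sub>F n in sequentially. h n v C = 1" unfolding eventually_sequentially by blast
    then show ?thesis using False by (simp add: tendsto_eventually)
  qed
  define f where "f n x = (case x of None \<Rightarrow> indicator W None | Some (s,
      v) \<Rightarrow> h n v (C s))" for n x
  have f_cont: "continuous_map ?Y euclidean (f n :: _ \<Rightarrow> real)" for n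
    unfolding continuous_map_add_isolated continuous_map_Xhat f_def
    by (auto intro: continuous_on_subset [OF h_cont])
  have f01: "0 \<le> f n x" "f n x \<le> (1 :: real)" for n x
    by (auto simp: f_def h01 split: option.split prod.split)
  have f_lim: "(\<lambda>n. f n x) \<longlonglongrightarrow> indicator W x" if x_in: "x \<in> topspace ?Y" for x
  proof (cases x)
    case (Some y)
    then obtain s v where x: "x = Some (s, v)" "s \<in> S" "v \<in> tangent (ket s)"
      using x_in by (auto simp: topspace_add_isolated topspace_Xhat)
    then have "indicator (- C s) v = (indicator W x :: real)"
      by (auto simp: C_def indicator_def)
    then show ?thesis using h_lim [OF C [OF x(2)], of v] by (simp add: f_def x)
  qed (simp add: f_def)
  have lim: "(\<lambda>n. \<integral>x. f n x \<partial>M) \<longlonglongrightarrow> measure M W"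
    if M: "prob_space M" "sets M = sets (borel_of ?Y)" for M
  proof -
    interpret M: prob_space M by (rule M(1))
    have spM: "space M = topspace ?Y" using sets_eq_imp_space_eq [OF M(2)] by simp
    have WM: "W \<in> sets M" using W by (simp add: M(2) openin_sets_borel_of)
    have "(\<lambda>n. \<integral>x. f n x \<partial>M) \<longlonglongrightarrow> (\<integral>x. indicator W x \<partial>M)"
    proof (rule integral_dominated_convergence [where w = "\<lambda>_. 1"])
      show "(indicator W :: _ \<Rightarrow> real) \<in> borel_measurable M" using WM by simp
      show "f n \<in> borel_measurable M" for n
        using continuous_map_borel_measurable [OF f_cont] measurable_cong_sets [OF M(2) refl] by blast
      show "AE x in M. (\<lambda>n. f n x) \<longlonglongrightarrow> indicator W x"
        by (rule AE_I2, rule f_lim) (simp flip: spM)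
      show "AE x in M. norm (f n x) \<le> 1" for n using f01 by simp
    qed simp
    then show ?thesis using WM sets.sets_into_space [OF WM] by (simp add: Int_absorb2)
  qed
  have "(\<integral>x. f n x \<partial>\<mu>) = (\<integral>x. f n x \<partial>\<nu>)" for n
  proof (rule eq [OF f_cont])
    show "bounded (f n ` topspace ?Y)" unfolding bounded_iff using f01 by (intro exI [of _ 1]) auto
  qed
  then have "measure \<mu> W = measure \<nu> W"
    using lim [OF \<mu>] lim [OF \<nu>] LIMSEQ_unique by simp
  then show "emeasure \<mu> W = emeasure \<nu> W"
    by (simp add: \<mu>.emeasure_eq_measure \<nu>.emeasure_eq_measure)
qed

end


section \<open>Words of branches\<close>

primrec word_apply :: "'p mod_ring \<Rightarrow> 'n \<Rightarrow> real \<Rightarrow> ('n::finite,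
    'p::prime_card) branch list \<Rightarrow>
    ('n, 'p) qvec \<Rightarrow> ('n, 'p) qvec" where
  "word_apply a j0 \<theta> [] x = x"
| "word_apply a j0 \<theta> (J # w) x = word_apply a j0 \<theta> w (branch_op a j0 J \<theta> *v x)"

lemma word_apply_linear: "linear (word_apply a j0 \<theta> w)"
proof (induction w)
  case Nil
  then show ?case by (intro linearI) simp_all
next
  case (Cons J w)
  have "linear (\<lambda>x. branch_op a j0 J \<theta> *v x)"
    by (rule bounded_linear.linear) (rule matrix_vector_mul_bounded_linear)
  from linear_compose [OF this Cons] show ?case by (simp add: comp_def)
qed

lemma word_apply_smult: "word_apply a j0 \<theta> w (c *s x) = c *s word_apply a j0 \<theta> w x"
  by (induction w arbitrary: x) (simp_all add: matrix_vector_smult)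

lemma word_apply_zero [simp]: "word_apply a j0 \<theta> w 0 = 0"
  by (rule linear_0) (rule word_apply_linear)

lemma word_apply_contraction: "w \<in> lists branches \<Longrightarrow> norm (word_apply a j0 \<theta> w x) \<le> norm x"
proof (induction w arbitrary: x)
  case (Cons J w)
  then have "norm (word_apply a j0 \<theta> w (branch_op a j0 J \<theta> *v x)) \<le> norm (branch_op a j0 J \<theta> *v x)"
    by auto
  also have "\<dots> \<le> norm x" using Cons.prems by (intro branch_op_contraction) auto
  finally show ?case by simp
qed simp

text \<open>Telescoping: one factor is changed at a time, the other factors are contractions and do
  not amplify the error, and the constants add up.\<close>

lemma word_apply_lipschitz:
  assumes "w \<in> lists branches"
  shows "\<exists>C\<ge>0. \<forall>\<theta> x. norm (word_apply a j0 \<theta> w x - word_apply a j0 0 w x) \<le> C * \<bar>\<theta>\<bar> * norm x"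
  using assms
proof (induction w)
  case (Cons J w)
  then have J: "J \<in> branches" and w: "w \<in> lists branches" by auto
  obtain C where C: "C \<ge> 0" "\<And>\<theta> x. norm (word_apply a j0 \<theta> w x - word_apply a j0 0 w x) \<le> C * \<bar>\<theta>\<bar> *
      norm x"
    using Cons.IH w by blast
  obtain D where D: "D \<ge> 0" "\<And>\<theta> x. norm (branch_op a j0 J \<theta> *v x - branch_op a j0 J 0 *v x) \<le> D *
      \<bar>\<theta>\<bar> * norm x"
    by (rule branch_op_lipschitz [of a j0 J]) blast
  show ?case
  proof (intro exI [of _ "C + D"] conjI allI)
    fix \<theta> x
    let ?y = "branch_op a j0 J \<theta> *v x" and ?z = "branch_op a j0 J 0 *v x"
    have "norm (word_apply a j0 \<theta> (J # w) x - word_apply a j0 0 (J # w) x)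
        \<le> norm (word_apply a j0 \<theta> w ?y - word_apply a j0 0 w ?y) + norm (word_apply a j0 0 w ?y -
            word_apply a j0 0 w ?z)"
      using norm_triangle_ineq [of "word_apply a j0 \<theta> w ?y - word_apply a j0 0 w ?y"
          "word_apply a j0 0 w ?y - word_apply a j0 0 w ?z"] by simp
    also have "\<dots> \<le> C * \<bar>\<theta>\<bar> * norm x + D * \<bar>\<theta>\<bar> * norm x"
    proof (rule add_mono)
      have "C * \<bar>\<theta>\<bar> * norm ?y \<le> C * \<bar>\<theta>\<bar> * norm x"
        using C(1) branch_op_contraction [OF J] by (intro mult_left_mono) auto
      then show "norm (word_apply a j0 \<theta> w ?y - word_apply a j0 0 w ?y) \<le> C * \<bar>\<theta>\<bar> * norm x"
        using C(2) [of \<theta> ?y] by linarith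
      have "norm (word_apply a j0 0 w ?y - word_apply a j0 0 w ?z) \<le> norm (?y - ?z)"
        using word_apply_contraction [OF w, of a j0 0 "?y - ?z"] linear_diff [OF word_apply_linear] by metis
      then show "norm (word_apply a j0 0 w ?y - word_apply a j0 0 w ?z) \<le> D * \<bar>\<theta>\<bar> * norm x"
        using D(2) [of \<theta> x] by linarith
    qed
    finally show "norm (word_apply a j0 \<theta> (J # w) x - word_apply a j0 0 (J # w) x) \<le> (C + D) * \<bar>\<theta>\<bar> * norm x"
      by (simp add: algebra_simps)
  qed (use C D in simp)
qed (auto intro: exI [of _ 0])

text \<open>The unknown phase of the chosen representative cancels against its conjugate.\<close>

lemma branch_op_pclass:
  assumes "V \<in> clifford"
  shows "branch_op a j0 (pclass V, m) 0 = dagger V ** meas_op j0 m ** V"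
proof -
  obtain c where c: "cmod c = 1" "unitary_rep (pclass V) = mat c ** V" by (rule unitary_rep_pclass)
  have "cnj c * c = 1" using c(1) by (simp add: mult.commute flip: complex_norm_square)
  have "branch_op a j0 (pclass V, m) 0 = dagger V ** mat (cnj c) ** meas_op j0 m ** (mat c ** V)"
    by (simp add: branch_op_def R_gate_zero on_qudit_one c(2) dagger_mult dagger_mat)
  also have "\<dots> = (mat (cnj c) ** mat c) ** dagger V ** meas_op j0 m ** V"
    by (simp only: matrix_mul_assoc mat_commute [of "cnj c" "dagger V", symmetric])
      (simp only: mat_commute [of c "mat (cnj c) ** dagger V ** meas_op j0 m", symmetric] matrix_mul_assoc
        mat_mult_mat mult.commute)
  finally show ?thesis using \<open>cnj c * c = 1\<close> by (simp add: mat_mult_mat)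
qed

definition exchange :: "'n \<Rightarrow> 'n \<Rightarrow> 'n \<Rightarrow> 'n" where
  "exchange i j k = (if k = i then j else if k = j then i else k)"

lemma exchange_involution: "exchange i j \<circ> exchange i j = id"
  by (auto simp: exchange_def)

text \<open>Measuring all qudits in the basis \<open>V |x>\<close>, with outcome \<open>x\<close>, is the rank-one projection
  onto \<open>V |x>\<close>.\<close>

definition basis_word :: "'n \<Rightarrow> ('n, 'p) qop \<Rightarrow> ('n \<Rightarrow> 'p mod_ring)
    \<Rightarrow> ('n::finite, 'p::prime_card) branch list" where
  "basis_word j0 V x = map (\<lambda>j. (pclass (swap_op (exchange j0 j) ** dagger V), x j)) (SOME js. set js =
      UNIV)"

lemma set_some_list: "set (SOME js. set js = (UNIV :: 'n::finite set)) = UNIV"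
  by (rule someI_ex) (rule finite_list [OF finite])

lemma basis_word_branches:
  assumes "V \<in> clifford" shows "basis_word j0 V x \<in> lists branches"
proof -
  have "swap_op (exchange j0 j) ** dagger V \<in> clifford" for j
    by (intro clifford_mult clifford_dagger swap_op_clifford exchange_involution assms)
  then show ?thesis by (auto simp: basis_word_def clifford_def)
qed

lemma length_basis_word: "length (basis_word j0 V x) = length (SOME js. set js = (UNIV :: 'n set))"
  for V :: "('n::finite, 'p::prime_card) qop"
  by (simp add: basis_word_def)

text \<open>Between consecutive branches \<open>V\<close> meets its adjoint and cancels. What
  remains inside is a product of coordinate projections, one per qudit, and fixing all digits leaves
  a single basis vector.\<close>

lemma basis_word_apply:
  fixes V :: "('n::finite, 'p::prime_card) qop"
  assumes V: "V \<in> clifford"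
  shows "word_apply a j0 0 (basis_word j0 V x) y = V *v ((dagger V *v y) $ x *s axis x 1)"
proof -
  let ?E = "\<lambda>js. diag (\<lambda>k. if \<forall>j\<in>set js. k j = x j then 1 else 0) :: ('n, 'p) qop"
  \<comment> \<open>Exchanging \<open>j0\<close> and \<open>j\<close> turns the measurement of qudit
    \<open>j0\<close> into that of qudit \<open>j\<close>.\<close>
  have m: "branch_op a j0 (pclass (swap_op (exchange j0 j) ** dagger V), m) 0 =
      V ** meas_op j m ** dagger V"
    for j m
  proof -
    let ?T = "swap_op (exchange j0 j) :: ('n, 'p) qop"
    have "?T ** dagger V \<in> clifford"
      by (intro clifford_mult clifford_dagger swap_op_clifford exchange_involution V)
    then have "branch_op a j0 (pclass (?T ** dagger V), m) 0 = V ** (?T ** meas_op j0 m ** ?T) ** dagger V"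
      by (simp add: branch_op_pclass dagger_mult swap_op_dagger exchange_involution matrix_mul_assoc)
    also have "?T ** meas_op j0 m ** ?T = meas_op j m"
      by (simp add: meas_op_def swap_op_diag exchange_involution) (simp add: exchange_def)
    finally show ?thesis .
  qed
  have "word_apply a j0 0 (map (\<lambda>j. (pclass (swap_op (exchange j0 j) ** dagger V), x j)) js) y
      = V *v (?E js *v (dagger V *v y))" for js
  proof (induction js arbitrary: y)
    case Nil
    then show ?case
      using dagger_unitary_mult_vec(2) [OF clifford_unitary [OF V]] by (simp flip: mat_eq_diag)
  next
    case (Cons j js)
    have "?E js *v (dagger V *v ((V ** meas_op j (x j) ** dagger V) *v y))
        = ?E js *v (meas_op j (x j) *v (dagger V *v y))"
      by (simp only: matrix_vector_mul_assoc [symmetric] dagger_unitary_mult_vec(1) [OF clifford_unitary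
          [OF V]])
    also have "\<dots> = ?E (j # js) *v (dagger V *v y)"
      by (auto simp: vec_eq_iff diag_mult_vec meas_op_def)
    finally show ?case using Cons by (simp add: m)
  qed
  moreover have "?E (SOME js. set js = UNIV) *v z = z $ x *s axis x 1" for z
    by (simp add: vec_eq_iff diag_mult_vec set_some_list axis_def flip: fun_eq_iff)
  ultimately show ?thesis by (simp add: basis_word_def)
qed

lemma matrix_vector_axis: "(A *v axis k 1) $ i = A $ i $ k" for A :: "complex ^ 'c ^ 'd"
  by (simp add: matrix_vector_mult_def axis_def if_distrib [of "\<lambda>x. _ * x"] cong: if_cong)

text \<open>All entries of the Fourier matrix are phases divided by \<open>sqrt CARD('p)\<close>, so
  the overlaps between the two bases never vanish. This makes the passage from one word to the next
  possible.\<close>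

lemma fourier_all_component: "(fourier_all *v axis (\<lambda>_. 0) 1) $ x \<noteq> 0"
  "(dagger fourier_all *v axis x 1) $ (\<lambda>_. 0) \<noteq> 0"
  unfolding matrix_vector_axis
  by (simp_all add: fourier_all_def tensor_op_def fourier_component dagger_def)

section \<open>Words acting on stabilizer states\<close>

context blowup_charts
begin

lemma word_stabilizer:
  assumes "w \<in> lists branches" "x \<noteq> 0" "ray_of x \<in> S" "word_apply a j0 0 w x \<noteq> 0"
  shows "ray_of (word_apply a j0 0 w x) \<in> S"
  using assms
proof (induction w arbitrary: x)
  case (Cons J w)
  let ?y = "branch_op a j0 J 0 *v x"
  have J: "J \<in> branches" and w: "w \<in> lists branches"
    using Cons.hyps by blast+
  have y: "?y \<noteq> 0" using Cons.prems(3) by auto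
  then have "branch_prob a j0 J 0 (ray_of x) > 0"
    using Cons.prems(1) J by (simp add: branch_prob_ray_of)
  from branch_map_stabilizer [OF Cons.prems(2) J this]
  have "ray_of ?y \<in> S" using Cons.prems(1) by (simp add: branch_map_ray_of)
  then show ?case using Cons.IH [OF y] Cons.prems(3) by simp
qed simp

text \<open>The basis state is reached by measuring the Fourier image of the zero state with outcome
  \<open>x\<close>: branches preserve stabilizer states and this outcome has nonzero
  amplitude.\<close>

lemma basis_state_stabilizer: "ray_of (axis x 1) \<in> S"
proof -
  let ?p = "fourier_all *v axis (\<lambda>_. 0) 1 :: ('n, 'p) qvec"
  have p: "?p \<noteq> 0" "?p $ x \<noteq> 0" using fourier_all_component(1) by (metis zero_index, metis)
  have "ray_of ?p \<in> S" using fourier_all_clifford by (auto simp: stabilizer_states_eq)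
  moreover have w: "word_apply a j0 0 (basis_word j0 (mat 1) x) ?p = ?p $ x *s axis x 1"
    using basis_word_apply [OF clifford_one, of a j0 x ?p] by (simp add: dagger_mat)
  moreover have "?p $ x *s axis x 1 \<noteq> (0 :: ('n, 'p) qvec)"
    using p(2) by (auto simp: vec_eq_iff axis_def)
  ultimately have "ray_of (?p $ x *s axis x 1) \<in> S"
    using word_stabilizer [OF basis_word_branches [OF clifford_one] p(1)] by metis
  then show ?thesis using p(2) by (simp add: ray_of_smult)
qed

lemma rotated_basis_stabilizer: "V \<in> clifford \<Longrightarrow> ray_of (V *v axis x 1) \<in> S"
  by (intro ray_of_clifford_mult basis_state_stabilizer) simp_all


section \<open>Tightness of the blown-up stationary laws\<close>

abbreviation chain_mean :: "real \<Rightarrow> (('n, 'p) qray \<Rightarrow> real) \<Rightarrow> ('n,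
    'p) qray \<Rightarrow> real" where
  "chain_mean \<theta> \<equiv> branch_mean branches (chain_weight \<theta>) (\<lambda>J. branch_map a j0 J \<theta>)"

text \<open>Every letter contributes the probability of drawing its Clifford element and a ratio of
  squared norms; the ratios telescope to that of the whole word.\<close>

lemma chain_mean_word:
  assumes "w \<in> lists branches" "x \<noteq> 0" "\<And>\<psi>. 0 \<le> \<phi> \<psi>"
  shows "(chain_mean \<theta> ^^ length w) \<phi> (ray_of x)
    \<ge> (1 / real (card (proj_clifford :: ('n, 'p) qop set set))) ^ length w
      * (norm (word_apply a j0 \<theta> w x) / norm x)\<^sup>2 * \<phi> (ray_of (word_apply a j0 \<theta> w x))"
  using assms(1,2)
proof (induction w arbitrary: x)
  case (Cons J w)
  let ?c = "1 / real (card (proj_clifford :: ('n, 'p) qop set set))"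
  let ?y = "branch_op a j0 J \<theta> *v x" and ?g = "(chain_mean \<theta> ^^ length w) \<phi>"
  have J: "J \<in> branches" and w: "w \<in> lists branches"
    using Cons.hyps by blast+
  have g: "0 \<le> ?g \<psi>" for \<psi> by (rule chain.funpow_branch_mean_bounds(2)) (simp_all add: assms(3))
  have "chain_weight \<theta> J (ray_of x) * ?g (branch_map a j0 J \<theta> (ray_of x)) \<le> chain_mean \<theta> ?g (ray_of x)"
    by (rule chain.branch_mean_ge_branch) (simp_all add: J g)
  then have step: "?c * (norm ?y / norm x)\<^sup>2 * ?g (ray_of ?y) \<le> (chain_mean \<theta> ^^ length (J # w)) \<phi>
      (ray_of x)"
    using Cons.prems(1) J by (simp add: chain_weight_def branch_prob_ray_of branch_map_ray_of)
  show ?case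
  proof (cases "?y = 0")
    \<comment> \<open>The word then maps \<open>x\<close> to 0 and the asserted lower bound is
      0.\<close>
    case True
    have "0 \<le> (chain_mean \<theta> ^^ length (J # w)) \<phi> (ray_of x)"
      by (rule chain.funpow_branch_mean_bounds(2)) (simp_all add: assms(3))
    then show ?thesis using True by simp
  next
    case False
    have "?c * (norm ?y / norm x)\<^sup>2 * (?c ^ length w * (norm (word_apply a j0 \<theta> w ?y) / norm ?y)\<^sup>2
        * \<phi> (ray_of (word_apply a j0 \<theta> w ?y))) \<le> ?c * (norm ?y / norm x)\<^sup>2 * ?g (ray_of ?y)"
      by (intro mult_left_mono Cons.IH w False) simp
    also note step
    finally show ?thesis using False by (simp add: power_divide algebra_simps)
  qed
qed simp

text \<open>The radius is measured in the blow-up coordinate, hence at scale \<theta> on rays. The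
  isolated point never counts as near.\<close>

definition near :: "real \<Rightarrow> (('n, 'p) qray \<times> ('n, 'p) qvec) option \<Rightarrow> bool" where
  "near R x \<longleftrightarrow> (case x of None \<Rightarrow> False | Some (s, v) \<Rightarrow> norm v \<le> R)"

definition far :: "real \<Rightarrow> real \<Rightarrow> ('n, 'p) qray \<Rightarrow> real" where
  "far \<theta> R \<psi> = (if near R (blowup_map U \<kappa> \<theta> \<psi>) then 0 else 1)"

lemma near_mono: "near R x \<Longrightarrow> R \<le> R' \<Longrightarrow> near R' x"
  by (auto simp: near_def split: option.splits)

lemma far_bounds: "0 \<le> far \<theta> R \<psi>" "far \<theta> R \<psi> \<le> 1"
  by (auto simp: far_def)

lemma far_measurable: "far \<theta> R \<in> borel_measurable borel"
proof -
  \<comment> \<open>The value R + 1 puts the isolated point beyond the radius R.\<close>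
  define h where "h x = (case x of None \<Rightarrow> R + 1 | Some (s, v) \<Rightarrow> norm v)"
    for x :: "(('n, 'p) qray \<times> ('n, 'p) qvec) option"
  have "continuous_map (add_isolated Xhat) euclidean h"
    unfolding continuous_map_add_isolated continuous_map_Xhat
    by (simp add: h_def continuous_on_norm_id)
  then have "h \<in> borel_measurable (borel_of (add_isolated Xhat))" by (rule continuous_map_borel_measurable)
  from measurable_compose [OF blowup_map_measurable this]
  have [measurable]: "(\<lambda>\<psi>. h (blowup_map U \<kappa> \<theta> \<psi>)) \<in> borel_measurable borel" .
  have "far \<theta> R = (\<lambda>\<psi>. if h (blowup_map U \<kappa> \<theta> \<psi>) \<le> R then 0 else 1)"
    by (auto simp: far_def near_def h_def fun_eq_iff split: option.splits)
  also have "\<dots> \<in> borel_measurable borel" by measurable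
  finally show ?thesis .
qed

lemma near_obtain:
  assumes "near R (blowup_map U \<kappa> \<theta> \<psi>)" "\<theta> > 0"
  obtains s v where "blowup_map U \<kappa> \<theta> \<psi> = Some (s, v)" "s \<in> S" "v \<in> tangent (ket s)" "norm v \<le> R"
    "\<psi> = inv_into (U s) (\<kappa> s) (\<theta> *\<^sub>R v)"
proof -
  obtain s v where sv: "blowup_map U \<kappa> \<theta> \<psi> = Some (s, v)" "norm v \<le> R"
    using assms(1) unfolding near_def by (auto split: option.splits)
  show ?thesis by (rule that [OF sv(1) blowup_map_eq_Some(1,2) [OF sv(1) assms(2)] sv(2)
        blowup_map_eq_Some(3) [OF sv(1) assms(2)]])
qed

text \<open>A branch possible at \<open>s\<close> is close to an affine map, which keeps bounded
  sets bounded; an impossible one has weight tending to 0. The bound is claimed for every larger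
  radius so that the radii of finitely many branches can be merged.\<close>

lemma branch_stays_near:
  assumes s: "s \<in> S" and J: "J \<in> branches"
  shows "\<exists>R'. \<forall>R''\<ge>R'. \<forall>e>0. \<forall>\<^sub>F \<theta> in at_right 0. \<forall>v\<in>tangent (ket s). norm v \<le> R \<longrightarrow>
    chain_weight \<theta> J (inv_into (U s) (\<kappa> s) (\<theta> *\<^sub>R v)) * far \<theta> R'' (branch_map a j0 J \<theta> (inv_into (U s)
        (\<kappa> s) (\<theta> *\<^sub>R v))) \<le> e"
proof (cases "branch_prob a j0 J 0 s > 0")
  case True
  let ?t = "branch_map a j0 J 0 s"
  let ?g = "\<lambda>v. branch_linear ket U \<kappa> a j0 J s v + branch_shift U \<kappa> a j0 J s"
  note h = hat_map_component [OF s J True]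
  obtain c where c: "c \<noteq> 0" "branch_op a j0 J 0 *v ket s = c *s ket ?t"
    by (rule branch_op_ket_eq [OF s J True])
  obtain L where L: "L \<ge> 0" "\<And>v. norm (branch_linear ket U \<kappa> a j0 J s v) \<le> norm v * L"
    using bounded_linear.nonneg_bounded [OF h(3)] by blast
  \<comment> \<open>The image of the ball under the affine map, enlarged by 1 for the approximation
    error.\<close>
  define R' where "R' = \<bar>R\<bar> * L + norm (branch_shift U \<kappa> a j0 J s) + 1"
  show ?thesis
  proof (intro exI [of _ R'] allI impI)
    fix R'' e :: real assume R'': "R' \<le> R''" and e: "e > 0"
    show "\<forall>\<^sub>F \<theta> in at_right 0. \<forall>v\<in>tangent (ket s). norm v \<le> R \<longrightarrow>
        chain_weight \<theta> J (inv_into (U s) (\<kappa> s) (\<theta> *\<^sub>R v)) * far \<theta> R'' (branch_map a j0 J \<theta> (inv_into (U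
            s) (\<kappa> s) (\<theta> *\<^sub>R v))) \<le> e"
      using branch_uniform [OF s J True c zero_less_one, of R]
    proof eventually_elim
      case (elim \<theta>)
      show ?case
      proof (intro ballI impI)
        fix v assume v: "v \<in> tangent (ket s)" "norm v \<le> R"
        let ?\<psi> = "branch_map a j0 J \<theta> (inv_into (U s) (\<kappa> s) (\<theta> *\<^sub>R v))"
        have \<psi>: "?\<psi> \<in> U ?t" "norm (\<kappa> ?t ?\<psi> /\<^sub>R \<theta> - ?g v) \<le> 1" using elim v by blast+
        have "norm v * L \<le> \<bar>R\<bar> * L" using v(2) L(1) by (intro mult_right_mono) auto
        then have "norm (?g v) \<le> \<bar>R\<bar> * L + norm (branch_shift U \<kappa> a j0 J s)"
          using norm_triangle_ineq [of "branch_linear ket U \<kappa> a j0 J s v"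
              "branch_shift U \<kappa> a j0 J s"] L(2) [of v]
          by linarith
        then have "norm (\<kappa> ?t ?\<psi> /\<^sub>R \<theta>) \<le> R''"
          using \<psi>(2) R'' norm_triangle_sub [of "\<kappa> ?t ?\<psi> /\<^sub>R \<theta>" "?g v"] unfolding R'_def by linarith
        then have "far \<theta> R'' ?\<psi> = 0"
          by (simp add: far_def near_def blowup_map_Some [OF h(1) \<psi>(1)])
        then show "chain_weight \<theta> J (inv_into (U s) (\<kappa> s) (\<theta> *\<^sub>R v)) * far \<theta> R'' ?\<psi> \<le> e"
          using e by simp
      qed
    qed
  qed
next
  case False
  then have p: "branch_prob a j0 J 0 s = 0" by (simp add: branch_prob_def)
  show ?thesis
  proof (intro exI [of _ 0] allI impI)
    fix R'' e :: real assume e: "e > 0"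
    show "\<forall>\<^sub>F \<theta> in at_right 0. \<forall>v\<in>tangent (ket s). norm v \<le> R \<longrightarrow>
        chain_weight \<theta> J (inv_into (U s) (\<kappa> s) (\<theta> *\<^sub>R v)) * far \<theta> R'' (branch_map a j0 J \<theta> (inv_into (U
            s) (\<kappa> s) (\<theta> *\<^sub>R v))) \<le> e"
      using branch_prob_uniform [OF s J e, of R]
    proof eventually_elim
      case (elim \<theta>)
      show ?case
      proof (intro ballI impI)
        fix v assume v: "v \<in> tangent (ket s)" "norm v \<le> R"
        let ?\<phi> = "inv_into (U s) (\<kappa> s) (\<theta> *\<^sub>R v)"
        have "branch_prob a j0 J \<theta> ?\<phi> \<le> e" using elim v p by fastforce
        moreover have "chain_weight \<theta> J ?\<phi> \<le> branch_prob a j0 J \<theta> ?\<phi>"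
          using card_clifford_pos by (simp add: chain_weight_def divide_le_eq branch_prob_def
              mult_le_cancel_left1)
        moreover have "chain_weight \<theta> J ?\<phi> * far \<theta> R'' (branch_map a j0 J \<theta> ?\<phi>) \<le> chain_weight \<theta> J ?\<phi>"
          using far_bounds chain_weight_nonneg by (simp add: mult_left_le)
        ultimately show "chain_weight \<theta> J ?\<phi> * far \<theta> R'' (branch_map a j0 J \<theta> ?\<phi>) \<le> e" by linarith
      qed
    qed
  qed
qed

lemma finite_uniform_bound:
  fixes P :: "'b \<Rightarrow> real \<Rightarrow> bool"
  assumes "finite A" "\<And>x. x \<in> A \<Longrightarrow> \<exists>R. \<forall>R'\<ge>R. P x R'"
  shows "\<exists>R. \<forall>x\<in>A. \<forall>R'\<ge>R. P x R'"
proof -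
  obtain r where r: "\<And>x R'. x \<in> A \<Longrightarrow> R' \<ge> r x \<Longrightarrow> P x R'"
      using assms(2) by metis
  have "r x \<le> (\<Sum>x\<in>A. \<bar>r x\<bar>)" if "x \<in> A" for x
    using member_le_sum [OF that, of "\<lambda>x. \<bar>r x\<bar>"] assms(1) by simp
  then show ?thesis using r by (intro exI [of _ "\<Sum>x\<in>A. \<bar>r x\<bar>"]) (meson order_trans)
qed

lemma chain_stays_near:
  "\<exists>R'. \<forall>R''\<ge>R'. \<forall>e>0. \<forall>\<^sub>F \<theta> in at_right 0. \<forall>\<psi>. near R (blowup_map U \<kappa> \<theta> \<psi>) \<longrightarrow>
    chain_mean \<theta> (far \<theta> R'') \<psi> \<le> e"
proof -
  define P where "P = (\<lambda>(s, J) R''. \<forall>e>0. \<forall>\<^sub>F \<theta> in at_right 0. \<forall>v\<in>tangent (ket s). norm v \<le> R \<longrightarrow>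
    chain_weight \<theta> J (inv_into (U s) (\<kappa> s) (\<theta> *\<^sub>R v)) * far \<theta> R'' (branch_map a j0 J \<theta> (inv_into (U s)
        (\<kappa> s) (\<theta> *\<^sub>R v))) \<le> e)"
  have "\<exists>R'. \<forall>x\<in>S \<times> branches. \<forall>R''\<ge>R'. P x R''"
  proof (rule finite_uniform_bound)
    show "finite (S \<times> (branches :: ('n, 'p) branch set))"
      by (intro finite_cartesian_product finite_S finite_branches_set)
    show "\<exists>R'. \<forall>R''\<ge>R'. P x R''" if "x \<in> S \<times> branches" for x
      using branch_stays_near [of "fst x" "snd x" R] that by (auto simp: P_def)
  qed
  then obtain R' where R': "\<And>s J R''. s \<in> S \<Longrightarrow> J \<in> branches \<Longrightarrow>
      R'' \<ge> R' \<Longrightarrow> P (s, J) R''" by blast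
  let ?n = "real (card (branches :: ('n, 'p) branch set))"
  show ?thesis
  proof (intro exI [of _ R'] allI impI)
    fix R'' e :: real assume R'': "R' \<le> R''" and e: "e > 0"
    have e': "e / (?n + 1) > 0" using e by (intro divide_pos_pos) auto
    have "\<forall>\<^sub>F \<theta> in at_right 0. \<forall>s\<in>S. \<forall>J\<in>branches. \<forall>v\<in>tangent (ket s). norm v \<le> R \<longrightarrow>
        chain_weight \<theta> J (inv_into (U s) (\<kappa> s) (\<theta> *\<^sub>R v)) * far \<theta> R'' (branch_map a j0 J \<theta> (inv_into (U
            s) (\<kappa> s) (\<theta> *\<^sub>R v))) \<le> e / (?n + 1)"
    proof (rule eventually_ball_finite [OF finite_S], rule ballI,
        rule eventually_ball_finite [OF finite_branches_set], rule ballI)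
      fix s and J :: "('n, 'p) branch" assume "s \<in> S" "J \<in> branches"
      from R' [OF this R''] e'
      show "\<forall>\<^sub>F \<theta> in at_right 0. \<forall>v\<in>tangent (ket s). norm v \<le> R \<longrightarrow>
        chain_weight \<theta> J (inv_into (U s) (\<kappa> s) (\<theta> *\<^sub>R v)) * far \<theta> R'' (branch_map a j0 J \<theta> (inv_into (U
            s) (\<kappa> s) (\<theta> *\<^sub>R v))) \<le> e / (?n + 1)"
        unfolding P_def prod.case by blast
    qed
    then show "\<forall>\<^sub>F \<theta> in at_right 0. \<forall>\<psi>. near R (blowup_map U \<kappa> \<theta> \<psi>) \<longrightarrow> chain_mean \<theta> (far \<theta> R'') \<psi> \<le> e"
      using eventually_at_right_less
    proof eventually_elim
      case (elim \<theta>)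
      show ?case
      proof (intro allI impI)
        fix \<psi> assume "near R (blowup_map U \<kappa> \<theta> \<psi>)"
        then obtain s v where s: "s \<in> S" "v \<in> tangent (ket s)" "norm v \<le> R"
          "\<psi> = inv_into (U s) (\<kappa> s) (\<theta> *\<^sub>R v)" using near_obtain elim(2) by metis
        have "chain_mean \<theta> (far \<theta> R'') \<psi> \<le> (\<Sum>J\<in>(branches :: ('n, 'p) branch set). e / (?n + 1))"
          unfolding branch_mean_def using elim(1) s by (intro sum_mono) blast
        also have "\<dots> = ?n * (e / (?n + 1))" by simp
        also have "\<dots> \<le> e" using e by (simp add: field_simps)
        finally show "chain_mean \<theta> (far \<theta> R'') \<psi> \<le> e" .
      qed
    qed
  qed
qed

text \<open>The radius grows with the number of steps but does not depend on \<theta>. One step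
  leads from radius R to \<open>R1\<close> and the other n steps start there; each stage fails with
  probability at most e/2.\<close>

lemma chain_stays_near_funpow:
  "\<exists>R'. \<forall>R''\<ge>R'. \<forall>e>0. \<forall>\<^sub>F \<theta> in at_right 0. \<forall>\<psi>. near R (blowup_map U \<kappa> \<theta> \<psi>) \<longrightarrow>
    (chain_mean \<theta> ^^ n) (far \<theta> R'') \<psi> \<le> e"
proof (induction n arbitrary: R)
  case 0
  show ?case
  proof (intro exI [of _ R] allI impI always_eventually)
    fix R'' e \<theta> :: real and \<psi> assume "R \<le> R''" "e > 0" "near R (blowup_map U \<kappa> \<theta> \<psi>)"
    then show "(chain_mean \<theta> ^^ 0) (far \<theta> R'') \<psi> \<le> e"
      using near_mono by (auto simp: far_def)
  qed
next
  case (Suc n)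
  obtain R1 where R1: "\<And>e. e > 0 \<Longrightarrow>
      \<forall>\<^sub>F \<theta> in at_right 0. \<forall>\<psi>. near R (blowup_map U \<kappa> \<theta> \<psi>) \<longrightarrow>
    chain_mean \<theta> (far \<theta> R1) \<psi> \<le> e" using chain_stays_near [of R] by blast
  obtain R2 where R2: "\<And>R'' e. R'' \<ge> R2 \<Longrightarrow> e > 0 \<Longrightarrow>
      \<forall>\<^sub>F \<theta> in at_right 0. \<forall>\<psi>. near R1 (blowup_map U \<kappa> \<theta> \<psi>) \<longrightarrow>
    (chain_mean \<theta> ^^ n) (far \<theta> R'') \<psi> \<le> e" using Suc [of R1] by blast
  show ?case
  proof (intro exI [of _ R2] allI impI)
    fix R'' e :: real assume R'': "R2 \<le> R''" and e: "e > 0"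
    then have e2: "e / 2 > 0" by simp
    show "\<forall>\<^sub>F \<theta> in at_right 0. \<forall>\<psi>. near R (blowup_map U \<kappa> \<theta> \<psi>) \<longrightarrow> (chain_mean \<theta> ^^ Suc n) (far \<theta> R'') \<psi> \<le> e"
      using R1 [OF e2] R2 [OF R'' e2]
    proof eventually_elim
      case (elim \<theta>)
      show ?case
      proof (intro allI impI)
        fix \<psi> assume \<psi>: "near R (blowup_map U \<kappa> \<theta> \<psi>)"
        \<comment> \<open>Outside radius \<open>R1\<close> the trivial bound 1 is carried by the
          indicator; the explicit factor 1 fits \<open>branch_mean_affine\<close>.\<close>
        have "(chain_mean \<theta> ^^ n) (far \<theta> R'') \<phi> \<le> 1 * far \<theta> R1 \<phi> + e / 2" for \<phi>
        proof (cases "near R1 (blowup_map U \<kappa> \<theta> \<phi>)")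
          case True
          then show ?thesis using elim(2) by (simp add: far_def)
        next
          case False
          have "(chain_mean \<theta> ^^ n) (far \<theta> R'') \<phi> \<le> 1"
            by (rule chain.funpow_branch_mean_bounds(1)) (simp_all add: far_bounds)
          then show ?thesis using False e by (simp add: far_def)
        qed
        then have "chain_mean \<theta> ((chain_mean \<theta> ^^ n) (far \<theta> R'')) \<psi> \<le> chain_mean \<theta> (\<lambda>\<phi>. 1 * far \<theta> R1 \<phi> +
            e / 2) \<psi>"
          by (intro chain.branch_mean_mono) simp_all
        also have "\<dots> = 1 * chain_mean \<theta> (far \<theta> R1) \<psi> + e / 2"
          by (rule chain.branch_mean_affine) simp
        also have "\<dots> \<le> e" using elim(1) \<psi> by fastforce
        finally show "(chain_mean \<theta> ^^ Suc n) (far \<theta> R'') \<psi> \<le> e" by simp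
      qed
    qed
  qed
qed


text \<open>At \<theta> = 0 the word maps \<open>y\<close> onto the line of the basis vector. At
  \<theta> it errs by at most C \<theta>, that is C \<theta> / \<delta> relative to the amplitude,
  and the chart at most multiplies distances from its center by L + 1. Blowing up divides by
  \<theta> and leaves a radius independent of it.\<close>

lemma word_hits_near:
  fixes x :: "'n \<Rightarrow> 'p mod_ring"
  assumes \<delta>: "\<delta> > 0"
  shows "\<exists>R. \<forall>R'\<ge>R. \<forall>\<^sub>F \<theta> in at_right 0. \<forall>y. norm y = 1 \<longrightarrow> \<delta> \<le> cmod (y $ x) \<longrightarrow>
    \<delta> / 2 \<le> norm (word_apply a j0 \<theta> (basis_word j0 (mat 1) x) y) \<and>
    near R' (blowup_map U \<kappa> \<theta> (ray_of (word_apply a j0 \<theta> (basis_word j0 (mat 1) x) y)))"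
proof -
  let ?W = "\<lambda>\<theta> y. word_apply a j0 \<theta> (basis_word j0 (mat 1) x) y"
  let ?x = "axis x 1 :: ('n, 'p) qvec"
  define t where "t = ray_of ?x"
  have t: "t \<in> S" unfolding t_def by (rule basis_state_stabilizer)
  obtain d where d: "d \<noteq> 0" "ket t = d *s ?x"
  proof (rule ray_of_eqD)
    show "?x \<noteq> 0" "ket t \<noteq> 0" "ray_of ?x = ray_of (ket t)"
      using t by (simp_all add: ket_nonzero ray_of_ket flip: t_def)
  qed
  have "norm (d *s ?x) = 1" using norm_ket [OF t] d(2) by simp
  then have d1: "cmod d = 1" by (simp add: norm_smult)
  have W0: "?W 0 y = y $ x *s ?x" for y
    using basis_word_apply [OF clifford_one, of a j0 x y] by (simp add: dagger_mat)
  obtain C where C: "C \<ge> 0" "\<And>\<theta> y. norm (?W \<theta> y - ?W 0 y) \<le> C * \<bar>\<theta>\<bar> * norm y"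
    using word_apply_lipschitz [OF basis_word_branches [OF clifford_one, of j0 x], of a j0] by blast
  let ?g = "\<lambda>z. \<kappa> t (ray_of z)"
  have g0: "?g (ket t) = 0" by (simp add: ray_of_ket t chart_center)
  obtain r where r: "r > 0" "\<And>z. norm (z - ket t) < r \<Longrightarrow>
      norm (?g z - ?g (ket t) - tan_proj (ket t) (z - ket t)) \<le> 1 * norm (z - ket t)"
    using chart_has_derivative_ket [OF t] zero_less_one unfolding has_derivative_at_alt by blast
  obtain L where L: "L \<ge> 0" "\<And>v. norm (tan_proj (ket t) v) \<le> norm v * L"
    using bounded_linear.nonneg_bounded [OF bounded_linear_tan_proj] by blast
  have "\<forall>\<^sub>F z in nhds (1 *s ket t). z \<noteq> 0 \<and> ray_of z \<in> U t"
    by (rule eventually_in_chart [OF t]) simp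
  then obtain r' where r': "r' > 0" "\<And>z. dist z (ket t) < r' \<Longrightarrow> z \<noteq> 0 \<and> ray_of z \<in> U t"
    unfolding eventually_nhds_metric by auto
  define R where "R = (L + 1) * (C / \<delta>)"
  \<comment> \<open>The first threshold keeps the rescaled vector inside the neighbourhoods of
    radius \<open>r\<close> and \<open>r'\<close> of \<open>ket t\<close>; the second keeps the
    error below half of the amplitude.\<close>
  have pos: "0 < min r r' / (C / \<delta> + 1)" "0 < \<delta> / 2 / (C + 1)"
    using r(1) r'(1) C(1) \<delta> by (auto intro!: divide_pos_pos add_nonneg_pos)
  show ?thesis
  proof (intro exI [of _ R] allI impI)
    fix R' assume R': "R \<le> R'"
    show "\<forall>\<^sub>F \<theta> in at_right 0. \<forall>y. norm y = 1 \<longrightarrow> \<delta> \<le> cmod (y $ x) \<longrightarrow>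
        \<delta> / 2 \<le> norm (?W \<theta> y) \<and> near R' (blowup_map U \<kappa> \<theta> (ray_of (?W \<theta> y)))"
      using eventually_at_right_real [OF pos(1)] eventually_at_right_real [OF pos(2)]
    proof eventually_elim
      case (elim \<theta>)
      then have \<theta>: "\<theta> > 0" by simp
      have "\<theta> * (C / \<delta> + 1) < min r r'"
        using elim(1) C(1) \<delta> by (simp add: less_divide_eq add_nonneg_pos)
      then have small: "C / \<delta> * \<theta> < r" "C / \<delta> * \<theta> < r'"
        using \<theta> by (simp_all add: algebra_simps)
      have "\<theta> * (C + 1) < \<delta> / 2"
        using elim(2) C(1) by (simp add: less_divide_eq add_nonneg_pos algebra_simps)
      then have half: "C * \<theta> < \<delta> / 2" using \<theta> by (simp add: algebra_simps)
      show ?case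
      proof (intro allI impI conjI)
        fix y :: "('n, 'p) qvec" assume y: "norm y = 1" "\<delta> \<le> cmod (y $ x)"
        have y0: "y $ x \<noteq> 0" using y(2) \<delta> by auto
        have W: "norm (?W \<theta> y - y $ x *s ?x) \<le> C * \<theta>" using C(2) [of \<theta> y] y(1) \<theta> by (simp add: W0)
        have "cmod (y $ x) = norm (y $ x *s ?x)" by (simp add: norm_smult)
        also have "\<dots> \<le> norm (?W \<theta> y) + norm (?W \<theta> y - y $ x *s ?x)"
          using norm_triangle_sub [of "y $ x *s ?x" "?W \<theta> y"] by (simp add: norm_minus_commute)
        finally show "\<delta> / 2 \<le> norm (?W \<theta> y)" using W y(2) half by linarith
        \<comment> \<open>Rescaling does not change the ray and moves the vector to within C
          \<theta> / \<delta> of \<open>ket t\<close>, where the derivative of the chart is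
          known.\<close>
        define z where "z = (d / y $ x) *s ?W \<theta> y"
        have dy: "d / y $ x \<noteq> 0" using d(1) y0 by simp
        have "z - ket t = (d / y $ x) *s (?W \<theta> y - y $ x *s ?x)"
          using y0 by (simp add: z_def d(2) vector_ssub_ldistrib vector_smult_assoc)
        then have "norm (z - ket t) = norm (?W \<theta> y - y $ x *s ?x) / cmod (y $ x)"
          by (simp only: norm_smult norm_divide d1) simp
        also have "\<dots> \<le> C * \<theta> / \<delta>" using W y(2) \<delta> C(1) \<theta> by (intro frac_le) auto
        finally have zt: "norm (z - ket t) \<le> C / \<delta> * \<theta>" by simp
        have zU: "ray_of z \<in> U t" using r'(2) [of z] zt small by (simp add: dist_norm)
        have "norm (?g z - tan_proj (ket t) (z - ket t)) \<le> norm (z - ket t)"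
          using r(2) [of z] zt small by (simp add: g0)
        then have "norm (?g z) \<le> norm (z - ket t) * (L + 1)"
          using norm_triangle_sub [of "?g z" "tan_proj (ket t) (z - ket t)"] L(2) [of "z - ket t"]
          by (simp add: algebra_simps)
        also have "\<dots> \<le> C / \<delta> * \<theta> * (L + 1)" using zt L(1) by (intro mult_right_mono) auto
        finally have "norm (?g z /\<^sub>R \<theta>) \<le> R" using \<theta> by (simp add: R_def field_simps)
        then have "near R' (blowup_map U \<kappa> \<theta> (ray_of z))"
          using R' by (simp add: near_def blowup_map_Some [OF t zU])
        then show "near R' (blowup_map U \<kappa> \<theta> (ray_of (?W \<theta> y)))"
          unfolding z_def ray_of_smult [OF dy] .
      qed
    qed
  qed
qed

text \<open>Pigeonhole for the squared components. It makes the hitting probability uniform over all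
  states.\<close>

lemma large_component:
  fixes y :: "('n, 'p) qvec"
  assumes "norm y = 1"
  shows "\<exists>x. 1 / sqrt (CARD('n \<Rightarrow> 'p mod_ring)) \<le> cmod (y $ x)"
proof (rule ccontr)
  let ?D = "real CARD('n \<Rightarrow> 'p mod_ring)"
  have D: "?D > 0" by (simp add: card_gt_0_iff del: card_fun)
  assume "\<not> (\<exists>x. 1 / sqrt ?D \<le> cmod (y $ x))"
  then have "(cmod (y $ x))\<^sup>2 < (1 / sqrt ?D)\<^sup>2" for x
    by (intro power_strict_mono) (auto simp: not_le)
  then have "(\<Sum>x\<in>UNIV. (cmod (y $ x))\<^sup>2) < (\<Sum>x\<in>(UNIV :: ('n \<Rightarrow> 'p mod_ring) set).
      (1 / sqrt ?D)\<^sup>2)"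
    by (intro sum_strict_mono) auto
  also have "\<dots> = 1" using D by (simp add: power_divide del: card_fun)
  finally have "(norm y)\<^sup>2 < 1" by (simp add: norm_vec_def L2_set_def sum_nonneg)
  then show False using assms by simp
qed

text \<open>From any state, a basis vector with overlap at least \<delta> is taken as the outcome of
  measuring all qudits. The word depends on the state, but its length does not, and there are
  finitely many words.\<close>

lemma chain_hits_near:
  "\<exists>n R c. 0 < c \<and> c \<le> 1 \<and> (\<forall>R'\<ge>R. \<forall>\<^sub>F \<theta> in at_right 0. \<forall>\<psi>. (chain_mean \<theta> ^^ n) (far \<theta> R') \<psi> \<le> 1 - c)"
proof -
  let ?C = "real (card (proj_clifford :: ('n, 'p) qop set set))"
  define n where "n = length (SOME js. set js = (UNIV :: 'n set))"
  define \<delta> where "\<delta> = 1 / sqrt (CARD('n \<Rightarrow> 'p mod_ring))"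
  \<comment> \<open>The n Clifford elements of the word are drawn with probability 1/|C| each, and
    the outcomes occur with probability at least the square of \<delta>/2.\<close>
  define c where "c = (1 / ?C) ^ n * (\<delta> / 2)\<^sup>2"
  have D: "real CARD('n \<Rightarrow> 'p mod_ring) \<ge> 1"
    using card_gt_0_iff [of "UNIV :: ('n \<Rightarrow> 'p mod_ring) set"] by (simp del: card_fun)
  have \<delta>: "0 < \<delta>" "\<delta> \<le> 1" using D by (auto simp: \<delta>_def simp del: card_fun)
  have C: "?C \<ge> 1" using card_clifford_pos by simp
  have "0 < c" using C \<delta> by (simp add: c_def)
  moreover have "c \<le> 1 * 1" unfolding c_def
    using C \<delta> by (intro mult_mono power_le_one) (auto simp: divide_le_eq)
  moreover have "\<exists>R. \<forall>x\<in>UNIV. \<forall>R'\<ge>R. \<forall>\<^sub>F \<theta> in at_right 0. \<forall>y. norm y = 1 \<longrightarrow> \<delta> \<le> cmod (y $ x) \<longrightarrow>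
    \<delta> / 2 \<le> norm (word_apply a j0 \<theta> (basis_word j0 (mat 1) x) y) \<and>
    near R' (blowup_map U \<kappa> \<theta> (ray_of (word_apply a j0 \<theta> (basis_word j0 (mat 1) x) y)))"
    by (rule finite_uniform_bound) (use word_hits_near [OF \<delta>(1)] in auto)
  then obtain R where R: "\<And>x R'. R' \<ge> R \<Longrightarrow> \<forall>\<^sub>F \<theta> in at_right 0. \<forall>y. norm y = 1 \<longrightarrow>
      \<delta> \<le> cmod (y $ x) \<longrightarrow>
    \<delta> / 2 \<le> norm (word_apply a j0 \<theta> (basis_word j0 (mat 1) x) y) \<and>
    near R' (blowup_map U \<kappa> \<theta> (ray_of (word_apply a j0 \<theta> (basis_word j0 (mat 1) x) y)))" by blast
  have "\<forall>\<^sub>F \<theta> in at_right 0. \<forall>\<psi>. (chain_mean \<theta> ^^ n) (far \<theta> R') \<psi> \<le> 1 - c" if R': "R' \<ge> R" for R'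
  proof -
    have "\<forall>\<^sub>F \<theta> in at_right 0. \<forall>x\<in>UNIV. \<forall>y. norm y = 1 \<longrightarrow> \<delta> \<le> cmod (y $ x) \<longrightarrow>
      \<delta> / 2 \<le> norm (word_apply a j0 \<theta> (basis_word j0 (mat 1) x) y) \<and>
      near R' (blowup_map U \<kappa> \<theta> (ray_of (word_apply a j0 \<theta> (basis_word j0 (mat 1) x) y)))"
      by (rule eventually_ball_finite) (use R [OF R'] in auto)
    then show ?thesis
    proof eventually_elim
      case (elim \<theta>)
      show ?case
      proof
        fix \<psi> :: "('n, 'p) qray"
        let ?y = "unit_rep \<psi>"
        obtain x where x: "\<delta> \<le> cmod (?y $ x)"
          unfolding \<delta>_def using large_component [OF unit_rep(2)] by blast
        let ?w = "basis_word j0 (mat 1) x"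
        let ?W = "word_apply a j0 \<theta> ?w ?y"
        have W: "\<delta> / 2 \<le> norm ?W" "far \<theta> R' (ray_of ?W) = 0"
          using elim x unit_rep(2) [of \<psi>] by (auto simp: far_def)
        \<comment> \<open>\<open>chain_mean_word\<close> needs a nonnegative function that is large
          near the stabilizer states, hence 1 minus the indicator \<open>far\<close>.\<close>
        have "c \<le> (1 / ?C) ^ n * (norm ?W / norm ?y)\<^sup>2 * ((-1) * far \<theta> R' (ray_of ?W) + 1)"
        proof -
          have "(\<delta> / 2)\<^sup>2 \<le> (norm ?W / norm ?y)\<^sup>2"
            using W(1) \<delta>(1) by (intro power_mono) (simp_all add: unit_rep)
          then have "c \<le> (1 / ?C) ^ n * (norm ?W / norm ?y)\<^sup>2"
            unfolding c_def by (intro mult_left_mono) auto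
          then show ?thesis by (simp add: W(2))
        qed
        also have "\<dots> \<le> (chain_mean \<theta> ^^ n) (\<lambda>\<psi>. (-1) * far \<theta> R' \<psi> + 1) (ray_of ?y)"
          using chain_mean_word [OF basis_word_branches [OF clifford_one, of j0 x] unit_rep_nonzero [of \<psi>],
              of "\<lambda>\<psi>. (-1) * far \<theta> R' \<psi> + 1" \<theta>] far_bounds(2) [of \<theta> R']
          unfolding length_basis_word n_def by simp
        also have "\<dots> = (-1) * (chain_mean \<theta> ^^ n) (far \<theta> R') \<psi> + 1"
          by (subst chain.funpow_branch_mean_affine) simp_all
        finally show "(chain_mean \<theta> ^^ n) (far \<theta> R') \<psi> \<le> 1 - c" by simp
      qed
    qed
  qed
  ultimately show ?thesis
    by (intro exI [of _ n] exI [of _ R] exI [of _ c]) auto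
qed

end


section \<open>Geometric decay of the stationary mass far from the stabilizer states\<close>

locale blowup_chain = blowup_charts ket U \<kappa> \<eta> \<rho> a j0
  for ket :: "('n::finite, 'p::prime_card) qray \<Rightarrow> ('n, 'p) qvec" and U \<kappa> \<eta> \<rho> a j0 +
  fixes stat :: "real \<Rightarrow> ('n, 'p) qray measure"
  assumes stat: "\<And>\<theta>. 0 < \<theta> \<Longrightarrow> \<theta> \<le> 1 \<Longrightarrow>
      invariant_prob borel (chain_kernel a j0 \<theta>) (stat \<theta>)"
begin

lemma eventually_unit: "\<forall>\<^sub>F \<theta> in at_right (0::real). 0 < \<theta> \<and> \<theta> \<le> 1"
  using eventually_at_right_real [OF zero_less_one] by eventually_elim simp

lemma stat_integrable:
  assumes "0 < \<theta>" "\<theta> \<le> 1" "f \<in> borel_measurable borel" "\<And>\<psi>. \<bar>f \<psi>\<bar> \<le> B"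
  shows "integrable (stat \<theta>) (f :: _ \<Rightarrow> real)"
proof -
  have s: "sets (stat \<theta>) = sets borel" and p: "prob_space (stat \<theta>)"
    using stat [OF assms(1,2)] by (auto simp: invariant_prob_def)
  show ?thesis
  proof (rule finite_measure.integrable_const_bound [OF prob_space.finite_measure [OF p]])
    show "f \<in> borel_measurable (stat \<theta>)" using assms(3) measurable_cong_sets [OF s refl] by blast
    show "AE x in stat \<theta>. norm (f x) \<le> B" using assms(4) by simp
  qed
qed

lemma stat_measure_space: "0 < \<theta> \<Longrightarrow> \<theta> \<le> 1 \<Longrightarrow>
    measure (stat \<theta>) (space (stat \<theta>)) = 1"
  using stat [of \<theta>] prob_space.prob_space [of "stat \<theta>"] by (simp add: invariant_prob_def)

lemma far_integrable: "0 < \<theta> \<Longrightarrow> \<theta> \<le> 1 \<Longrightarrow> integrable (stat \<theta>) (far \<theta> R)"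
  by (rule stat_integrable [where B = 1]) (auto simp: far_measurable far_bounds)

lemma far_funpow:
  assumes "0 < \<theta>" "\<theta> \<le> 1"
  shows "(chain_mean \<theta> ^^ n) (far \<theta> R) \<in> borel_measurable borel"
    and "\<bar>(chain_mean \<theta> ^^ n) (far \<theta> R) \<psi>\<bar> \<le> 1"
    and "(\<integral>\<psi>. (chain_mean \<theta> ^^ n) (far \<theta> R) \<psi> \<partial>stat \<theta>) = (\<integral>\<psi>. far \<theta> R \<psi> \<partial>stat \<theta>)"
proof -
  have "\<bar>far \<theta> R \<psi>\<bar> \<le> 1" for \<psi> by (simp add: far_def)
  note * = chain.funpow_branch_mean [OF stat [OF assms] far_measurable [of \<theta> R] this]
  show "(chain_mean \<theta> ^^ n) (far \<theta> R) \<in> borel_measurable borel" by (rule *(1))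
  show "\<bar>(chain_mean \<theta> ^^ n) (far \<theta> R) \<psi>\<bar> \<le> 1" by (rule *(2)) simp
  show "(\<integral>\<psi>. (chain_mean \<theta> ^^ n) (far \<theta> R) \<psi> \<partial>stat \<theta>) = (\<integral>\<psi>. far \<theta> R \<psi> \<partial>stat \<theta>)" by (rule *(3))
qed

text \<open>By invariance the far mass at a new radius equals the integral of its n-step average.
  This average is o(1) on states near at the old radius and at most 1 - c elsewhere. Each round
  multiplies the far mass by 1 - c, up to o(1), and enlarges the radius.\<close>

lemma tight_geometric:
  assumes c: "0 < c" "c \<le> 1"
    and hit: "\<And>R'. R' \<ge> R0 \<Longrightarrow> \<forall>\<^sub>F \<theta> in at_right 0. \<forall>\<psi>. (chain_mean \<theta> ^^ n) (far \<theta>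
        R') \<psi> \<le> 1 - c"
  shows "\<exists>R. \<forall>e>0. \<forall>\<^sub>F \<theta> in at_right 0. (\<integral>\<psi>. far \<theta> R \<psi> \<partial>stat \<theta>) \<le> (1 - c) ^ k + e"
proof (induction k)
  case 0
  show ?case
  proof (intro exI [of _ 0] allI impI)
    fix e :: real assume e: "e > 0"
    show "\<forall>\<^sub>F \<theta> in at_right 0. (\<integral>\<psi>. far \<theta> 0 \<psi> \<partial>stat \<theta>) \<le> (1 - c) ^ 0 + e"
      using eventually_unit
    proof eventually_elim
      case (elim \<theta>)
      have "(\<integral>\<psi>. far \<theta> 0 \<psi> \<partial>stat \<theta>) \<le> (\<integral>\<psi>. 1 \<partial>stat \<theta>)"
        using elim by (intro integral_mono far_integrable stat_integrable [where B =
            1]) (auto simp: far_bounds)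
      then show ?case using elim e by (simp add: stat_measure_space)
    qed
  qed
next
  case (Suc k)
  then obtain R where R: "\<And>e. e > 0 \<Longrightarrow>
      \<forall>\<^sub>F \<theta> in at_right 0. (\<integral>\<psi>. far \<theta> R \<psi> \<partial>stat \<theta>) \<le> (1 - c) ^ k + e"
    by blast
  obtain R1 where R1: "\<And>R'' e. R'' \<ge> R1 \<Longrightarrow> e > 0 \<Longrightarrow>
      \<forall>\<^sub>F \<theta> in at_right 0. \<forall>\<psi>. near R (blowup_map U \<kappa> \<theta> \<psi>) \<longrightarrow>
    (chain_mean \<theta> ^^ n) (far \<theta> R'') \<psi> \<le> e" using chain_stays_near_funpow [of R n] by blast
  let ?R = "max R0 R1"
  show ?case
  proof (intro exI [of _ ?R] allI impI)
    fix e :: real assume "e > 0"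
    then have e: "e / 2 > 0" by simp
    show "\<forall>\<^sub>F \<theta> in at_right 0. (\<integral>\<psi>. far \<theta> ?R \<psi> \<partial>stat \<theta>) \<le> (1 - c) ^ Suc k + e"
      using eventually_unit R [OF e] R1 [of ?R, OF _ e, simplified] hit [of ?R, simplified]
    proof eventually_elim
      case (elim \<theta>)
      have m: "(chain_mean \<theta> ^^ n) (far \<theta> ?R) \<in> borel_measurable borel"
        and b: "\<bar>(chain_mean \<theta> ^^ n) (far \<theta> ?R) \<psi>\<bar> \<le> 1" for \<psi>
        using elim(1) by (simp_all add: far_funpow)
      have "(\<integral>\<psi>. far \<theta> ?R \<psi> \<partial>stat \<theta>) = (\<integral>\<psi>. (chain_mean \<theta> ^^ n) (far \<theta> ?R) \<psi> \<partial>stat \<theta>)"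
        using elim(1) by (simp add: far_funpow)
      also have "\<dots> \<le> (\<integral>\<psi>. (1 - c) * far \<theta> R \<psi> + e / 2 \<partial>stat \<theta>)"
      proof (rule integral_mono)
        show "integrable (stat \<theta>) ((chain_mean \<theta> ^^ n) (far \<theta> ?R))"
          using elim(1) m b by (intro stat_integrable [where B = 1]) auto
        show "integrable (stat \<theta>) (\<lambda>\<psi>. (1 - c) * far \<theta> R \<psi> + e / 2)"
          using elim(1) by (intro Bochner_Integration.integrable_add integrable_mult_right far_integrable
            stat_integrable [where B = "e / 2"]) (use e in auto)
        fix \<psi>
        show "(chain_mean \<theta> ^^ n) (far \<theta> ?R) \<psi> \<le> (1 - c) * far \<theta> R \<psi> + e / 2"
        proof (cases "near R (blowup_map U \<kappa> \<theta> \<psi>)")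
          case True
          then show ?thesis using elim(3) by (simp add: far_def)
        next
          case False
          have "(chain_mean \<theta> ^^ n) (far \<theta> ?R) \<psi> \<le> 1 - c" using elim(4) by blast
          then show ?thesis using False e by (simp add: far_def)
        qed
      qed
      also have "\<dots> = (1 - c) * (\<integral>\<psi>. far \<theta> R \<psi> \<partial>stat \<theta>) + e / 2"
        using elim(1) by (subst Bochner_Integration.integral_add)
          (auto intro!: integrable_mult_right far_integrable stat_integrable [where B =
              "\<bar>e\<bar>"] simp: stat_measure_space)
      also have "\<dots> \<le> (1 - c) * ((1 - c) ^ k + e / 2) + e / 2"
        using elim(2) c by (intro add_right_mono mult_left_mono) auto
      also have "\<dots> \<le> (1 - c) ^ Suc k + e"
      proof -
        have "(1 - c) * (e / 2) \<le> 1 * (e / 2)" using c e by (intro mult_right_mono) auto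
        then show ?thesis unfolding distrib_left power_Suc by linarith
      qed
      finally show ?case .
    qed
  qed
qed

lemma tight:
  assumes "e > 0"
  shows "\<exists>R. \<forall>\<^sub>F \<theta> in at_right 0. (\<integral>\<psi>. far \<theta> R \<psi> \<partial>stat \<theta>) \<le> e"
proof -
  obtain n R0 c where c: "0 < c" "c \<le> 1"
    and hit: "\<And>R'. R' \<ge> R0 \<Longrightarrow> \<forall>\<^sub>F \<theta> in at_right 0. \<forall>\<psi>. (chain_mean \<theta> ^^ n) (far \<theta>
        R') \<psi> \<le> 1 - c"
    using chain_hits_near by blast
  have "(\<lambda>k. (1 - c) ^ k) \<longlonglongrightarrow> 0" using c by (intro LIMSEQ_power_zero) auto
  then have "\<forall>\<^sub>F k in sequentially. (1 - c) ^ k < e / 2" using assms by (intro order_tendstoD) auto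
  then obtain k where k: "(1 - c) ^ k < e / 2" unfolding eventually_sequentially by blast
  obtain R where R: "\<And>e. e > 0 \<Longrightarrow> \<forall>\<^sub>F \<theta> in at_right 0. (\<integral>\<psi>. far \<theta> R \<psi> \<partial>stat \<theta>) \<le> (1
      - c) ^ k + e"
    using tight_geometric [OF c hit] by blast
  have "e / 2 > 0" using assms by simp
  from R [OF this] have "\<forall>\<^sub>F \<theta> in at_right 0. (\<integral>\<psi>. far \<theta> R \<psi> \<partial>stat \<theta>) \<le> e"
    by eventually_elim (use k in linarith)
  then show ?thesis by blast
qed

end


context blowup_charts
begin

section \<open>Convergence of the blown-up kernels\<close>

abbreviation hat_mean :: "(('n, 'p) qray \<times> ('n, 'p) qvec \<Rightarrow> real) \<Rightarrow> ('n,
    'p) qray \<times> ('n, 'p) qvec \<Rightarrow> real" where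
  "hat_mean \<equiv> branch_mean branches hat_weight hat_map"

text \<open>Splits a test function on the extended space into its value at the isolated point and a
  function on the blow-up space, so that the tangent kernel can be applied to the second part
  alone.\<close>

definition with_None :: "real \<Rightarrow> ('x \<Rightarrow> real) \<Rightarrow> 'x option
    \<Rightarrow> real" where
  "with_None c f x = (case x of None \<Rightarrow> c | Some y \<Rightarrow> f y)"

lemma with_None_simps [simp]: "with_None c f None = c" "with_None c f (Some y) = f y"
  by (simp_all add: with_None_def)

lemma with_None_measurable:
  assumes "continuous_map Xhat euclidean f"
  shows "(\<lambda>\<psi>. with_None c f (blowup_map U \<kappa> \<theta> \<psi>)) \<in> borel_measurable borel"
proof -
  have "continuous_map (add_isolated Xhat) euclidean (with_None c f)"
    unfolding continuous_map_add_isolated using assms by simp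
  from measurable_compose [OF blowup_map_measurable continuous_map_borel_measurable [OF this]] show
      ?thesis .
qed

lemma with_None_bound:
  assumes "\<theta> > 0" "\<bar>c\<bar> \<le> B" "\<And>x. x \<in> topspace Xhat \<Longrightarrow> \<bar>f x\<bar> \<le> B"
  shows "\<bar>with_None c f (blowup_map U \<kappa> \<theta> \<psi>)\<bar> \<le> B"
proof (cases "blowup_map U \<kappa> \<theta> \<psi>")
  case (Some x)
  moreover obtain s v where "x = (s, v)" by (cases x)
  ultimately have "blowup_map U \<kappa> \<theta> \<psi> = Some (s, v)" "x = (s, v)" by simp_all
  then have "x \<in> topspace Xhat"
    using blowup_map_eq_Some(1,2) [OF _ assms(1)] by (simp add: topspace_Xhat)
  then show ?thesis using Some assms(3) by simp
qed (use assms(2) in simp)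

lemma chain_weight_le_1: 
  assumes "J \<in> branches" shows "chain_weight \<theta> J \<psi> \<le> 1"
  using member_le_sum [OF assms, of "\<lambda>J. chain_weight \<theta> J \<psi>"] chain_weight_nonneg finite_branches_set
    chain_weight_sum [of \<theta> \<psi>] by simp

lemma chain_weight_diff: "\<bar>chain_weight \<theta> J \<psi> - chain_weight \<theta>' J \<psi>'\<bar>
    \<le> \<bar>branch_prob a j0 J \<theta> \<psi> - branch_prob a j0 J \<theta>' \<psi>'\<bar>"
proof -
  have "\<bar>chain_weight \<theta> J \<psi> - chain_weight \<theta>' J \<psi>'\<bar>
      = \<bar>branch_prob a j0 J \<theta> \<psi> - branch_prob a j0 J \<theta>' \<psi>'\<bar> / real (card (proj_clifford :: ('n,
          'p) qop set set))"
    by (simp add: chain_weight_def flip: diff_divide_distrib)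
  also have "\<dots> \<le> \<bar>branch_prob a j0 J \<theta> \<psi> - branch_prob a j0 J \<theta>' \<psi>'\<bar> / 1"
    using card_clifford_pos by (intro divide_left_mono) auto
  finally show ?thesis by simp
qed

text \<open>The weight converges uniformly on bounded sets. If the branch is possible at
  \<open>s\<close>, its images stay in a compact ball, where \<open>f\<close> is uniformly
  continuous; otherwise the vanishing weight and the bound on \<open>f\<close> suffice.\<close>

lemma branch_converges:
  assumes s: "s \<in> S" and J: "J \<in> branches" and e: "e > 0"
    and f: "continuous_map Xhat euclidean f"
    and B: "\<And>x. x \<in> topspace Xhat \<Longrightarrow> \<bar>f x\<bar> \<le> B" "\<bar>c0\<bar> \<le> B"
  shows "\<forall>\<^sub>F \<theta> in at_right 0. \<forall>v\<in>tangent (ket s). norm v \<le> R \<longrightarrow>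
    \<bar>chain_weight \<theta> J (inv_into (U s) (\<kappa> s) (\<theta> *\<^sub>R v))
        * with_None c0 f (blowup_map U \<kappa> \<theta> (branch_map a j0 J \<theta> (inv_into (U s) (\<kappa> s) (\<theta> *\<^sub>R v))))
      - hat_weight J (s, v) * f (hat_map J (s, v))\<bar> \<le> e"
proof -
  have B0: "B \<ge> 0" using B(2) by simp
  let ?\<phi> = "\<lambda>\<theta> v. inv_into (U s) (\<kappa> s) (\<theta> *\<^sub>R v)"
  let ?\<psi> = "\<lambda>\<theta> v. branch_map a j0 J \<theta> (?\<phi> \<theta> v)"
  \<comment> \<open>Multiplied by the bound B of the test function, this weight error costs at most
    e/2; the summand 1 covers B = 0.\<close>
  have e': "e / (2 * (B + 1)) > 0" using e B0 by (intro divide_pos_pos) auto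
  have small: "e / (2 * (B + 1)) * B \<le> e / 2"
    using e B0 by (simp add: field_simps)
  have w: "\<forall>\<^sub>F \<theta> in at_right 0. \<forall>v\<in>tangent (ket s). norm v \<le> R \<longrightarrow>
    \<bar>chain_weight \<theta> J (?\<phi> \<theta> v) - hat_weight J (s, v)\<bar> \<le> e / (2 * (B + 1))"
    using branch_prob_uniform [OF s J e', of R]
  proof eventually_elim
    case (elim \<theta>)
    show ?case
    proof (intro ballI impI)
      fix v assume "v \<in> tangent (ket s)" "norm v \<le> R"
      then have "\<bar>branch_prob a j0 J \<theta> (?\<phi> \<theta> v) - branch_prob a j0 J 0 s\<bar> \<le> e / (2 * (B + 1))"
          using elim by blast
      then show "\<bar>chain_weight \<theta> J (?\<phi> \<theta> v) - hat_weight J (s, v)\<bar> \<le> e / (2 * (B + 1))"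
        using chain_weight_diff [of \<theta> J "?\<phi> \<theta> v" 0 s] by (simp add: hat_weight_def)
    qed
  qed
  show ?thesis
  proof (cases "branch_prob a j0 J 0 s > 0")
    case False
    then have "branch_prob a j0 J 0 s = 0" by (simp add: branch_prob_def)
    then have h0: "hat_weight J (s, v) = 0" for v by (simp add: hat_weight_def chain_weight_def)
    show ?thesis
      using w eventually_at_right_less
    proof eventually_elim
      case (elim \<theta>)
      show ?case
      proof (intro ballI impI)
        fix v assume v: "v \<in> tangent (ket s)" "norm v \<le> R"
        let ?F = "with_None c0 f (blowup_map U \<kappa> \<theta> (?\<psi> \<theta> v))"
        have "\<bar>chain_weight \<theta> J (?\<phi> \<theta> v)\<bar> * \<bar>?F\<bar> \<le> e / (2 * (B + 1)) * B"
          using elim v h0 with_None_bound [OF elim(2) B(2,1)] e' by (intro mult_mono) fastforce+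
        moreover have "\<bar>chain_weight \<theta> J (?\<phi> \<theta> v) * ?F - hat_weight J (s, v) * f (hat_map J (s, v))\<bar>
            = \<bar>chain_weight \<theta> J (?\<phi> \<theta> v)\<bar> * \<bar>?F\<bar>"
          by (simp add: h0 abs_mult)
        ultimately show "\<bar>chain_weight \<theta> J (?\<phi> \<theta> v) * ?F - hat_weight J (s, v) * f (hat_map J (s, v))\<bar> \<le> e"
          using small e by linarith
      qed
    qed
  next
    case True
    let ?t = "branch_map a j0 J 0 s"
    let ?g = "\<lambda>v. branch_linear ket U \<kappa> a j0 J s v + branch_shift U \<kappa> a j0 J s"
    note h = hat_map_component [OF s J True]
    obtain c where c: "c \<noteq> 0" "branch_op a j0 J 0 *v ket s = c *s ket ?t"
      by (rule branch_op_ket_eq [OF s J True])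
    obtain L where L: "L \<ge> 0" "\<And>v. norm (branch_linear ket U \<kappa> a j0 J s v) \<le> norm v * L"
      using bounded_linear.nonneg_bounded [OF h(3)] by blast
    \<comment> \<open>The margin 1 keeps both the affine image and the true image in the compact set
      \<open>?K\<close>.\<close>
    define R' where "R' = \<bar>R\<bar> * L + norm (branch_shift U \<kappa> a j0 J s) + 1"
    let ?K = "tangent (ket ?t) \<inter> cball 0 R'"
    have "compact ?K" by (intro closed_Int_compact closed_tangent compact_cball)
    moreover have "continuous_on ?K (\<lambda>v. f (?t, v))"
      using f h(1) unfolding continuous_map_Xhat by (blast intro: continuous_on_subset)
    ultimately have "uniformly_continuous_on ?K (\<lambda>v. f (?t, v))"
      by (rule compact_uniformly_continuous [rotated])
    then obtain \<delta> where \<delta>: "\<delta> > 0" "\<And>x y. x \<in> ?K \<Longrightarrow> y \<in> ?K \<Longrightarrow>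
        dist y x < \<delta> \<Longrightarrow> dist (f (?t, y)) (f (?t, x)) < e / 2"
      unfolding uniformly_continuous_on_def using e by (metis half_gt_zero)
    have "min 1 (\<delta> / 2) > 0" using \<delta>(1) by simp
    from branch_uniform [OF s J True c this, of R] w eventually_at_right_less
    show ?thesis
    proof eventually_elim
      case (elim \<theta>)
      show ?case
      proof (intro ballI impI)
        fix v assume v: "v \<in> tangent (ket s)" "norm v \<le> R"
        let ?F = "with_None c0 f (blowup_map U \<kappa> \<theta> (?\<psi> \<theta> v))"
        let ?v = "\<kappa> ?t (?\<psi> \<theta> v) /\<^sub>R \<theta>"
        have \<psi>: "?\<psi> \<theta> v \<in> U ?t" "norm (?v - ?g v) \<le> min 1 (\<delta> / 2)" using elim v by blast+
        have "norm v * L \<le> \<bar>R\<bar> * L" using v(2) L(1) by (intro mult_right_mono) auto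
        then have n: "norm (?g v) \<le> R' - 1"
          using norm_triangle_ineq [of "branch_linear ket U \<kappa> a j0 J s v"
              "branch_shift U \<kappa> a j0 J s"] L(2) [of v]
          unfolding R'_def by linarith
        then have n': "norm ?v \<le> R'"
          using \<psi>(2) norm_triangle_sub [of ?v "?g v"] by simp
        have "?v \<in> ?K" using n' \<psi>(1) h(1) by (simp add: tangent_scaleR chart_tangent)
        moreover have "?g v \<in> ?K" using n h(2) [OF v(1)] by simp
        moreover have "dist ?v (?g v) < \<delta>" using \<psi>(2) \<delta>(1) by (simp add: dist_norm)
        ultimately have d: "\<bar>f (?t, ?v) - f (?t, ?g v)\<bar> < e / 2"
          using \<delta>(2) by (simp add: dist_real_def)
        have F: "?F = f (?t, ?v)" by (simp add: blowup_map_Some [OF h(1) \<psi>(1)])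
        have G: "f (hat_map J (s, v)) = f (?t, ?g v)" by (simp add: hat_map_def)
        have wd: "\<bar>chain_weight \<theta> J (?\<phi> \<theta> v) - hat_weight J (s, v)\<bar> \<le> e / (2 * (B + 1))"
            using elim v by blast
        have "chain_weight \<theta> J (?\<phi> \<theta> v) * ?F - hat_weight J (s, v) * f (hat_map J (s, v))
            = (chain_weight \<theta> J (?\<phi> \<theta> v) - hat_weight J (s, v)) * ?F
              + hat_weight J (s, v) * (f (?t, ?v) - f (?t, ?g v))"
          by (simp add: F G algebra_simps)
        moreover have "\<bar>(chain_weight \<theta> J (?\<phi> \<theta> v) - hat_weight J (s, v)) * ?F\<bar> \<le> e / (2 * (B + 1)) * B"
          unfolding abs_mult using wd with_None_bound [OF elim(3) B(2,1)] e' by (intro mult_mono) auto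
        moreover have "\<bar>hat_weight J (s, v) * (f (?t, ?v) - f (?t, ?g v))\<bar> \<le> 1 * (e / 2)"
          unfolding abs_mult
        proof (rule mult_mono)
          show "\<bar>hat_weight J (s, v)\<bar> \<le> 1"
            using chain_weight_nonneg [of 0 J s] chain_weight_le_1 [OF J,
                of 0 s] by (simp add: hat_weight_def)
        qed (use d in auto)
        ultimately show "\<bar>chain_weight \<theta> J (?\<phi> \<theta> v) * ?F - hat_weight J (s, v) * f (hat_map J (s, v))\<bar> \<le> e"
          using small by linarith
      qed
    qed
  qed
qed

lemma mean_converges:
  assumes e: "e > 0" and f: "continuous_map Xhat euclidean f"
    and B: "\<And>x. x \<in> topspace Xhat \<Longrightarrow> \<bar>f x\<bar> \<le> B" "\<bar>c0\<bar> \<le> B"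
  shows "\<forall>\<^sub>F \<theta> in at_right 0. \<forall>\<psi>. near R (blowup_map U \<kappa> \<theta> \<psi>) \<longrightarrow>
    \<bar>chain_mean \<theta> (\<lambda>\<psi>. with_None c0 f (blowup_map U \<kappa> \<theta> \<psi>)) \<psi>
      - with_None c0 (hat_mean f) (blowup_map U \<kappa> \<theta> \<psi>)\<bar> \<le> e"
proof -
  let ?n = "real (card (branches :: ('n, 'p) branch set))"
  have e': "e / (?n + 1) > 0" using e by (intro divide_pos_pos) auto
  have "\<forall>\<^sub>F \<theta> in at_right 0. \<forall>s\<in>S. \<forall>J\<in>branches. \<forall>v\<in>tangent (ket s). norm v \<le> R \<longrightarrow>
    \<bar>chain_weight \<theta> J (inv_into (U s) (\<kappa> s) (\<theta> *\<^sub>R v))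
        * with_None c0 f (blowup_map U \<kappa> \<theta> (branch_map a j0 J \<theta> (inv_into (U s) (\<kappa> s) (\<theta> *\<^sub>R v))))
      - hat_weight J (s, v) * f (hat_map J (s, v))\<bar> \<le> e / (?n + 1)"
    by (rule eventually_ball_finite [OF finite_S], rule ballI,
        rule eventually_ball_finite [OF finite_branches_set], rule ballI)
      (rule branch_converges [OF _ _ e' f B])
  then show ?thesis
    using eventually_at_right_less
  proof eventually_elim
    case (elim \<theta>)
    show ?case
    proof (intro allI impI)
      fix \<psi> assume "near R (blowup_map U \<kappa> \<theta> \<psi>)"
      then obtain s v where s: "blowup_map U \<kappa> \<theta> \<psi> = Some (s, v)" "s \<in> S" "v \<in> tangent (ket s)" "norm v \<le> R"
        "\<psi> = inv_into (U s) (\<kappa> s) (\<theta> *\<^sub>R v)" by (rule near_obtain [OF _ elim(2)])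
      have "\<bar>chain_mean \<theta> (\<lambda>\<psi>. with_None c0 f (blowup_map U \<kappa> \<theta> \<psi>)) \<psi> - hat_mean f (s, v)\<bar>
          = \<bar>\<Sum>J\<in>branches. chain_weight \<theta> J \<psi> * with_None c0 f (blowup_map U \<kappa> \<theta> (branch_map a j0 J
              \<theta> \<psi>))
              - hat_weight J (s, v) * f (hat_map J (s, v))\<bar>"
        by (simp add: branch_mean_def sum_subtractf)
      also have "\<dots> \<le> (\<Sum>J\<in>(branches :: ('n, 'p) branch set). e / (?n + 1))"
      proof (rule order_trans [OF sum_abs], rule sum_mono)
        fix J :: "('n, 'p) branch" assume J: "J \<in> branches"
        show "\<bar>chain_weight \<theta> J \<psi> * with_None c0 f (blowup_map U \<kappa> \<theta> (branch_map a j0 J \<theta> \<psi>))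
              - hat_weight J (s, v) * f (hat_map J (s, v))\<bar> \<le> e / (?n + 1)"
          using elim(1) s(2-4) J unfolding s(5) by blast
      qed
      also have "\<dots> = ?n * (e / (?n + 1))" by simp
      also have "\<dots> \<le> e" using e by (simp add: field_simps)
      finally show "\<bar>chain_mean \<theta> (\<lambda>\<psi>. with_None c0 f (blowup_map U \<kappa> \<theta> \<psi>)) \<psi>
          - with_None c0 (hat_mean f) (blowup_map U \<kappa> \<theta> \<psi>)\<bar> \<le> e" by (simp add: s(1))
    qed
  qed
qed

end

section \<open>Asymptotic invariance of the blown-up laws under the tangent kernel\<close>

context blowup_chain
begin

lemma with_None_integrable:
  assumes "0 < \<theta>" "\<theta> \<le> 1" "continuous_map Xhat euclidean f"
    "\<bar>c0\<bar> \<le> B" "\<And>x. x \<in> topspace Xhat \<Longrightarrow> \<bar>f x\<bar> \<le> B"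
  shows "integrable (stat \<theta>) (\<lambda>\<psi>. with_None c0 f (blowup_map U \<kappa> \<theta> \<psi>))"
  using assms by (intro stat_integrable [where B = B] with_None_measurable with_None_bound) auto

text \<open>Exact invariance replaces \<open>f\<close> by its one-step average. Near the stabilizer
  states this average is uniformly close to \<open>hat_mean f\<close>; far from them the difference
  is at most 2 B, on a set of small mass.\<close>

lemma invariance_asymptotic:
  assumes f: "continuous_map Xhat euclidean f"
    and B: "\<And>x. x \<in> topspace Xhat \<Longrightarrow> \<bar>f x\<bar> \<le> B" "\<bar>c0\<bar> \<le> B"
  shows "((\<lambda>\<theta>. (\<integral>\<psi>. with_None c0 f (blowup_map U \<kappa> \<theta> \<psi>) \<partial>stat \<theta>)
      - (\<integral>\<psi>. with_None c0 (hat_mean f) (blowup_map U \<kappa> \<theta> \<psi>) \<partial>stat \<theta>)) \<longlongrightarrow> 0) (at_right 0)"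
proof (rule tendstoI)
  fix e :: real assume e: "e > 0"
  have B0: "B \<ge> 0" using B(2) by simp
  \<comment> \<open>Far mass at most \<open>?d\<close> contributes at most 2 B \<open>?d\<close>
    \<le> e/2, which together with the uniform error e/3 stays below e.\<close>
  let ?d = "e / (4 * (B + 1))"
  have d: "?d > 0" using e B0 by (intro divide_pos_pos) auto
  obtain R where R: "\<forall>\<^sub>F \<theta> in at_right 0. (\<integral>\<psi>. far \<theta> R \<psi> \<partial>stat \<theta>) \<le> ?d" using tight [OF d] by blast
  have e3: "e / 3 > 0" using e by simp
  have hf: "continuous_map Xhat euclidean (hat_mean f)" by (rule hat_mean_continuous [OF f])
  have hB: "\<bar>hat_mean f x\<bar> \<le> B" if "x \<in> topspace Xhat" for x
    using hat.branch_mean_bound [of x f B] hat.branch_mean_bound [of x "\<lambda>y. (-1) * f y + 0" B]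
      hat.branch_mean_affine [of x "-1" f 0] B(1) that by (force simp: abs_le_iff)
  have mc: "\<forall>\<^sub>F \<theta> in at_right 0. \<forall>\<psi>. near R (blowup_map U \<kappa> \<theta> \<psi>) \<longrightarrow>
    \<bar>chain_mean \<theta> (\<lambda>\<psi>. with_None c0 f (blowup_map U \<kappa> \<theta> \<psi>)) \<psi>
      - with_None c0 (hat_mean f) (blowup_map U \<kappa> \<theta> \<psi>)\<bar> \<le> e / 3"
    by (rule mean_converges [OF e3 f]) (use B in auto)
  show "\<forall>\<^sub>F \<theta> in at_right 0. dist ((\<integral>\<psi>. with_None c0 f (blowup_map U \<kappa> \<theta> \<psi>) \<partial>stat \<theta>)
      - (\<integral>\<psi>. with_None c0 (hat_mean f) (blowup_map U \<kappa> \<theta> \<psi>) \<partial>stat \<theta>)) 0 < e"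
    using eventually_unit R mc
  proof eventually_elim
    case (elim \<theta>)
    then have \<theta>: "0 < \<theta>" "\<theta> \<le> 1" by auto
    let ?f = "\<lambda>\<psi>. with_None c0 f (blowup_map U \<kappa> \<theta> \<psi>)"
    let ?h = "\<lambda>\<psi>. with_None c0 (hat_mean f) (blowup_map U \<kappa> \<theta> \<psi>)"
    have fm: "?f \<in> borel_measurable borel" by (rule with_None_measurable [OF f])
    have fB: "\<bar>?f \<psi>\<bar> \<le> B" for \<psi> by (rule with_None_bound [OF \<theta>(1) B(2,1)])
    note fpow = chain.funpow_branch_mean [OF stat [OF \<theta>] fm fB]
    have P: "chain_mean \<theta> ?f \<in> borel_measurable borel" "\<bar>chain_mean \<theta> ?f \<psi>\<bar> \<le> B"
      "(\<integral>\<psi>. chain_mean \<theta> ?f \<psi> \<partial>stat \<theta>) = (\<integral>\<psi>. ?f \<psi> \<partial>stat \<theta>)" for \<psi>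
      using fpow(1) [where n = 1] fpow(2) [where n = 1 and x = \<psi>] fpow(3) [where n = 1] by simp_all
    have Pi: "integrable (stat \<theta>) (chain_mean \<theta> ?f)"
      by (rule stat_integrable [OF \<theta> P(1,2)])
    have hi: "integrable (stat \<theta>) ?h" by (rule with_None_integrable [OF \<theta> hf B(2) hB])
    have "\<bar>(\<integral>\<psi>. ?f \<psi> \<partial>stat \<theta>) - (\<integral>\<psi>. ?h \<psi> \<partial>stat \<theta>)\<bar> = \<bar>\<integral>\<psi>. chain_mean \<theta> ?f \<psi> - ?h \<psi> \<partial>stat \<theta>\<bar>"
      by (simp add: P(3) Bochner_Integration.integral_diff [OF Pi hi])
    also have "\<dots> \<le> (\<integral>\<psi>. \<bar>chain_mean \<theta> ?f \<psi> - ?h \<psi>\<bar> \<partial>stat \<theta>)"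
      by (rule integral_abs_bound)
    also have "\<dots> \<le> (\<integral>\<psi>. e / 3 + 2 * B * far \<theta> R \<psi> \<partial>stat \<theta>)"
    proof (rule integral_mono)
      show "integrable (stat \<theta>) (\<lambda>\<psi>. \<bar>chain_mean \<theta> ?f \<psi> - ?h \<psi>\<bar>)"
        by (intro integrable_abs Bochner_Integration.integrable_diff Pi hi)
      show "integrable (stat \<theta>) (\<lambda>\<psi>. e / 3 + 2 * B * far \<theta> R \<psi>)"
        using \<theta> by (intro Bochner_Integration.integrable_add integrable_mult_right far_integrable
            stat_integrable [where B = "e / 3"]) (use e in auto)
      fix \<psi>
      show "\<bar>chain_mean \<theta> ?f \<psi> - ?h \<psi>\<bar> \<le> e / 3 + 2 * B * far \<theta> R \<psi>"
      proof (cases "near R (blowup_map U \<kappa> \<theta> \<psi>)")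
        case True
        then show ?thesis using elim(3) by (simp add: far_def)
      next
        case False
        have "\<bar>?h \<psi>\<bar> \<le> B" by (rule with_None_bound [OF \<theta>(1) B(2) hB])
        then show ?thesis using False P(2) [of \<psi>] e by (simp add: far_def abs_le_iff)
      qed
    qed
    also have "\<dots> = e / 3 + 2 * B * (\<integral>\<psi>. far \<theta> R \<psi> \<partial>stat \<theta>)"
      using \<theta> e by (subst Bochner_Integration.integral_add)
        (auto intro!: integrable_mult_right far_integrable stat_integrable [where B =
            "e / 3"] simp: stat_measure_space)
    also have "\<dots> \<le> e / 3 + 2 * B * ?d"
      using elim(2) B0 by (intro add_left_mono mult_left_mono) auto
    also have "2 * B * ?d \<le> e / 2" using e B0 by (simp add: field_simps)
    also have "e / 3 + e / 2 < e" using e by simp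
    finally show ?case by (simp add: dist_real_def)
  qed
qed

lemma hat_mean_funpow:
  assumes f: "continuous_map Xhat euclidean f" and B: "\<And>x. x \<in> topspace Xhat \<Longrightarrow>
      \<bar>f x\<bar> \<le> B"
  shows "continuous_map Xhat euclidean ((hat_mean ^^ k) f)"
    and "x \<in> topspace Xhat \<Longrightarrow> \<bar>(hat_mean ^^ k) f x\<bar> \<le> B"
proof -
  show "continuous_map Xhat euclidean ((hat_mean ^^ k) f)"
    by (induction k) (simp_all add: f hat_mean_continuous)
  assume x: "x \<in> topspace Xhat"
  then show "\<bar>(hat_mean ^^ k) f x\<bar> \<le> B"
    using hat.funpow_branch_mean_bounds(1) [where x = x and \<phi> = f and B = B and n = k]
      hat.funpow_branch_mean_bounds(2) [where x = x and \<phi> = f and B = "- B" and n = k] B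
    by (simp add: abs_le_iff minus_le_iff)
qed

lemma invariance_asymptotic_funpow:
  assumes f: "continuous_map Xhat euclidean f"
    and B: "\<And>x. x \<in> topspace Xhat \<Longrightarrow> \<bar>f x\<bar> \<le> B" "\<bar>c0\<bar> \<le> B"
  shows "((\<lambda>\<theta>. (\<integral>\<psi>. with_None c0 f (blowup_map U \<kappa> \<theta> \<psi>) \<partial>stat \<theta>)
      - (\<integral>\<psi>. with_None c0 ((hat_mean ^^ k) f) (blowup_map U \<kappa> \<theta> \<psi>) \<partial>stat \<theta>)) \<longlongrightarrow> 0) (at_right 0)"
proof (induction k)
  case (Suc k)
  let ?h = "(hat_mean ^^ k) f"
  have "((\<lambda>\<theta>. (\<integral>\<psi>. with_None c0 ?h (blowup_map U \<kappa> \<theta> \<psi>) \<partial>stat \<theta>)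
      - (\<integral>\<psi>. with_None c0 (hat_mean ?h) (blowup_map U \<kappa> \<theta> \<psi>) \<partial>stat \<theta>)) \<longlongrightarrow> 0) (at_right 0)"
    by (rule invariance_asymptotic [where B = B]) (use hat_mean_funpow [OF f] B in auto)
  from tendsto_add [OF Suc this] show ?case by simp
qed simp

end


section \<open>Regeneration of the affine tangent chain\<close>

context blowup_charts
begin

text \<open>A Doeblin lower bound: in n steps from (s, v) the tangent chain is at \<open>z v\<close>
  with probability at least c. Stating it through nonnegative functions lets such bounds be chained
  by iterating \<open>hat_mean\<close>.\<close>

definition minorized :: "nat \<Rightarrow> ('n, 'p) qray \<Rightarrow> real \<Rightarrow> (('n,
    'p) qvec \<Rightarrow> ('n, 'p) qray \<times> ('n, 'p) qvec) \<Rightarrow> bool" where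
  "minorized n s c z \<longleftrightarrow> (\<forall>v\<in>tangent (ket s). \<forall>\<phi>. (\<forall>y\<in>topspace Xhat. 0 \<le> \<phi> y) \<longrightarrow>
     c * \<phi> (z v) \<le> (hat_mean ^^ n) \<phi> (s, v))"

lemma minorizedD:
  "minorized n s c z \<Longrightarrow> v \<in> tangent (ket s) \<Longrightarrow>
      (\<And>y. y \<in> topspace Xhat \<Longrightarrow> 0 \<le> \<phi> y) \<Longrightarrow>
    c * \<phi> (z v) \<le> (hat_mean ^^ n) \<phi> (s, v)"
  by (simp add: minorized_def)

text \<open>Along a word of possible branches the affine maps compose to one whose linear part is
  the word operator, normalized by the amplitude \<open>l\<close> and projected once at the
  end.\<close>

lemma hat_mean_word:
  assumes "w \<in> lists branches" "s \<in> S" "word_apply a j0 0 w (ket s) \<noteq> 0"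
  shows "\<exists>t\<in>S. \<exists>l b. \<exists>c>0. l \<noteq> 0 \<and> b \<in> tangent (ket t) \<and> word_apply a j0 0 w (ket s) = l *s ket t \<and>
    minorized (length w) s c (\<lambda>v. (t, tan_proj (ket t) ((1 / l) *s word_apply a j0 0 w v) + b))"
  using assms
proof (induction w arbitrary: s)
  case Nil
  show ?case
    by (rule bexI [of _ s], rule exI [of _ 1], rule exI [of _ 0], rule exI [of _ 1])
      (use Nil in \<open>simp_all add: minorized_def tan_proj_tangent\<close>)
next
  case (Cons J w)
  have J: "J \<in> branches" and s: "s \<in> S" using Cons by auto
  have "branch_op a j0 J 0 *v ket s \<noteq> 0" using Cons.prems(2) by auto
  then have p: "branch_prob a j0 J 0 s > 0" by (simp add: branch_op_ket s J)
  let ?t1 = "branch_map a j0 J 0 s"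
  note h = hat_map_component [OF s J p]
  obtain c1 where c1: "c1 \<noteq> 0" "branch_op a j0 J 0 *v ket s = c1 *s ket ?t1"
    by (rule branch_op_ket_eq [OF s J p])
  have "word_apply a j0 0 w (ket ?t1) \<noteq> 0"
    using Cons.prems(2) by (auto simp: c1(2) word_apply_smult)
  from Cons.IH [OF h(1) this]
  obtain t l b c where t: "t \<in> S" and c: "c > 0" "l \<noteq> 0" "b \<in> tangent (ket t)"
    "word_apply a j0 0 w (ket ?t1) = l *s ket t"
    and min: "minorized (length w) ?t1 c (\<lambda>v. (t, tan_proj (ket t) ((1 / l) *s word_apply a j0 0 w v) + b))"
    by blast
  let ?W = "word_apply a j0 0 w"
  let ?b1 = "branch_shift U \<kappa> a j0 J s"
  define b' where "b' = tan_proj (ket t) ((1 / l) *s ?W ?b1) + b"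
  have W_tan: "tan_proj (ket t) ((1 / l) *s ?W (tan_proj (ket ?t1) z)) =
      tan_proj (ket t) ((1 / l) *s ?W z)" for z
  proof -
    have "?W (tan_proj (ket ?t1) z) = ?W z - (cinner (ket ?t1) z * l) *s ket t"
      unfolding tan_proj_def linear_diff [OF word_apply_linear] word_apply_smult c(4) by (simp add:
          vector_smult_assoc)
    then show ?thesis
      using t by (simp add: vector_ssub_ldistrib tan_proj_diff tan_proj_smult tan_proj_self norm_ket)
  qed
  have bw: "hat_weight J (s, v) > 0" for v using p by (simp add: hat_weight_pos)
  have hw: "hat_weight J (s, v) = hat_weight J (s, 0)" for v by (simp add: hat_weight_def)
  have "minorized (length (J # w)) s (hat_weight J (s, 0) * c)
      (\<lambda>v. (t, tan_proj (ket t) ((1 / (c1 * l)) *s word_apply a j0 0 (J # w) v) + b'))"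
    unfolding minorized_def
  proof (intro ballI allI impI)
    fix v and \<phi> :: "('n, 'p) qray \<times> ('n, 'p) qvec \<Rightarrow> real"
    assume v: "v \<in> tangent (ket s)" and \<phi>: "\<forall>y\<in>topspace Xhat. 0 \<le> \<phi> y"
    have sv: "(s, v) \<in> space (borel_of Xhat)" using s v by (simp add: topspace_Xhat)
    let ?v1 = "branch_linear ket U \<kappa> a j0 J s v + ?b1"
    have "tan_proj (ket t) ((1 / l) *s ?W ?v1) + b
        = tan_proj (ket t) ((1 / l) *s ?W (tan_proj (ket ?t1) ((1 / c1) *s (branch_op a j0 J 0 *v v))))
            + b'"
      unfolding branch_linear_eq [OF s J p c1] tan_proj_tangent [OF v] b'_def
      by (simp add: linear_add [OF word_apply_linear] vector_add_ldistrib tan_proj_add)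
    also have "\<dots> = tan_proj (ket t) ((1 / (c1 * l)) *s word_apply a j0 0 (J # w) v) + b'"
      unfolding W_tan by (simp add: word_apply_smult vector_smult_assoc mult.commute)
    finally have eq: "tan_proj (ket t) ((1 / l) *s ?W ?v1) + b
        = tan_proj (ket t) ((1 / (c1 * l)) *s word_apply a j0 0 (J # w) v) + b'" .
    have "hat_weight J (s, v) * (c * \<phi> (t, tan_proj (ket t) ((1 / l) *s ?W ?v1) + b))
        \<le> hat_weight J (s, v) * (hat_mean ^^ length w) \<phi> (hat_map J (s, v))"
      using minorizedD [OF min h(2) [OF v], of \<phi>] \<phi> bw [of v] by (simp add: hat_map_def)
    also have "\<dots> \<le> hat_mean ((hat_mean ^^ length w) \<phi>) (s, v)"
      by (rule hat.branch_mean_ge_branch [OF sv J], rule hat.funpow_branch_mean_bounds(2)) (use \<phi> in auto)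
    finally show "hat_weight J (s, 0) * c * \<phi> (t, tan_proj (ket t) ((1 / (c1 * l)) *s word_apply a j0 0
        (J # w) v) + b')
        \<le> (hat_mean ^^ length (J # w)) \<phi> (s, v)"
      by (simp add: eq hw [of v] mult.assoc)
  qed
  moreover have "0 < hat_weight J (s, 0) * c" using bw c(1) by simp
  moreover have "c1 * l \<noteq> 0" using c1(1) c(2) by simp
  moreover have "b' \<in> tangent (ket t)"
    unfolding b'_def by (intro tangent_add c tan_proj_in_tangent norm_ket t)
  moreover have "word_apply a j0 0 (J # w) (ket s) = (c1 * l) *s ket t"
    by (simp add: c1(2) word_apply_smult c(4) vector_smult_assoc)
  ultimately show ?case using t by blast
qed

text \<open>The operator of a basis word has rank one, so the affine maps along it have linear part zero.\<close>

lemma hat_mean_basis_word: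
  assumes V: "V \<in> clifford" and s: "s \<in> S" and x: "(dagger V *v ket s) $ x \<noteq> 0"
  shows "\<exists>b c. c > 0 \<and> (ray_of (V *v axis x 1), b) \<in> topspace Xhat \<and>
    minorized (length (SOME js. set js = (UNIV :: 'n set))) s c (\<lambda>v. (ray_of (V *v axis x 1), b))"
proof -
  let ?w = "basis_word j0 V x"
  have w: "word_apply a j0 0 ?w y = (dagger V *v y) $ x *s (V *v axis x 1)" for y
    by (simp add: basis_word_apply [OF V] matrix_vector_smult)
  have "norm (V *v axis x 1) = 1" using norm_unitary [OF clifford_unitary [OF V]] by (simp add: norm_axis_1)
  then have Vx: "V *v axis x 1 \<noteq> 0" by auto
  then have nz: "word_apply a j0 0 ?w (ket s) \<noteq> 0" unfolding w using x by simp
  obtain t l b c where t: "t \<in> S" and c: "c > 0" "l \<noteq> 0" "b \<in> tangent (ket t)"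
    "word_apply a j0 0 ?w (ket s) = l *s ket t"
    and min: "minorized (length ?w) s c (\<lambda>v. (t, tan_proj (ket t) ((1 / l) *s word_apply a j0 0 ?w v) + b))"
    using hat_mean_word [OF basis_word_branches [OF V] s nz] by blast
  let ?r = "(dagger V *v ket s) $ x"
  have Vt: "V *v axis x 1 = (l / ?r) *s ket t"
  proof -
    have "(1 / ?r) *s (?r *s (V *v axis x 1)) = (1 / ?r) *s (l *s ket t)" using c(4) w by metis
    then show ?thesis using x by (simp add: vector_smult_assoc)
  qed
  have "ray_of (V *v axis x 1) = ray_of (ket t)"
    unfolding Vt using x c(2) by (intro ray_of_smult) simp
  then have tt: "ray_of (V *v axis x 1) = t" using t by (simp add: ray_of_ket)
  \<comment> \<open>The word maps every vector to a multiple of \<open>V *v axis x 1\<close>, which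
    lies on the line of \<open>ket t\<close>.\<close>
  have "tan_proj (ket t) ((1 / l) *s word_apply a j0 0 ?w v) = 0" for v
    unfolding w Vt using t by (simp add: tan_proj_smult tan_proj_self norm_ket)
  with min have "minorized (length (SOME js. set js = (UNIV :: 'n set))) s c (\<lambda>v. (t, b))"
    by (simp add: length_basis_word)
  then show ?thesis
    using c t unfolding tt by (intro exI [of _ b] exI [of _ c]) (simp add: topspace_Xhat)
qed

lemma ket_ray_of_component:
  assumes "ray_of y \<in> S" "y \<noteq> 0" "(A *v y) $ x \<noteq> 0" shows "(A *v ket (ray_of y)) $ x \<noteq> 0"
proof -
  have "ray_of y = ray_of (ket (ray_of y))" using assms(1) by (simp add: ray_of_ket)
  then obtain c where "c \<noteq> 0" "ket (ray_of y) = c *s y"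
    by (rule ray_of_eqD [OF assms(2) ket_nonzero [OF assms(1)]])
  then show ?thesis using assms(3) by (simp add: matrix_vector_smult)
qed

text \<open>The first outcome must have nonzero amplitude at \<open>s\<close>, so the basis state
  reached depends on \<open>s\<close>. All of these overlap with the Fourier state, so the second
  word leads to the common state \<open>p\<close>, but with a tangent vector that may still depend
  on the way. The third word starts at \<open>p\<close> in every case and forgets this vector, so
  its end point (z0, b) is the same for all starts.\<close>

lemma hat_mean_regenerates:
  "\<exists>n z c. 0 < c \<and> z \<in> topspace Xhat \<and> (\<forall>y\<in>topspace Xhat. \<forall>\<phi>. (\<forall>y\<in>topspace Xhat. 0 \<le> \<phi> y) \<longrightarrow>
      (hat_mean ^^ n) \<phi> y \<ge> c * \<phi> z)"
proof -
  define N where "N = length (SOME js. set js = (UNIV :: 'n set))"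
  let ?F = "fourier_all :: ('n, 'p) qop"
  let ?o = "\<lambda>_ :: 'n. 0 :: 'p mod_ring"
  define p where "p = ray_of (?F *v axis ?o 1)"
  define z0 where "z0 = ray_of (mat 1 *v axis ?o 1 :: ('n, 'p) qvec)"
  have Fx: "?F *v axis ?o 1 \<noteq> 0" using fourier_all_component(1) by (metis zero_index)
  have pS: "p \<in> S" unfolding p_def by (rule rotated_basis_stabilizer [OF fourier_all_clifford])
  \<comment> \<open>The last word is chosen before \<open>s\<close>, which makes \<open>b\<close>
    independent of \<open>s\<close>.\<close>
  have "(dagger (mat 1) *v ket p) $ ?o \<noteq> 0"
    unfolding p_def
    by (rule ket_ray_of_component) (use pS Fx fourier_all_component(1) in \<open>simp_all add: p_def dagger_mat\<close>)
  from hat_mean_basis_word [OF clifford_one pS this]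
  obtain b c where c: "c > 0" "(z0, b) \<in> topspace Xhat"
    and last: "minorized N p c (\<lambda>v. (z0, b))"
    unfolding N_def z0_def by blast
  have "\<exists>e>0. minorized (N + (N + N)) s e (\<lambda>v. (z0, b))" if s: "s \<in> S" for s
  proof -
    obtain x where x: "(dagger (mat 1) *v ket s) $ x \<noteq> 0"
      using ket_nonzero [OF s] by (auto simp: vec_eq_iff dagger_mat)
    let ?t = "ray_of (mat 1 *v axis x 1 :: ('n, 'p) qvec)"
    from hat_mean_basis_word [OF clifford_one s x]
    obtain b1 c1 where c1: "c1 > 0" "(?t, b1) \<in> topspace Xhat"
      and first: "minorized N s c1 (\<lambda>v. (?t, b1))"
      unfolding N_def by blast
    have t: "?t \<in> S" by (rule rotated_basis_stabilizer [OF clifford_one])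
    have "(dagger ?F *v ket ?t) $ ?o \<noteq> 0"
      by (rule ket_ray_of_component) (use t fourier_all_component(2) in simp_all)
    from hat_mean_basis_word [OF fourier_all_clifford t this]
    obtain b2 c2 where c2: "c2 > 0" "(p, b2) \<in> topspace Xhat"
      and second: "minorized N ?t c2 (\<lambda>v. (p, b2))"
      unfolding N_def p_def by blast
    have "(hat_mean ^^ (N + (N + N))) \<phi> (s, v) \<ge> c1 * c2 * c * \<phi> (z0, b)"
      if v: "v \<in> tangent (ket s)" and \<phi>: "\<And>y. y \<in> topspace Xhat \<Longrightarrow> 0 \<le> \<phi> y" for v \<phi>
    proof -
      have nonneg: "0 \<le> (hat_mean ^^ k) \<phi> y" if "y \<in> topspace Xhat" for k y
        by (rule hat.funpow_branch_mean_bounds(2)) (use that \<phi> in auto)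
      have "c1 * c2 * c * \<phi> (z0, b) = c1 * (c2 * (c * \<phi> (z0, b)))" by simp
      also have "\<dots> \<le> c1 * (c2 * (hat_mean ^^ N) \<phi> (p, b2))"
        using c1(1) c2 by (intro mult_left_mono minorizedD [OF last] \<phi>) (auto simp: topspace_Xhat)
      also have "\<dots> \<le> c1 * (hat_mean ^^ N) ((hat_mean ^^ N) \<phi>) (?t, b1)"
        using c1 by (intro mult_left_mono minorizedD [OF second] nonneg) (auto simp: topspace_Xhat)
      also have "\<dots> \<le> (hat_mean ^^ N) ((hat_mean ^^ N) ((hat_mean ^^ N) \<phi>)) (s, v)"
        using nonneg [of _ "N + N"] by (intro minorizedD [OF first] v) (simp add: funpow_add)
      finally show ?thesis by (simp add: funpow_add)
    qed
    then show ?thesis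
      using c1 c2 c by (intro exI [of _ "c1 * c2 * c"]) (simp add: minorized_def)
  qed
  then obtain e where e: "\<And>s. s \<in> S \<Longrightarrow> e s > 0"
    "\<And>s. s \<in> S \<Longrightarrow> minorized (N + (N + N)) s (e s) (\<lambda>v. (z0, b))" by metis
  define m where "m = Min (e ` S)"
  have ne: "e ` S \<noteq> {}" "finite (e ` S)" using pS finite_S by auto
  show ?thesis
  proof (intro exI [of _ "N + (N + N)"] exI [of _ "(z0, b)"] exI [of _ m] conjI ballI allI impI)
    show "0 < m" using Min_in [OF ne(2,1)] e(1) unfolding m_def by auto
    show "(z0, b) \<in> topspace Xhat" by (rule c(2))
    fix y and \<phi> :: "('n, 'p) qray \<times> ('n, 'p) qvec \<Rightarrow> real"
    assume y: "y \<in> topspace Xhat" and \<phi>: "\<forall>y\<in>topspace Xhat. 0 \<le> \<phi> y"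
    obtain s v where sv: "y = (s, v)" "s \<in> S" "v \<in> tangent (ket s)" using y by (auto simp: topspace_Xhat)
    have "m * \<phi> (z0, b) \<le> e s * \<phi> (z0, b)"
      unfolding m_def using \<phi> c(2) sv(2) ne by (intro mult_right_mono Min_le) auto
    also have "\<dots> \<le> (hat_mean ^^ (N + (N + N))) \<phi> y" unfolding sv(1) 
      by (rule minorizedD [OF e(2) [OF sv(2)] sv(3)]) (use \<phi> in blast)
    finally show "m * \<phi> (z0, b) \<le> (hat_mean ^^ (N + (N + N))) \<phi> y" .
  qed
qed

text \<open>Doeblin contraction: the common point \<open>z\<close> receives weight c from
  everywhere, so every n steps shrink the range of values by the factor 1 - c.\<close>

lemma hat_mean_oscillation:
  assumes B: "\<And>x. x \<in> topspace Xhat \<Longrightarrow> \<bar>f x\<bar> \<le> B" and e: "e > 0"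
  shows "\<exists>k m. \<bar>m\<bar> \<le> B \<and> (\<forall>x\<in>topspace Xhat. \<bar>(hat_mean ^^ k) f x - m\<bar> \<le> e)"
proof -
  obtain n z c where c: "0 < c" and z: "z \<in> topspace Xhat"
    and reg: "\<And>y \<phi>. y \<in> topspace Xhat \<Longrightarrow>
        (\<forall>y\<in>topspace Xhat. 0 \<le> \<phi> y) \<Longrightarrow> (hat_mean ^^ n) \<phi> y \<ge> c * \<phi> z"
    using hat_mean_regenerates by blast
  \<comment> \<open>Testing the minorization on the constant 1.\<close>
  have c1: "c \<le> 1"
    using reg [OF z, of "\<lambda>_. 1"] hat.funpow_branch_mean_const [where x = z and n = n and d = 1] z by simp
  have osc: "\<exists>m M. M - m \<le> (1 - c) ^ j * (2 * B) \<and> (\<forall>x\<in>topspace Xhat. m \<le> (hat_mean ^^ (n * j)) f x \<and>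
      (hat_mean ^^ (n * j)) f x \<le> M)" for j
  proof (induction j)
    case 0
    show ?case using B by (intro exI [of _ "- B"] exI [of _ B]) (auto simp: abs_le_iff minus_le_iff)
  next
    case (Suc j)
    let ?g = "(hat_mean ^^ (n * j)) f"
    obtain m M where mM: "M - m \<le> (1 - c) ^ j * (2 * B)" "\<And>x. x \<in> topspace Xhat \<Longrightarrow>
        m \<le> ?g x \<and> ?g x \<le> M"
      using Suc by blast
    have "m + c * (?g z - m) \<le> (hat_mean ^^ n) ?g x \<and> (hat_mean ^^ n) ?g x \<le> M - c * (M - ?g z)"
      if x: "x \<in> topspace Xhat" for x
    proof -
      have xs: "x \<in> space (borel_of Xhat)" using x by simp
      \<comment> \<open>Minorization of the nonnegative functions \<open>?g - m\<close> and then
        \<open>M - ?g\<close> raises the lower and lowers the upper bound.\<close>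
      have "c * (1 * ?g z + - m) \<le> (hat_mean ^^ n) (\<lambda>y. 1 * ?g y + - m) x"
        using mM(2) by (intro reg x) fastforce
      moreover have "c * ((-1) * ?g z + M) \<le> (hat_mean ^^ n) (\<lambda>y. (-1) * ?g y + M) x"
        using mM(2) by (intro reg x) fastforce
      ultimately show ?thesis
        unfolding hat.funpow_branch_mean_affine [OF xs] by (simp add: algebra_simps)
    qed
    moreover have "(M - c * (M - ?g z)) - (m + c * (?g z - m)) \<le> (1 - c) ^ Suc j * (2 * B)"
    proof -
      have "(M - c * (M - ?g z)) - (m + c * (?g z - m)) = (1 - c) * (M - m)" by (simp add: algebra_simps)
      also have "\<dots> \<le> (1 - c) * ((1 - c) ^ j * (2 * B))" using mM(1) c1 by (intro mult_left_mono) auto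
      finally show ?thesis by simp
    qed
    ultimately show ?case unfolding mult_Suc_right funpow_add comp_def by blast
  qed
  have "(\<lambda>j. (1 - c) ^ j * (2 * B)) \<longlonglongrightarrow> 0 * (2 * B)"
    using c c1 by (intro tendsto_mult LIMSEQ_power_zero tendsto_const) auto
  then have "\<forall>\<^sub>F j in sequentially. (1 - c) ^ j * (2 * B) < e" using e by (intro order_tendstoD) auto
  then obtain j where j: "(1 - c) ^ j * (2 * B) < e" unfolding eventually_sequentially by blast
  obtain m M where mM: "M - m \<le> (1 - c) ^ j * (2 * B)"
    "\<And>x. x \<in> topspace Xhat \<Longrightarrow> m \<le> (hat_mean ^^ (n * j)) f x \<and>
        (hat_mean ^^ (n * j)) f x \<le> M"
    using osc by blast
  let ?m = "(hat_mean ^^ (n * j)) f z"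
  show ?thesis
  proof (intro exI [of _ "n * j"] exI [of _ ?m] conjI ballI)
    show "\<bar>?m\<bar> \<le> B"
      using hat.funpow_branch_mean_bounds(1) [where x = z and \<phi> = f and B = B and n = "n * j"]
        hat.funpow_branch_mean_bounds(2) [where x = z and \<phi> = f and B = "- B" and n = "n * j"] B z
      by (simp add: abs_le_iff minus_le_iff)
    fix x assume "x \<in> topspace Xhat"
    then show "\<bar>(hat_mean ^^ (n * j)) f x - ?m\<bar> \<le> e"
      using mM(2) [of x] mM(2) [OF z] mM(1) j by (simp add: abs_le_iff)
  qed
qed

end


section \<open>Identification of the limit\<close>

context blowup_chain
begin

text \<open>Both integrals are compared with one constant \<open>m\<close> that approximates the
  k-step average of \<open>f\<close> uniformly: the limit law is exactly invariant, the blown-up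
  laws are asymptotically invariant and tight.\<close>

lemma blown_up_integral_tendsto:
  assumes tstat: "invariant_prob (borel_of Xhat) (tangent_kernel ket U \<kappa> a j0) \<mu>"
    and f: "continuous_map Xhat euclidean f"
    and B: "\<And>x. x \<in> topspace Xhat \<Longrightarrow> \<bar>f x\<bar> \<le> B" "\<bar>c0\<bar> \<le> B"
  shows "((\<lambda>\<theta>. \<integral>\<psi>. with_None c0 f (blowup_map U \<kappa> \<theta> \<psi>) \<partial>stat \<theta>) \<longlongrightarrow> (\<integral>x. f x \<partial>\<mu>)) (at_right 0)"
proof (rule tendstoI)
  fix e :: real assume e: "e > 0"
  have B0: "B \<ge> 0" using B(2) by simp
  interpret \<mu>: prob_space \<mu> using tstat by (simp add: invariant_prob_def)
  have s\<mu>: "sets \<mu> = sets (borel_of Xhat)" using tstat by (simp add: invariant_prob_def)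
  have sp\<mu>: "space \<mu> = topspace Xhat" using sets_eq_imp_space_eq [OF s\<mu>] by simp
  have e5: "e / 5 > 0" using e by simp
  obtain k m where m: "\<bar>m\<bar> \<le> B" and osc: "\<And>x. x \<in> topspace Xhat \<Longrightarrow>
      \<bar>(hat_mean ^^ k) f x - m\<bar> \<le> e / 5"
    using hat_mean_oscillation [of f B "e / 5", OF B(1) e5] by blast
  let ?g = "(hat_mean ^^ k) f"
  have fm: "f \<in> borel_measurable (borel_of Xhat)" by (rule continuous_map_borel_measurable [OF f])
  have gc: "continuous_map Xhat euclidean ?g" by (rule hat_mean_funpow(1) [OF f B(1)])
  have gB: "\<bar>?g x\<bar> \<le> B" if "x \<in> topspace Xhat" for x
    using hat_mean_funpow(2) [OF f B(1)] that by auto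
  have gi: "integrable \<mu> ?g"
  proof (rule \<mu>.integrable_const_bound)
    show "?g \<in> borel_measurable \<mu>"
      using continuous_map_borel_measurable [OF gc] measurable_cong_sets [OF s\<mu> refl] by blast
    show "AE x in \<mu>. norm (?g x) \<le> B" by (rule AE_I2) (simp add: gB sp\<mu>)
  qed
  have "(\<integral>x. f x \<partial>\<mu>) = (\<integral>x. ?g x \<partial>\<mu>)"
    using hat.funpow_branch_mean(3) [OF tstat fm, where B = B and n = k] B(1) by simp
  then have "(\<integral>x. f x \<partial>\<mu>) - m = (\<integral>x. ?g x - m \<partial>\<mu>)"
    using gi by (simp add: \<mu>.prob_space)
  also have "\<bar>\<dots>\<bar> \<le> (\<integral>x. \<bar>?g x - m\<bar> \<partial>\<mu>)" by (rule integral_abs_bound)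
  also have "\<dots> \<le> (\<integral>x. e / 5 \<partial>\<mu>)"
    by (rule integral_mono) (use gi osc sp\<mu> in auto)
  finally have lim: "\<bar>(\<integral>x. f x \<partial>\<mu>) - m\<bar> \<le> e / 5" by (simp add: \<mu>.prob_space)
  \<comment> \<open>Makes the far contribution 2 B \<open>?d\<close> at most e/5. The errors are
    then e/5 for the limit law, 2e/5 for the blown-up average and e/5 for asymptotic
    invariance.\<close>
  let ?d = "e / (10 * (B + 1))"
  have d: "?d > 0" using e B0 by (intro divide_pos_pos) auto
  obtain R where R: "\<forall>\<^sub>F \<theta> in at_right 0. (\<integral>\<psi>. far \<theta> R \<psi> \<partial>stat \<theta>) \<le> ?d" using tight [OF d] by blast
  have inv: "\<forall>\<^sub>F \<theta> in at_right 0. dist ((\<integral>\<psi>. with_None c0 f (blowup_map U \<kappa> \<theta> \<psi>) \<partial>stat \<theta>)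
      - (\<integral>\<psi>. with_None c0 ?g (blowup_map U \<kappa> \<theta> \<psi>) \<partial>stat \<theta>)) 0 < e / 5"
    using e5 by (intro tendstoD [OF invariance_asymptotic_funpow [OF f, where B = B]]) (use B in auto)
  show "\<forall>\<^sub>F \<theta> in at_right 0. dist (\<integral>\<psi>. with_None c0 f (blowup_map U \<kappa> \<theta> \<psi>) \<partial>stat \<theta>) (\<integral>x. f x \<partial>\<mu>) < e"
    using eventually_unit R inv
  proof eventually_elim
    case (elim \<theta>)
    then have \<theta>: "0 < \<theta>" "\<theta> \<le> 1" by auto
    let ?h = "\<lambda>\<psi>. with_None c0 ?g (blowup_map U \<kappa> \<theta> \<psi>)"
    have hi: "integrable (stat \<theta>) ?h" by (rule with_None_integrable [OF \<theta> gc B(2) gB])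
    have "(\<integral>\<psi>. ?h \<psi> \<partial>stat \<theta>) - m = (\<integral>\<psi>. ?h \<psi> - m \<partial>stat \<theta>)"
    proof -
      have "integrable (stat \<theta>) (\<lambda>_. m)" by (rule stat_integrable [OF \<theta>, of _ "\<bar>m\<bar>"]) auto
      then show ?thesis using hi \<theta> by (simp add: stat_measure_space)
    qed
    also have "\<bar>\<dots>\<bar> \<le> (\<integral>\<psi>. \<bar>?h \<psi> - m\<bar> \<partial>stat \<theta>)" by (rule integral_abs_bound)
    also have "\<dots> \<le> (\<integral>\<psi>. e / 5 + 2 * B * far \<theta> R \<psi> \<partial>stat \<theta>)"
    proof (rule integral_mono)
      show "integrable (stat \<theta>) (\<lambda>\<psi>. \<bar>?h \<psi> - m\<bar>)"
        by (intro integrable_abs Bochner_Integration.integrable_diff hi stat_integrable [OF \<theta>,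
            of _ "\<bar>m\<bar>"]) auto
      show "integrable (stat \<theta>) (\<lambda>\<psi>. e / 5 + 2 * B * far \<theta> R \<psi>)"
        using \<theta> by (intro Bochner_Integration.integrable_add integrable_mult_right far_integrable
            stat_integrable [where B = "e / 5"]) (use e in auto)
      fix \<psi>
      show "\<bar>?h \<psi> - m\<bar> \<le> e / 5 + 2 * B * far \<theta> R \<psi>"
      proof (cases "near R (blowup_map U \<kappa> \<theta> \<psi>)")
        case True
        then obtain s v where "blowup_map U \<kappa> \<theta> \<psi> = Some (s, v)" "s \<in> S" "v \<in> tangent (ket s)"
          by (rule near_obtain [OF _ \<theta>(1)])
        then show ?thesis using osc [of "(s, v)"] True by (simp add: far_def topspace_Xhat)
      next
        case False
        have "\<bar>?h \<psi>\<bar> \<le> B" by (rule with_None_bound [OF \<theta>(1) B(2) gB])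
        then show ?thesis using False m e by (simp add: far_def)
      qed
    qed
    also have "\<dots> = e / 5 + 2 * B * (\<integral>\<psi>. far \<theta> R \<psi> \<partial>stat \<theta>)"
      using \<theta> e by (subst Bochner_Integration.integral_add)
        (auto intro!: integrable_mult_right far_integrable stat_integrable [where B =
            "e / 5"] simp: stat_measure_space)
    also have "\<dots> \<le> e / 5 + 2 * B * ?d"
      using elim(2) B0 by (intro add_left_mono mult_left_mono) auto
    also have "\<dots> \<le> e / 5 + e / 5" using e B0 by (intro add_left_mono) (simp add: field_simps)
    finally have "\<bar>(\<integral>\<psi>. ?h \<psi> \<partial>stat \<theta>) - m\<bar> \<le> e / 5 + e / 5" .
    then have "\<bar>(\<integral>\<psi>. with_None c0 f (blowup_map U \<kappa> \<theta> \<psi>) \<partial>stat \<theta>) - (\<integral>x. f x \<partial>\<mu>)\<bar> < e"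
      using elim(3) lim e unfolding dist_real_def by linarith
    then show ?case by (simp only: dist_real_def)
  qed
qed

end

section \<open>Finiteness of the Clifford group and stability of the stabilizer states under
  branches\<close>

lemma emeasure_distr_le: "emeasure (distr M N f) A \<le> emeasure M (f -` A \<inter> space M)"
  \<comment> \<open>For a non-measurable \<open>f\<close> the left side may degenerate to 0, so the
    bound persists although equality may fail.\<close>
  unfolding distr_def emeasure_measure_of_conv by simp

text \<open>For an infinite group, \<^const>\<open>card\<close> is 0 and the weights \<open>x / 0\<close> make the kernel the zero measure,
  which has no invariant probability measure.\<close>

lemma finite_proj_clifford:
  fixes a :: "'p::prime_card mod_ring" and j0 :: "'n::finite"
  assumes "invariant_prob borel (chain_kernel a j0 \<theta>) \<mu>"
  shows "finite (proj_clifford :: ('n, 'p) qop set set)"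
proof (rule ccontr)
  assume inf: "infinite (proj_clifford :: ('n, 'p) qop set set)"
  interpret prob_space \<mu> using assms by (simp add: invariant_prob_def)
  have "emeasure (chain_kernel a j0 \<theta> \<psi>) UNIV = 0" for \<psi> :: "('n, 'p) qray"
  proof -
    have "emeasure (chain_kernel a j0 \<theta> \<psi>) UNIV
        \<le> emeasure (branch_law a j0 \<theta> \<psi>) ((\<lambda>J. branch_map a j0 J \<theta> \<psi>) -` UNIV \<inter> space (branch_law a j0 \<theta>
            \<psi>))"
      unfolding chain_kernel_def by (rule emeasure_distr_le)
    also have "\<dots> = 0"
      using inf by (simp add: branch_law_def point_measure_def emeasure_density)
    finally show ?thesis by simp
  qed
  then have "emeasure \<mu> UNIV = 0"
    using assms by (simp add: invariant_prob_def)
  moreover have "space \<mu> = UNIV"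
    using assms sets_eq_imp_space_eq [of \<mu> borel] by (simp add: invariant_prob_def)
  ultimately show False using emeasure_space_1 by simp
qed

text \<open>\<open>T\<close> is absorbed into the Clifford part of the label. This is the symmetry
  that transports statements about branches from one stabilizer state to another.\<close>

lemma branch_op_conjugate:
  assumes g: "g \<in> proj_clifford" and T: "T \<in> clifford"
  obtains g' where "g' \<in> proj_clifford" "branch_op a j0 (g, m) 0 ** T = T ** branch_op a j0 (g', m) 0"
proof
  let ?W = "unitary_rep g"
  have W: "?W ** T \<in> clifford" using g T by (intro clifford_mult unitary_rep_clifford)
  then show "pclass (?W ** T) \<in> proj_clifford" by (simp add: clifford_def)
  have "branch_op a j0 (g, m) 0 = dagger ?W ** meas_op j0 m ** ?W"
    by (simp add: branch_op_def R_gate_zero on_qudit_one)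
  moreover have "T ** branch_op a j0 (pclass (?W ** T), m) 0
      = (T ** dagger T) ** dagger ?W ** meas_op j0 m ** ?W ** T"
    by (simp only: branch_op_pclass [OF W] dagger_mult matrix_mul_assoc)
  ultimately show "branch_op a j0 (g, m) 0 ** T = T ** branch_op a j0 (pclass (?W ** T), m) 0"
    using clifford_unitary [OF T] by (simp add: unitary_def)
qed

text \<open>The invariant probability measure has mass one, so from almost every stabilizer state all branches
  lead to stabilizer states. The Clifford group acts transitively on these states and permutes the branches,
  hence the same holds from every stabilizer state.\<close>

lemma branch_map_stabilizer_states:
  fixes ket :: "('n::finite, 'p::prime_card) qray \<Rightarrow> ('n, 'p) qvec"
  assumes fin: "finite (proj_clifford :: ('n, 'p) qop set set)"
    and inv: "invariant_prob (borel_of (blowup_space ket)) (tangent_kernel ket U \<kappa> a j0) \<mu>"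
    and s: "s \<in> stabilizer_states" and J: "J \<in> branches" and p: "branch_prob a j0 J 0 s > 0"
  shows "branch_map a j0 J 0 s \<in> stabilizer_states"
proof -
  let ?S = "stabilizer_states :: ('n, 'p) qray set"
  let ?X = "blowup_space ket" and ?P = "tangent_kernel ket U \<kappa> a j0"
  let ?c = "real (card (proj_clifford :: ('n, 'p) qop set set))"
  interpret prob_space \<mu> using inv by (simp add: invariant_prob_def)
  have sp: "space \<mu> = topspace ?X"
    using inv sets_eq_imp_space_eq [of \<mu> "borel_of ?X"] by (simp add: invariant_prob_def)
  have top: "topspace ?X = Sigma ?S (\<lambda>s. tangent (ket s))" by (simp add: blowup_space_def comp_def)
  have finS: "finite ?S" unfolding stabilizer_states_def using fin by simp
  have finB: "finite (branches :: ('n, 'p) branch set)" using fin by simp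
  have c: "?c > 0" using fin subgroup.one_closed [OF proj_clifford_subgroup] card_gt_0_iff
    by (metis empty_iff of_nat_0_less_iff)
  \<comment> \<open>The total weight of branches at \<open>s\<close> whose images are stabilizer
    states, an upper bound for the mass that the tangent kernel keeps in the blow-up space.\<close>
  define good where "good s = (\<Sum>J\<in>{J \<in> branches. branch_map a j0 J 0 s \<in> ?S}. branch_prob a j0 J 0
      s / ?c)" for s
  have le_good: "emeasure (?P x) (topspace ?X) \<le> ennreal (good (fst x))" for x
  proof -
    obtain s v where x: "x = (s, v)" by (cases x)
    let ?f = "\<lambda>J. (branch_map a j0 J 0 s, branch_linear ket U \<kappa> a j0 J s v + branch_shift U \<kappa> a j0 J s)"
    let ?A = "?f -` topspace ?X \<inter> positive_branches a j0 0 s"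
    have sub: "?A \<subseteq> {J \<in> branches. branch_map a j0 J 0 s \<in> ?S}"
      by (auto simp: top positive_branches_def)
    have "emeasure (?P x) (topspace ?X) \<le> emeasure (branch_law a j0 0 s) ?A"
      using emeasure_distr_le [of "branch_law a j0 0 s" "borel_of ?X" ?f "topspace ?X"]
      by (simp add: x tangent_kernel_def branch_law_def space_point_measure)
    also have "\<dots> = (\<Sum>J\<in>?A. ennreal (branch_prob a j0 J 0 s / ?c))"
      unfolding branch_law_def
      by (rule emeasure_point_measure_finite) (use finB in \<open>auto simp: positive_branches_def\<close>)
    also have "\<dots> = ennreal (\<Sum>J\<in>?A. branch_prob a j0 J 0 s / ?c)"
      by (rule sum_ennreal) (simp add: branch_prob_def)
    also have "\<dots> \<le> ennreal (good s)"
      unfolding good_def using finB by (intro ennreal_leI sum_mono2 sub) (auto simp: branch_prob_def)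
    finally show ?thesis by (simp add: x)
  qed
  \<comment> \<open>If every stabilizer state lost mass, finiteness would give a common bound m < 1
    on the mass of the kernel, and an invariant measure could not have mass 1.\<close>
  have "\<exists>s0\<in>?S. good s0 \<ge> 1"
  proof (rule ccontr)
    assume "\<not> (\<exists>s0\<in>?S. good s0 \<ge> 1)"
    then have lt: "good s0 < 1" if "s0 \<in> ?S" for s0 using that by force
    define m where "m = Max (insert 0 (good ` ?S))"
    have "m < 1" unfolding m_def using lt finS by (subst Max_less_iff) auto
    have "emeasure \<mu> (topspace ?X) = (\<integral>\<^sup>+x. emeasure (?P x) (topspace ?X) \<partial>\<mu>)"
      using inv sets.top [of "borel_of ?X"] by (simp add: invariant_prob_def)
    also have "\<dots> \<le> (\<integral>\<^sup>+x. ennreal m \<partial>\<mu>)"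
    proof (rule nn_integral_mono)
      fix x assume "x \<in> space \<mu>"
      then have "good (fst x) \<le> m" unfolding m_def using finS by (intro Max_ge) (auto simp: sp top)
      then show "emeasure (?P x) (topspace ?X) \<le> ennreal m"
        using le_good [of x] ennreal_leI order_trans by blast
    qed
    also have "\<dots> = ennreal m" by (simp add: emeasure_space_1)
    finally have "1 \<le> ennreal m" using emeasure_space_1 by (simp add: sp)
    then show False using \<open>m < 1\<close> by (simp add: ennreal_ge_1)
  qed
  then obtain s0 where s0: "s0 \<in> ?S" "good s0 \<ge> 1" by blast
  \<comment> \<open>All weights at \<open>s0\<close> add up to 1, and the good ones already do, so
    no possible branch is bad.\<close>
  have good0: "branch_map a j0 J 0 s0 \<in> ?S" if J: "J \<in> branches" and pos: "branch_prob a j0 J 0 s0 > 0"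
      for J
  proof (rule ccontr)
    assume bad: "branch_map a j0 J 0 s0 \<notin> ?S"
    have "good s0 + branch_prob a j0 J 0 s0 / ?c
        = (\<Sum>J\<in>insert J {J \<in> branches. branch_map a j0 J 0 s0 \<in> ?S}. branch_prob a j0 J 0 s0 / ?c)"
      unfolding good_def using bad finB by (subst sum.insert) auto
    also have "\<dots> \<le> (\<Sum>J\<in>branches. branch_prob a j0 J 0 s0 / ?c)"
      using finB J by (intro sum_mono2) (auto simp: branch_prob_def)
    also have "\<dots> = 1" using branch_prob_sum [OF fin, of a j0 0 s0] c by (simp flip: sum_divide_distrib)
    finally have "good s0 + branch_prob a j0 J 0 s0 / ?c \<le> 1" .
    moreover have "0 < branch_prob a j0 J 0 s0 / ?c" using pos c by (rule divide_pos_pos)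
    ultimately show False using s0(2) by linarith
  qed
  let ?e = "axis (\<lambda>_. 0) 1 :: ('n, 'p) qvec"
  obtain V0 V :: "('n, 'p) qop" where V: "V0 \<in> clifford" "s0 = ray_of (V0 *v ?e)" "V \<in> clifford" "s =
      ray_of (V *v ?e)"
    using s0(1) s unfolding stabilizer_states_eq by blast
  \<comment> \<open>The Clifford matrix that carries the representative of \<open>s0\<close> to that
    of \<open>s\<close>.\<close>
  define T where "T = V ** dagger V0"
  have T: "T \<in> clifford" unfolding T_def by (intro clifford_mult clifford_dagger V)
  let ?x = "V0 *v ?e"
  have Tx: "T *v ?x = V *v ?e"
    by (simp only: T_def matrix_vector_mul_assoc [symmetric] dagger_unitary_mult_vec(1) [OF
        clifford_unitary [OF V(1)]])
  have x0: "?x \<noteq> 0" using norm_unitary [OF clifford_unitary [OF V(1)], of ?e] by auto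
  have Tx0: "T *v ?x \<noteq> 0" using norm_unitary [OF clifford_unitary [OF T], of ?x] x0 by auto
  obtain g m where gm: "J = (g, m)" "g \<in> proj_clifford" using J by auto
  obtain g' where g': "g' \<in> proj_clifford" "branch_op a j0 (g, m) 0 ** T = T ** branch_op a j0 (g', m) 0"
    by (rule branch_op_conjugate [OF gm(2) T])
  let ?J' = "(g', m)"
  have J': "?J' \<in> branches" using g'(1) by simp
  have eq: "branch_op a j0 J 0 *v (T *v ?x) = T *v (branch_op a j0 ?J' 0 *v ?x)"
  proof -
    have "branch_op a j0 J 0 *v (T *v ?x) = (T ** branch_op a j0 ?J' 0) *v ?x"
      unfolding gm(1) matrix_vector_mul_assoc [of _ T] g'(2) ..
    then show ?thesis by (simp only: matrix_vector_mul_assoc [of T])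
  qed
  have nz: "branch_op a j0 ?J' 0 *v ?x \<noteq> 0"
    using p branch_prob_ray_of [OF Tx0 J, of a j0 0] unfolding V(4) Tx [symmetric] eq by auto
  then have "branch_prob a j0 ?J' 0 s0 > 0" unfolding V(2) branch_prob_ray_of [OF x0 J'] using x0 by simp
  from good0 [OF J' this] have "ray_of (branch_op a j0 ?J' 0 *v ?x) \<in> ?S"
    unfolding V(2) branch_map_ray_of [OF x0] .
  from ray_of_clifford_mult [OF T nz this]
  show ?thesis unfolding V(4) Tx [symmetric] branch_map_ray_of [OF Tx0] eq .
qed

section \<open>Measures on the space with an added isolated point\<close>

lemma Some_measurable_borel_of: "Some \<in> borel_of X \<rightarrow>\<^sub>M borel_of (add_isolated X)"
proof (rule measurable_borel_ofI)
  fix W assume "openin (add_isolated X) W"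
  then have "openin X (Some -` W)" by (simp add: openin_add_isolated)
  moreover have "{x \<in> space (borel_of X). Some x \<in> W} = Some -` W"
    using openin_subset [OF calculation] by auto
  ultimately show "{x \<in> space (borel_of X). Some x \<in> W} \<in> sets (borel_of X)"
    by (simp add: openin_sets_borel_of)
qed (auto simp: topspace_add_isolated)

lemma restrict_extend_isolated:
  assumes "sets \<mu> = sets (borel_of X)"
  shows "restrict_isolated X (extend_isolated X \<mu>) = \<mu>"
proof (rule measure_eqI)
  show "sets (restrict_isolated X (extend_isolated X \<mu>)) = sets \<mu>"
    by (simp add: restrict_isolated_def assms)
  let ?Y = "add_isolated X"
  have sp: "space \<mu> = topspace X" using sets_eq_imp_space_eq [OF assms] by simp
  have op: "openin ?Y (Some ` W)" if "openin X W" for W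
    using that by (simp add: openin_add_isolated inj_vimage_image_eq)
  have E: "Some ` topspace X \<in> sets (extend_isolated X \<mu>)"
    by (simp add: extend_isolated_def openin_sets_borel_of op)
  have spE: "space (extend_isolated X \<mu>) = topspace ?Y" by (simp add: extend_isolated_def)
  have spR: "space (restrict_space (extend_isolated X \<mu>) (Some ` topspace X)) = Some ` topspace X"
    by (auto simp: space_restrict_space spE topspace_add_isolated)
  have the: "the \<in> restrict_space (extend_isolated X \<mu>) (Some ` topspace X) \<rightarrow>\<^sub>M borel_of X"
  proof (rule measurable_borel_ofI)
    fix W assume W: "openin X W"
    have "{y \<in> Some ` topspace X. the y \<in> W} = Some ` W" using openin_subset [OF W] by auto
    then show "{y \<in> space (restrict_space (extend_isolated X \<mu>) (Some ` topspace X)). the y \<in> W}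
        \<in> sets (restrict_space (extend_isolated X \<mu>) (Some ` topspace X))"
    proof -
      have "Some ` W \<in> sets (extend_isolated X \<mu>)"
        by (simp add: extend_isolated_def openin_sets_borel_of op [OF W])
      moreover have "Some ` W \<subseteq> Some ` topspace X" using openin_subset [OF W] by blast
      ultimately show ?thesis
        using E unfolding spR \<open>{y \<in> Some ` topspace X. the y \<in> W} = Some ` W\<close>
        by (simp add: sets_restrict_space_iff)
    qed
  qed (auto simp: spR)
  fix A assume "A \<in> sets (restrict_isolated X (extend_isolated X \<mu>))"
  then have A: "A \<in> sets (borel_of X)" by (simp add: restrict_isolated_def)
  let ?A = "the -` A \<inter> Some ` topspace X"
  have "?A \<in> sets (restrict_space (extend_isolated X \<mu>) (Some ` topspace X))"
    using measurable_sets [OF the A] by (simp add: spR)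
  then have A': "?A \<in> sets (extend_isolated X \<mu>)" using E by (simp add: sets_restrict_space_iff)
  have "emeasure (restrict_isolated X (extend_isolated X \<mu>)) A
      = emeasure (restrict_space (extend_isolated X \<mu>) (Some ` topspace X)) ?A"
    by (simp add: restrict_isolated_def emeasure_distr [OF the A] spR)
  also have "\<dots> = emeasure (extend_isolated X \<mu>) ?A"
    using E by (intro emeasure_restrict_space) auto
  also have "\<dots> = emeasure \<mu> (Some -` ?A \<inter> space \<mu>)"
  proof -
    have "Some \<in> \<mu> \<rightarrow>\<^sub>M borel_of ?Y"
      using Some_measurable_borel_of [of X] measurable_cong_sets [OF assms refl] by blast
    then show ?thesis using A' unfolding extend_isolated_def by (intro emeasure_distr) simp_all
  qed
  also have "Some -` ?A \<inter> space \<mu> = A"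
    using sets.sets_into_space [OF A] by (auto simp: sp)
  finally show "emeasure (restrict_isolated X (extend_isolated X \<mu>)) A = emeasure \<mu> A" .
qed

lemma compactly_supported_bounded:
  assumes "compactly_supported X \<phi>"
  obtains B where "\<And>x. x \<in> topspace X \<Longrightarrow> \<bar>\<phi> x\<bar> \<le> B"
proof -
  obtain K where K: "continuous_map X euclidean \<phi>" "compactin X K"
      "\<And>x. x \<in> topspace X - K \<Longrightarrow> \<phi> x = 0"
    using assms unfolding compactly_supported_def by blast
  have "compact (\<phi> ` K)" using image_compactin [OF K(2,1)] by simp
  then have "bounded (\<phi> ` K)" by (rule compact_imp_bounded)
  then obtain B where "\<forall>y\<in>\<phi> ` K. norm y \<le> B" unfolding bounded_iff by blast
  then have B: "\<bar>\<phi> x\<bar> \<le> B" if "x \<in> K" for x using that by simp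
  have "\<bar>\<phi> x\<bar> \<le> max 0 B" if "x \<in> topspace X" for x
  proof (cases "x \<in> K")
    case True
    then show ?thesis using B [of x] by linarith
  qed (use K(3) that in simp)
  then show ?thesis by (rule that)
qed

theorem theoremD28:
  fixes ket :: "('n::finite, 'p::prime_card) qray \<Rightarrow> ('n, 'p) qvec"
    and U :: "('n, 'p) qray \<Rightarrow> ('n, 'p) qray set"
    and \<kappa> :: "('n, 'p) qray \<Rightarrow> ('n, 'p) qray \<Rightarrow> ('n, 'p) qvec"
    and \<eta> :: "('n, 'p) qray \<Rightarrow> ('n, 'p) qvec \<Rightarrow> ('n, 'p) qvec"
    and \<rho> :: "('n, 'p) qray \<Rightarrow> real"
    and a :: "'p mod_ring" and j0 :: 'n
    and stat :: "real \<Rightarrow> ('n, 'p) qray measure"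
    and tstat :: "(('n, 'p) qray \<times> ('n, 'p) qvec) measure"
  defines "Xhat \<equiv> blowup_space ket"
  defines "law \<equiv> (\<lambda>\<theta>. blowup_law ket U \<kappa> \<theta> (stat \<theta>))"
  defines "Phat \<equiv> tangent_kernel ket U \<kappa> a j0"
  assumes a: "a \<noteq> 0"
    and ket: "\<And>s. s \<in> stabilizer_states \<Longrightarrow> norm (ket s) = 1 \<and> ray_of (ket s) = s"
    and charts: "admissible_charts ket U \<kappa> \<eta> \<rho>"
    and stat: "\<And>\<theta>. 0 < \<theta> \<Longrightarrow> \<theta> \<le> 1 \<Longrightarrow> invariant_prob borel (chain_kernel a j0 \<theta>) (stat \<theta>)"
    and tstat: "invariant_prob (borel_of Xhat) Phat tstat"
  shows "(\<forall>\<theta> \<zeta>. (\<forall>n::nat. 0 < \<theta> n \<and> \<theta> n \<le> 1) \<and> \<theta> \<longlonglongrightarrow> 0 \<and>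
            sets \<zeta> = sets (borel_of (add_isolated Xhat)) \<and> prob_space \<zeta> \<and>
            weak_conv_on (add_isolated Xhat) (\<lambda>n. law (\<theta> n)) \<zeta> sequentially \<longrightarrow>
            measure \<zeta> {None} = 0 \<and>
            prob_space (restrict_isolated Xhat \<zeta>) \<and>
            (\<forall>\<phi>. compactly_supported Xhat \<phi> \<longrightarrow>
               (\<integral>x. \<phi> x \<partial>restrict_isolated Xhat \<zeta>) =
               (\<integral>x. (\<integral>y. \<phi> y \<partial>Phat x) \<partial>restrict_isolated Xhat \<zeta>)) \<and>
            \<zeta> = extend_isolated Xhat tstat) \<and>
         weak_conv_on (add_isolated Xhat) law (extend_isolated Xhat tstat) (at_right 0)"
proof -
  \<comment> \<open>One stationary law is enough, and \<theta> = 1 is an admissible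
    parameter.\<close>
  have fin: "finite (proj_clifford :: ('n, 'p) qop set set)"
    by (rule finite_proj_clifford [OF stat [of 1]]) simp_all
  have inv: "invariant_prob (borel_of (blowup_space ket)) (tangent_kernel ket U \<kappa> a j0) tstat"
    using tstat by (simp add: Xhat_def Phat_def)
  interpret blowup_chain ket U \<kappa> \<eta> \<rho> a j0 stat
  proof
    show "\<And>s J. s \<in> stabilizer_states \<Longrightarrow> J \<in> branches \<Longrightarrow>
        branch_prob a j0 J 0 s > 0 \<Longrightarrow>
        branch_map a j0 J 0 s \<in> stabilizer_states"
      by (rule branch_map_stabilizer_states [OF fin inv])
  qed (rule ket charts fin stat; assumption)+
  let ?Y = "add_isolated Xhat" and ?\<nu> = "extend_isolated Xhat tstat"
  interpret tstat: prob_space tstat using inv by (simp add: invariant_prob_def)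
  have st: "sets tstat = sets (borel_of (blowup_space ket))" using inv by (simp add: invariant_prob_def)
  have Some: "Some \<in> tstat \<rightarrow>\<^sub>M borel_of ?Y"
    unfolding Xhat_def using Some_measurable_borel_of measurable_cong_sets [OF st refl] by blast
  have \<nu>: "prob_space ?\<nu>" "sets ?\<nu> = sets (borel_of ?Y)"
    unfolding extend_isolated_def using tstat.prob_space_distr [OF Some] by simp_all
  have conv: "weak_conv_on ?Y law ?\<nu> (at_right 0)"
    unfolding weak_conv_on_def
  proof (intro allI impI, elim conjE)
    fix f :: "_ \<Rightarrow> real" assume f: "continuous_map ?Y euclidean f" "bounded (f ` topspace ?Y)"
    obtain B where B: "\<And>x. x \<in> topspace ?Y \<Longrightarrow> \<bar>f x\<bar> \<le> B"
        using f(2) unfolding bounded_iff by auto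
    have fm: "f \<in> borel_measurable (borel_of ?Y)" by (rule continuous_map_borel_measurable [OF f(1)])
    \<comment> \<open>A test function on the extended space is recovered from its value at
      \<open>None\<close> and its restriction to the blow-up space.\<close>
    have "((\<lambda>\<theta>. \<integral>\<psi>. with_None (f None) (\<lambda>x. f (Some x)) (blowup_map U \<kappa> \<theta> \<psi>) \<partial>stat \<theta>)
        \<longlongrightarrow> (\<integral>x. f (Some x) \<partial>tstat)) (at_right 0)"
    proof (rule blown_up_integral_tendsto [OF inv, where B = B])
      show "continuous_map (blowup_space ket) euclidean (\<lambda>x. f (Some x))"
        using f(1) by (simp add: continuous_map_add_isolated Xhat_def)
      show "\<bar>f (Some x)\<bar> \<le> B" if "x \<in> topspace (blowup_space ket)" for x
        using B that by (simp add: topspace_add_isolated Xhat_def)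
      show "\<bar>f None\<bar> \<le> B" using B by (simp add: topspace_add_isolated)
    qed
    moreover have "with_None (f None) (\<lambda>x. f (Some x)) = f"
      by (auto simp: with_None_def fun_eq_iff split: option.split)
    moreover have "(\<integral>x. f (Some x) \<partial>tstat) = (\<integral>x. f x \<partial>?\<nu>)"
      unfolding extend_isolated_def using integral_distr [OF Some fm] by simp
    ultimately have lim: "((\<lambda>\<theta>. \<integral>\<psi>. f (blowup_map U \<kappa> \<theta> \<psi>) \<partial>stat \<theta>) \<longlongrightarrow> (\<integral>x. f x \<partial>?\<nu>)) (at_right 0)"
      by simp
    have "\<forall>\<^sub>F \<theta> in at_right 0. (\<integral>\<psi>. f (blowup_map U \<kappa> \<theta> \<psi>) \<partial>stat \<theta>) = (\<integral>x. f x \<partial>law \<theta>)"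
      using eventually_unit
    proof eventually_elim
      case (elim \<theta>)
      then have "sets (stat \<theta>) = sets borel" using stat by (simp add: invariant_prob_def)
      then have "blowup_map U \<kappa> \<theta> \<in> stat \<theta> \<rightarrow>\<^sub>M borel_of ?Y"
        using blowup_map_measurable [of \<theta>] measurable_cong_sets [of "stat \<theta>"
            borel] unfolding Xhat_def by blast
      from integral_distr [OF this fm] show ?case
        by (simp add: law_def blowup_law_def Xhat_def)
    qed
    then show "((\<lambda>\<theta>. \<integral>x. f x \<partial>law \<theta>) \<longlongrightarrow> (\<integral>x. f x \<partial>?\<nu>)) (at_right 0)"
      by (rule Lim_transform_eventually [OF lim])
  qed
  \<comment> \<open>Along the sequence the laws also converge to \<open>?\<nu>\<close>, so \<zeta>
    and \<open>?\<nu>\<close> integrate bounded continuous functions alike.\<close>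
  have eq: "\<zeta> = ?\<nu>"
    if \<theta>: "\<And>n. 0 < \<theta> n" "\<theta> \<longlonglongrightarrow> 0"
      and \<zeta>: "sets \<zeta> = sets (borel_of ?Y)" "prob_space \<zeta>"
          "weak_conv_on ?Y (\<lambda>n. law (\<theta> n)) \<zeta> sequentially" for \<theta> :: "nat \<Rightarrow> real" and \<zeta>
  proof (rule measure_eq_from_continuous)
    show "prob_space \<zeta>" "prob_space ?\<nu>" by (rule \<zeta> \<nu>)+
    show "sets \<zeta> = sets (borel_of (add_isolated (blowup_space ket)))"
      "sets ?\<nu> = sets (borel_of (add_isolated (blowup_space ket)))"
      using \<zeta> \<nu> by (simp_all add: Xhat_def)
    fix f :: "_ \<Rightarrow> real"
    assume f: "continuous_map (add_isolated (blowup_space ket)) euclidean f"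
      "bounded (f ` topspace (add_isolated (blowup_space ket)))"
    have "filterlim \<theta> (at_right 0) sequentially"
      using \<theta> by (intro tendsto_imp_filterlim_at_right) auto
    moreover have "((\<lambda>\<theta>. \<integral>x. f x \<partial>law \<theta>) \<longlongrightarrow> (\<integral>x. f x \<partial>?\<nu>)) (at_right 0)"
      using conv f unfolding weak_conv_on_def Xhat_def by blast
    ultimately have "(\<lambda>n. \<integral>x. f x \<partial>law (\<theta> n)) \<longlonglongrightarrow> (\<integral>x. f x \<partial>?\<nu>)"
      by (rule filterlim_compose [rotated])
    moreover have "(\<lambda>n. \<integral>x. f x \<partial>law (\<theta> n)) \<longlonglongrightarrow> (\<integral>x. f x \<partial>\<zeta>)"
      using \<zeta>(3) f unfolding weak_conv_on_def Xhat_def by blast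
    ultimately show "(\<integral>x. f x \<partial>\<zeta>) = (\<integral>x. f x \<partial>?\<nu>)" using LIMSEQ_unique by blast
  qed
  have restrict: "restrict_isolated Xhat ?\<nu> = tstat"
    by (rule restrict_extend_isolated) (simp add: st Xhat_def)
  have "openin ?Y {None}" by (simp add: openin_add_isolated vimage_def)
  then have "{None} \<in> sets (borel_of ?Y)" by (rule openin_sets_borel_of)
  then have "emeasure ?\<nu> {None} = emeasure tstat (Some -` {None} \<inter> space tstat)"
    unfolding extend_isolated_def by (rule emeasure_distr [OF Some])
  then have None: "measure ?\<nu> {None} = 0" by (simp add: measure_def vimage_def)
  \<comment> \<open>With \<zeta> already identified, its balance equation is the invariance of
    \<open>tstat\<close>; compact support supplies the bound on \<phi>.\<close>
  have balance: "(\<integral>x. \<phi> x \<partial>tstat) = (\<integral>x. (\<integral>y. \<phi> y \<partial>Phat x) \<partial>tstat)" if \<phi>: "compactly_supported Xhat \<phi>" for \<phi>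
  proof -
    obtain B where B: "\<And>x. x \<in> topspace Xhat \<Longrightarrow> \<bar>\<phi> x\<bar> \<le> B"
        by (rule compactly_supported_bounded [OF \<phi>]) blast
    have m: "\<phi> \<in> borel_measurable (borel_of (blowup_space ket))"
      using \<phi> unfolding compactly_supported_def Xhat_def by (blast intro: continuous_map_borel_measurable)
    have "(\<integral>x. \<phi> x \<partial>tstat) = (\<integral>x. branch_mean branches hat_weight hat_map \<phi> x \<partial>tstat)"
      using hat.integral_branch_mean [OF inv m, of B] B by (simp add: Xhat_def)
    also have "\<dots> = (\<integral>x. (\<integral>y. \<phi> y \<partial>Phat x) \<partial>tstat)"
      using sets_eq_imp_space_eq [OF st]
      by (intro Bochner_Integration.integral_cong) (simp_all add: Phat_def hat.integral_kernel m)
    finally show ?thesis .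
  qed
  show ?thesis
  proof (intro conjI allI impI; (elim conjE)?)
    show "weak_conv_on ?Y law ?\<nu> (at_right 0)" by (rule conv)
  next
    fix \<theta> :: "nat \<Rightarrow> real" and \<zeta>
    assume "\<forall>n. 0 < \<theta> n \<and> \<theta> n \<le> 1" "\<theta> \<longlonglongrightarrow> 0" "sets \<zeta> = sets (borel_of ?Y)" "prob_space \<zeta>"
      "weak_conv_on ?Y (\<lambda>n. law (\<theta> n)) \<zeta> sequentially"
    then have \<zeta>: "\<zeta> = ?\<nu>" using eq by blast
    then show "\<zeta> = ?\<nu>" .
    show "measure \<zeta> {None} = 0" unfolding \<zeta> by (rule None)
    show "prob_space (restrict_isolated Xhat \<zeta>)" unfolding \<zeta> restrict by (rule tstat.prob_space_axioms)
    fix \<phi> assume "compactly_supported Xhat \<phi>"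
    then show "(\<integral>x. \<phi> x \<partial>restrict_isolated Xhat \<zeta>) = (\<integral>x. (\<integral>y. \<phi> y \<partial>Phat x) \<partial>restrict_isolated Xhat \<zeta>)"
      unfolding \<zeta> restrict by (rule balance)
  qed
qed

end
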